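(* Let $r\in\mathbb{N}$ and let $\alpha_1,\ldots,\alpha_r$ be real numbers with $0<\alpha_j<1$ that are algebraically independent over $\mathbb{Q}$. For $j=1,\ldots,r$ let $l(j)\in\mathbb{N}$, put $\lambda=l(1)+\cdots+l(r)$, and for $1\leq l\leq l(j)$ let $\mathfrak{B}_{jl}=\{b_{mjl}\in\mathbb{C}: m\in\mathbb{N}_0\}$ be a periodic sequence (not all terms zero) with minimal period $k_{jl}$. Let $k_j$ be the least common multiple of $k_{j1},\ldots,k_{jl(j)}$, and let $B_j$ be the $k_j\times l(j)$ matrix $(b_{mjl})_{1\leq m\leq k_j,\,1\leq l\leq l(j)}$. Suppose $\mathrm{rank}\,B_j=l(j)$ for $1\leq j\leq r$, and that $\varphi(s)$ belongs to the class $\widetilde S$. Let $N\in\mathbb{N}$, $n\in\mathbb{N}_0$, and for each $j=0,\ldots,n$ let $F_j:\mathbb{C}^{N(\lambda+1)}\to\mathbb{C}$ be continuous. Suppose that the function $$\sum_{j=0}^n s^j\cdot F_j\Big(\varphi(s),\varphi'(s),\ldots,\varphi^{(N-1)}(s),\ \big(\zeta^{(i)}(s,\alpha_1;\mathfrak{B}_{11})\big)_{i=0}^{N-1},\ldots,\big(\zeta^{(i)}(s,\alpha_1;\mathfrak{B}_{1l(1)})\big)_{i=0}^{N-1},\ldots,\big(\zeta^{(i)}(s,\alpha_r;\mathfrak{B}_{r1})\big)_{i=0}^{N-1},\ldots,\big(\zeta^{(i)}(s,\alpha_r;\mathfrak{B}_{rl(r)})\big)_{i=0}^{N-1}\Big)$$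 is identically zero, where each block $(\zeta^{(i)}(s,\alpha_j;\mathfrak{B}_{jl}))_{i=0}^{N-1}$ lists $\zeta(s,\alpha_j;\mathfrak{B}_{jl}),\zeta'(s,\alpha_j;\mathfrak{B}_{jl}),\ldots,\zeta^{(N-1)}(s,\alpha_j;\mathfrak{B}_{jl})$ in this order. Then $F_j\equiv 0$ for $j=0,\ldots,n$.
   Context: Write $s=\sigma+it$. For a periodic sequence $\mathfrak{B}=\{b_m: m\in\mathbb{N}_0\}$ of complex numbers (not all zero) with minimal period $k$ and $0<\alpha\leq 1$, the periodic Hurwitz zeta-function is $\zeta(s,\alpha;\mathfrak{B})=\sum_{m=0}^\infty b_m (m+\alpha)^{-s}$ for $\sigma>1$; since $\zeta(s,\alpha;\mathfrak{B})=k^{-s}\sum_{l=0}^{k-1}b_l\zeta(s,\frac{l+\alpha}{k})$ with $\zeta(s,\cdot)$ the Hurwitz zeta-function, it extends meromorphically to $\mathbb{C}$ with at most a simple pole at $s=1$. The class $\widetilde S$ consists of functions $\varphi(s)$ satisfying: (i) $\varphi(s)=\sum_{m=1}^\infty a(m)m^{-s}$ with $a(m)=O(m^{\varepsilon})$ for every $\varepsilon>0$; (ii) there is $\sigma_\varphi<1$ such that $\varphi$ continues meromorphically to $\sigma>\sigma_\varphi$; (iii) there is $c\geq 0$ with $\varphi(\sigma+it)=O(|t|^{c+\varepsilon})$ for every fixed $\sigma>\sigma_\varphi$ and every $\varepsilon>0$; (iv) there are $l\in\mathbb{N}$ and complex numbers $a_j(p)$ such that $\varphi(s)=\prod_{p}\prod_{j=1}^{l}(1-a_j(p)p^{-s})^{-1}$,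 the product over primes; (v) there is $\kappa>0$ with $\lim_{x\to\infty}\frac{1}{\pi(x)}\sum_{p\leq x}|a(p)|^2=\kappa$, where $\pi(x)$ is the number of primes $\leq x$. *)

theory Defs
  imports
    "HOL-Complex_Analysis.Complex_Analysis"
    "HOL-Library.Poly_Mapping"
    "HOL-Library.Landau_Symbols"
    "HOL-Computational_Algebra.Primes"
    "Jordan_Normal_Form.DL_Rank"
begin

text \<open>
  Polynomials over the rationals in the variables with indices in \<open>I\<close> are represented as
  finitely supported maps from exponent vectors (themselves finitely supported maps) to coefficients.
\<close>

type_synonym rat_mpoly = "(nat \<Rightarrow>\<^sub>0 nat) \<Rightarrow>\<^sub>0 rat"

definition rat_mpolys_in :: "nat set \<Rightarrow> rat_mpoly set" where
  "rat_mpolys_in I = {P. \<forall>e\<in>Poly_Mapping.keys P. Poly_Mapping.keys e \<subseteq> I}"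

definition eval_rat_mpoly :: "(nat \<Rightarrow> real) \<Rightarrow> rat_mpoly \<Rightarrow> real" where
  "eval_rat_mpoly x P =
     (\<Sum>e\<in>Poly_Mapping.keys P. of_rat (Poly_Mapping.lookup P e) *
        (\<Prod>i\<in>Poly_Mapping.keys e. x i ^ Poly_Mapping.lookup e i))"

definition algebraically_independent_rat :: "nat set \<Rightarrow> (nat \<Rightarrow> real) \<Rightarrow> bool" where
  "algebraically_independent_rat I x \<longleftrightarrow>
     (\<forall>P\<in>rat_mpolys_in I. eval_rat_mpoly x P = 0 \<longrightarrow> P = 0)"

definition is_period :: "(nat \<Rightarrow> complex) \<Rightarrow> nat \<Rightarrow> bool" where
  "is_period b k \<longleftrightarrow> k > 0 \<and> (\<forall>m. b (m + k) = b m)"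

definition is_minimal_period :: "(nat \<Rightarrow> complex) \<Rightarrow> nat \<Rightarrow> bool" where
  "is_minimal_period b k \<longleftrightarrow> is_period b k \<and> (\<forall>k'. is_period b k' \<longrightarrow> k \<le> k')"

text \<open>
  The periodic Hurwitz zeta-function on the whole plane is the meromorphic continuation of its
  Dirichlet series. Being nicely meromorphic fixes the values at removable singularities (by
  continuity) and at poles (as \<open>0\<close>), so the continuation is unique as a total function, as
  the lemma \<open>periodic_hurwitz_zeta_eqI\<close> below shows.
\<close>

definition is_periodic_hurwitz_zeta ::
    "real \<Rightarrow> (nat \<Rightarrow> complex) \<Rightarrow> (complex \<Rightarrow> complex) \<Rightarrow> bool" where
  "is_periodic_hurwitz_zeta \<alpha> b f \<longleftrightarrow>
     f nicely_meromorphic_on UNIV \<and>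
     (\<forall>s. Re s > 1 \<longrightarrow> (\<lambda>m. b m * of_real (real m + \<alpha>) powr (- s)) sums f s)"

definition periodic_hurwitz_zeta :: "real \<Rightarrow> (nat \<Rightarrow> complex) \<Rightarrow> complex \<Rightarrow> complex" where
  "periodic_hurwitz_zeta \<alpha> b = (THE f. is_periodic_hurwitz_zeta \<alpha> b f)"

lemma is_periodic_hurwitz_zeta_unique:
  assumes "is_periodic_hurwitz_zeta \<alpha> b f" "is_periodic_hurwitz_zeta \<alpha> b g"
  shows "f = g"
proof -
  have nice: "f nicely_meromorphic_on UNIV" "g nicely_meromorphic_on UNIV"
    using assms by (auto simp: is_periodic_hurwitz_zeta_def)
  define h where "h = remove_sings (\<lambda>z. f z - g z)"
  have mero: "(\<lambda>z. f z - g z) meromorphic_on UNIV"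
    using nice unfolding nicely_meromorphic_on_def by (intro meromorphic_intros) auto
  have h: "h nicely_meromorphic_on UNIV"
    unfolding h_def by (rule remove_sings_nicely_meromorphic[OF mero])
  have ev_h: "eventually (\<lambda>w. h w = f w - g w) (at z)" for z
    unfolding h_def
    by (rule eventually_remove_sings_eq_at)
       (use mero in \<open>auto intro: meromorphic_on_isolated_singularity meromorphic_on_subset\<close>)
  have "eventually (\<lambda>w::complex. w \<in> {w. Re w > 1}) (at 2)"
    by (rule eventually_at_in_open') (auto simp: open_halfspace_Re_gt)
  hence "eventually (\<lambda>w. h w = 0) (at 2)"
    using ev_h[of 2]
  proof eventually_elim
    case (elim w)
    hence "f w = g w"
      using assms unfolding is_periodic_hurwitz_zeta_def by (auto intro: sums_unique2)
    with elim show ?case by simp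
  qed
  hence "frequently (\<lambda>w. h w = 0) (at 2)"
    by (intro eventually_frequently) auto
  hence h0: "h w = 0" for w
    by (rule frequently_eq_meromorphic_imp_constant[OF _ h]) auto
  show ?thesis
  proof
    fix z
    have ev: "eventually (\<lambda>w. f w = g w) (at z)"
      using ev_h[of z] by eventually_elim (simp add: h0)
    have pole: "is_pole f z \<longleftrightarrow> is_pole g z"
      using ev by (intro is_pole_cong refl)
    have f: "is_pole f z \<and> f z = 0 \<or> f \<midarrow>z\<rightarrow> f z" and g: "is_pole g z \<and> g z = 0 \<or> g \<midarrow>z\<rightarrow> g z"
      using nice by (auto simp: nicely_meromorphic_on_def)
    show "f z = g z"
    proof (cases "is_pole f z")
      case True
      hence "\<not> f \<midarrow>z\<rightarrow> f z" "\<not> g \<midarrow>z\<rightarrow> g z"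
        using pole not_tendsto_and_filterlim_at_infinity[of "at z"]
        unfolding is_pole_def by fastforce+
      with f g show ?thesis by auto
    next
      case False
      hence "f \<midarrow>z\<rightarrow> f z" "g \<midarrow>z\<rightarrow> g z"
        using f g pole by auto
      moreover from this have "f \<midarrow>z\<rightarrow> g z"
        using tendsto_cong[OF ev] by blast
      ultimately show ?thesis
        using LIM_unique by blast
    qed
  qed
qed

lemma periodic_hurwitz_zeta_eqI:
  assumes "is_periodic_hurwitz_zeta \<alpha> b f"
  shows "periodic_hurwitz_zeta \<alpha> b = f"
  unfolding periodic_hurwitz_zeta_def
  using assms is_periodic_hurwitz_zeta_unique by (blast intro: the_equality)

text \<open>
  The class \<open>S\<close> with a tilde, with the abscissa \<open>\<sigma>0 < 1\<close> of the half-plane of continuation as an explicit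
  parameter. The growth bound is meant for \<open>|t| \<rightarrow> \<infinity>\<close>, with a constant that may depend on
  \<open>\<sigma>\<close> and \<open>\<epsilon>\<close>. The condition that no Euler factor has a vanishing denominator is what makes the
  inverses meaningful (HOL has \<open>inverse 0 = 0\<close>).
\<close>

definition in_class_S_tilde :: "real \<Rightarrow> (complex \<Rightarrow> complex) \<Rightarrow> bool" where
  "in_class_S_tilde \<sigma>0 \<phi> \<longleftrightarrow>
     \<sigma>0 < 1 \<and> \<phi> nicely_meromorphic_on {s. Re s > \<sigma>0} \<and>
     (\<exists>c\<ge>0. \<forall>\<sigma>>\<sigma>0. \<forall>\<epsilon>>0.
        (\<lambda>t. norm (\<phi> (Complex \<sigma> t))) \<in> O[at_infinity](\<lambda>t::real. \<bar>t\<bar> powr (c + \<epsilon>))) \<and>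
     (\<exists>a :: nat \<Rightarrow> complex.
        (\<forall>\<epsilon>>0. (\<lambda>m. norm (a m)) \<in> O(\<lambda>m. real m powr \<epsilon>)) \<and>
        (\<forall>s. Re s > 1 \<longrightarrow> (\<lambda>m. a (Suc m) * of_nat (Suc m) powr (- s)) sums \<phi> s) \<and>
        (\<exists>l>0. \<exists>A :: nat \<Rightarrow> nat \<Rightarrow> complex. \<forall>s. Re s > 1 \<longrightarrow>
           (\<forall>p j. prime p \<longrightarrow> j \<in> {1..l} \<longrightarrow> 1 - A j p * of_nat p powr (- s) \<noteq> 0) \<and>
           (\<lambda>p. if prime p then \<Prod>j=1..l. inverse (1 - A j p * of_nat p powr (- s)) else 1)
             has_prod \<phi> s) \<and>
        (\<exists>\<kappa>>0. ((\<lambda>x::real. (\<Sum>p | prime p \<and> real p \<le> x. (norm (a p))\<^sup>2) /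
                  real (card {p::nat. prime p \<and> real p \<le> x})) \<longlongrightarrow> \<kappa>) at_top))"

definition derivs_list :: "nat \<Rightarrow> (complex \<Rightarrow> complex) \<Rightarrow> complex \<Rightarrow> complex list" where
  "derivs_list N f s = map (\<lambda>i. (deriv ^^ i) f s) [0..<N]"

definition zeta_args ::
    "nat \<Rightarrow> (complex \<Rightarrow> complex) \<Rightarrow> nat \<Rightarrow> (nat \<Rightarrow> nat) \<Rightarrow>
     (nat \<Rightarrow> nat \<Rightarrow> complex \<Rightarrow> complex) \<Rightarrow> complex \<Rightarrow> complex list" where
  "zeta_args N \<phi> r l Z s =
     derivs_list N \<phi> s @
     concat (map (\<lambda>j. concat (map (\<lambda>i. derivs_list N (Z j i) s) [1..<Suc (l j)])) [1..<Suc r])"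

lemma length_zeta_args:
  "length (zeta_args N \<phi> r l Z s) = N * ((\<Sum>j=1..r. l j) + 1)"
proof -
  have "sum_list (map l [1..<Suc r]) = (\<Sum>j=1..r. l j)"
    unfolding interv_sum_list_conv_sum_set_nat set_upt atLeastLessThanSuc_atLeastAtMost ..
  thus ?thesis
    by (simp add: zeta_args_def derivs_list_def length_concat o_def sum_list_triv
          sum_list_const_mult algebra_simps del: upt_Suc)
qed

text \<open>
  The space of complex \<open>d\<close>-tuples is rendered as the set of extensional functions on the index
  set \<open>{..<d}\<close> with its product topology.
\<close>

definition complex_space :: "nat \<Rightarrow> (nat \<Rightarrow> complex) topology" where
  "complex_space d = product_topology (\<lambda>_. euclidean) {..<d}"

definition tuple_of_list :: "complex list \<Rightarrow> nat \<Rightarrow> complex" where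
  "tuple_of_list xs = restrict (\<lambda>i. xs ! i) {..<length xs}"

lemma tuple_of_list_in_space: "tuple_of_list xs \<in> topspace (complex_space (length xs))"
  by (auto simp: tuple_of_list_def complex_space_def)

end

theory Submission
  imports Defs "HOL-Number_Theory.Prime_Powers" "HOL-Number_Theory.Cong"
begin

text \<open>
  Everything happens in the half plane of absolute convergence: for \<open>\<sigma> > 1\<close> the vectors of values
  \<open>\<phi>\<^sup>(\<^sup>\<nu>\<^sup>)(s)\<close>, \<open>\<zeta>\<^sup>(\<^sup>\<nu>\<^sup>)(s, \<alpha>\<^sub>j; b\<^sub>j\<^sub>l)\<close> are already dense in \<open>\<complex>\<^sup>N\<^sup>(\<^sup>\<lambda>\<^sup>+\<^sup>1\<^sup>)\<close>, even along \<open>|Im s| \<rightarrow> \<infinity>\<close>.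
  By algebraic independence of the \<open>\<alpha>\<^sub>j\<close> the numbers \<open>ln p\<close> and \<open>ln (m + \<alpha>\<^sub>j)\<close> are linearly
  independent over the rationals, so by Kronecker's theorem the phases \<open>p\<^sup>-\<^sup>i\<^sup>t\<close> and \<open>(m + \<alpha>\<^sub>j)\<^sup>-\<^sup>i\<^sup>t\<close>
  approximate arbitrary unimodular numbers. It remains to see that the twisted series
  \<open>\<Sum> \<omega>\<^sub>m v\<^sub>m (m + \<alpha>)\<^sup>-\<^sup>\<sigma>\<close> take values close to any prescribed vector once \<open>\<sigma>\<close> is near 1. This holds
  because \<open>\<Sum> |\<langle>v\<^sub>m, u\<rangle>| / (m + \<alpha>)\<close> diverges for all \<open>u \<noteq> 0\<close> (here the rank condition enters, and for
  \<open>log \<phi>\<close> the lower bound on the mean of \<open>|a(p)|\<^sup>2\<close>), while \<open>\<Sum> |v\<^sub>m|\<^sup>2 / (m + \<alpha>)\<^sup>2\<close> converges.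
  The function \<open>\<phi>\<close> is recovered from the derivatives of \<open>log \<phi>\<close>, at the cost of excluding the value 0.
  Finally, dividing the relation by \<open>s\<^sup>n\<close> along such a sequence shows \<open>F\<^sub>n = 0\<close>, and one descends on \<open>n\<close>.
\<close>

section \<open>Approximation by series with unimodular coefficients\<close>

text \<open>The delicate function is log \<phi>. Its coefficients live on prime powers, and the
  phase of p^k is forced to be the k-th power of the phase of p. Only the primes can be twisted
  freely; the higher powers must form an absolutely convergent perturbation, which rests on |a_j(p)|
  \<le> 1. This is not among the axioms of the class and is extracted in two rounds. Non-vanishing
  of the Euler factors gives |a_j(p)| \<le> p, hence a logarithm for Re s > 2 and a recursion for
  a(p^k). As a(m) = O(m^\<epsilon>), the power series with coefficients a(p^k) converges in the unit
  disc; its product with the polynomial of the Euler factor is a nonzero constant, so that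
  polynomial has no root there. The order of choices is decisive: cut-off, bound for the targets
  (terms below the cut-off are moved into the target with phase 1), \<sigma>, phases, and the
  ordinate t last. The zeta-functions are given by a definite description, so their continuation has
  to be constructed before anything is known about their values.\<close>

lemma compact_Pi_UNIV:
  fixes S :: "'a \<Rightarrow> 'b::topological_space set"
  assumes "\<And>i. compact (S i)"
  shows "compact (Pi UNIV S)"
  using compactin_PiE[of "\<lambda>_. euclidean" UNIV S] assms
  by (simp add: euclidean_product_topology PiE_UNIV_domain)

lemma L2_set_norm_power2: "(L2_set (\<lambda>i. norm (u i)) I)\<^sup>2 = (\<Sum>i\<in>I. (norm (u i))\<^sup>2)"
  unfolding L2_set_def by (simp add: sum_nonneg)

lemma norm_add_mult_squared:
  fixes u d w :: complex
  shows "(norm (u + d * w))\<^sup>2 = (norm u)\<^sup>2 + 2 * Re (d * (w * cnj u)) + (norm d)\<^sup>2 * (norm w)\<^sup>2"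
  unfolding cmod_power2 by (simp add: algebra_simps power2_eq_square)

lemma exists_unimodular_mult_eq_norm:
  fixes z :: complex
  obtains c where "norm c = 1" "c * z = of_real (norm z)"
proof (cases "z = 0")
  case True
  thus ?thesis using that[of 1] by simp
next
  case False
  have "cnj (sgn z) * z = of_real (norm z)"
    using False by (simp add: sgn_div_norm mult.commute complex_norm_square[symmetric] scaleR_conv_of_real
        field_simps power2_eq_square del: of_real_mult)
       (simp add: complex_norm_square power2_eq_square)
  moreover have "norm (cnj (sgn z)) = 1" using False by (simp add: norm_sgn)
  ultimately show ?thesis using that by blast
qed

text \<open>
  A minimiser \<open>c\<close> of the distance satisfies, for the residual \<open>u\<close> and every single coordinate
  \<open>m\<close>, the inequality \<open>|\<langle>w m, u\<rangle>| - Re (c m \<langle>w m, u\<rangle>) \<le> 2 |w m|\<^sup>2\<close>;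
  summing over \<open>m\<close> and using the lower bound on \<open>\<Sum>|\<langle>w m, u\<rangle>|\<close> bounds \<open>u\<close>.
\<close>
lemma unimodular_combination_approx:
  fixes w :: "'m \<Rightarrow> 'i \<Rightarrow> complex" and y :: "'i \<Rightarrow> complex"
  assumes S: "finite S" and I: "finite I"
    and big: "\<And>u. R * L2_set (\<lambda>i. norm (u i)) I \<le> (\<Sum>m\<in>S. norm (\<Sum>i\<in>I. w m i * cnj (u i)))"
    and y: "L2_set (\<lambda>i. norm (y i)) I \<le> R"
  obtains c where "\<And>m. norm (c m) = 1"
    "(\<Sum>i\<in>I. (norm (y i - (\<Sum>m\<in>S. c m * w m i)))\<^sup>2) \<le> 2 * (\<Sum>m\<in>S. \<Sum>i\<in>I. (norm (w m i))\<^sup>2)"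
proof -
  define f where "f = (\<lambda>c. \<Sum>i\<in>I. (norm (y i - (\<Sum>m\<in>S. c m * w m i)))\<^sup>2)"
  \<comment> \<open>Every coordinate is constrained, also outside \<open>S\<close>, so that
    \<open>T\<close> is compact by Tychonoff and a minimiser of \<open>f\<close> exists.\<close>
  define T where "T = Pi (UNIV :: 'm set) (\<lambda>_. sphere (0::complex) 1)"
  have "compact T" unfolding T_def by (intro compact_Pi_UNIV) auto
  moreover have "T \<noteq> {}" unfolding T_def by (auto intro!: exI[of _ "\<lambda>_. 1"])
  moreover have "continuous_on T f"
    unfolding f_def
    by (intro continuous_intros) (auto intro: continuous_on_subset[OF continuous_on_product_coordinates])
  ultimately obtain c where c: "c \<in> T" and min: "\<And>c'. c' \<in> T \<Longrightarrow> f c \<le> f c'"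
    using continuous_attains_inf[of T f] by blast
  have c1: "norm (c m) = 1" for m using c by (auto simp: T_def)
  define u where "u = (\<lambda>i. y i - (\<Sum>m\<in>S. c m * w m i))"
  define g where "g = (\<lambda>m. \<Sum>i\<in>I. w m i * cnj (u i))"
  define W where "W = (\<lambda>m. \<Sum>i\<in>I. (norm (w m i))\<^sup>2)"
  have step: "norm (g m) - Re (c m * g m) \<le> 2 * W m" if m: "m \<in> S" for m
  proof -
    \<comment> \<open>The competitor changes only the phase at \<open>m\<close>, to the one that
      turns \<open>g m\<close> into its absolute value.\<close>
    obtain e where e: "norm e = 1" "e * g m = of_real (norm (g m))"
      by (rule exists_unimodular_mult_eq_norm)
    define c' where "c' = c(m := e)"
    have "c' \<in> T" using c e by (auto simp: T_def c'_def)
    hence "f c \<le> f c'" by (rule min)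
    also have "f c' = (\<Sum>i\<in>I. (norm (u i + (c m - e) * w m i))\<^sup>2)"
    proof -
      have "(\<Sum>m\<in>S. c' m * w m i) = (\<Sum>m\<in>S. c m * w m i) - (c m - e) * w m i" for i
        using m S unfolding c'_def
        by (subst (1 2) sum.remove[of _ m]) (auto intro!: sum.cong simp: algebra_simps)
      note eq = this
      show ?thesis unfolding f_def u_def eq by (simp add: algebra_simps)
    qed
    also have "\<dots> = f c + 2 * Re ((c m - e) * g m) + (norm (c m - e))\<^sup>2 * W m"
    proof -
      have "Re ((c m - e) * g m) = (\<Sum>i\<in>I. Re ((c m - e) * (w m i * cnj (u i))))"
        unfolding g_def sum_distrib_left Re_sum ..
      moreover have "f c = (\<Sum>i\<in>I. (norm (u i))\<^sup>2)" unfolding f_def u_def ..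
      ultimately show ?thesis
        unfolding norm_add_mult_squared sum.distrib W_def by (simp only: sum_distrib_left)
    qed
    finally have "0 \<le> 2 * Re ((c m - e) * g m) + (norm (c m - e))\<^sup>2 * W m" by simp
    moreover have "Re ((c m - e) * g m) = Re (c m * g m) - norm (g m)"
      using e by (simp add: left_diff_distrib del: times_complex.simps)
    moreover have "(norm (c m - e))\<^sup>2 * W m \<le> 4 * W m"
    proof (rule mult_right_mono)
      have "norm (c m - e) \<le> 2" using norm_triangle_ineq4[of "c m" e] c1 e by simp
      thus "(norm (c m - e))\<^sup>2 \<le> 4" using power_mono[of _ 2 2] by force
    qed (simp add: W_def sum_nonneg)
    ultimately show ?thesis by simp
  qed
  define U where "U = L2_set (\<lambda>i. norm (u i)) I"
  have U2: "U\<^sup>2 = (\<Sum>i\<in>I. (norm (u i))\<^sup>2)" unfolding U_def by (rule L2_set_norm_power2)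
  have U0: "U \<ge> 0" unfolding U_def by simp
  \<comment> \<open>Pair the residual with itself. By Cauchy-Schwarz the part of \<open>y\<close> is
    at most \<open>R * U\<close>, and \<open>big\<close> at the residual absorbs this into the sum
    of \<open>norm (g m)\<close>; what is left are the defects bounded in
    \<open>step\<close>.\<close>
  have "of_real (U\<^sup>2) = (\<Sum>i\<in>I. u i * cnj (u i))"
    unfolding U2 of_real_sum by (simp only: complex_norm_square)
  also have "\<dots> = (\<Sum>i\<in>I. y i * cnj (u i)) - (\<Sum>i\<in>I. (\<Sum>m\<in>S. c m * w m i) * cnj (u i))"
    by (subst sum_subtractf[symmetric]) (simp add: u_def algebra_simps)
  also have "(\<Sum>i\<in>I. (\<Sum>m\<in>S. c m * w m i) * cnj (u i)) = (\<Sum>m\<in>S. c m * g m)"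
    unfolding g_def sum_distrib_left sum_distrib_right by (subst sum.swap) (simp add: mult.assoc)
  finally have eq: "U\<^sup>2 = Re (\<Sum>i\<in>I. y i * cnj (u i)) - (\<Sum>m\<in>S. Re (c m * g m))"
    by (metis Re_complex_of_real Re_sum minus_complex.simps(1))
  have "Re (\<Sum>i\<in>I. y i * cnj (u i)) \<le> norm (\<Sum>i\<in>I. y i * cnj (u i))" by (rule complex_Re_le_cmod)
  also have "\<dots> \<le> (\<Sum>i\<in>I. \<bar>norm (y i)\<bar> * \<bar>norm (u i)\<bar>)"
    by (rule order_trans[OF norm_sum]) (simp add: norm_mult)
  also have "\<dots> \<le> L2_set (\<lambda>i. norm (y i)) I * U" unfolding U_def by (rule L2_set_mult_ineq)
  also have "\<dots> \<le> R * U" using y U0 by (rule mult_right_mono)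
  also have "\<dots> \<le> (\<Sum>m\<in>S. norm (g m))" using big[of u] unfolding U_def g_def .
  finally have "U\<^sup>2 \<le> (\<Sum>m\<in>S. norm (g m) - Re (c m * g m))"
    using eq by (simp add: sum_subtractf del: times_complex.simps)
  also have "\<dots> \<le> (\<Sum>m\<in>S. 2 * W m)" by (intro sum_mono step)
  finally have "(\<Sum>i\<in>I. (norm (u i))\<^sup>2) \<le> 2 * (\<Sum>m\<in>S. W m)"
    unfolding U2 by (simp add: sum_distrib_left)
  thus ?thesis using that[of c] c1 unfolding u_def W_def by blast
qed

text \<open>A Dini argument: on the unit sphere the partial sums are continuous and increase beyond
  every bound, so the open sets where they exceed \<open>R\<close> form an increasing cover, and by
  compactness a single \<open>M\<close> suffices. Homogeneity removes the normalisation.\<close>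

lemma divergent_forms_uniform:
  fixes v :: "nat \<Rightarrow> 'i \<Rightarrow> complex"
  assumes I: "finite I"
    and div: "\<And>u. \<exists>i\<in>I. u i \<noteq> 0 \<Longrightarrow> \<not> summable (\<lambda>m. norm (\<Sum>i\<in>I. v m i * cnj (u i)))"
  obtains M where "M \<ge> M0"
    "\<And>u. R * L2_set (\<lambda>i. norm (u i)) I \<le> (\<Sum>m=M0..<M. norm (\<Sum>i\<in>I. v m i * cnj (u i)))"
proof -
  define q where "q = (\<lambda>M u. \<Sum>m=M0..<M. norm (\<Sum>i\<in>I. v m i * cnj (u i)))"
  \<comment> \<open>Only coordinates in \<open>I\<close> enter the norm; the polydisc confines the
    others, without which the sphere would not be compact.\<close>
  define T where "T = Pi (UNIV :: 'i set) (\<lambda>_. cball (0::complex) 1) \<inter> {u. L2_set (\<lambda>i. norm (u i)) I = 1}"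
  have cont_q: "continuous_on UNIV (q M)" for M
    unfolding q_def by (intro continuous_intros continuous_on_product_coordinates)
  have "closed {u::'i \<Rightarrow> complex. L2_set (\<lambda>i. norm (u i)) I = 1}"
    unfolding L2_set_def by (intro closed_Collect_eq continuous_intros continuous_on_product_coordinates)
  hence "compact T" unfolding T_def by (intro compact_Int_closed compact_Pi_UNIV) auto
  have mono_q: "q M u \<le> q M' u" if "M \<le> M'" for M M' u
    unfolding q_def using that by (intro sum_mono2) auto
  have cover: "T \<subseteq> (\<Union>M. {u. R < q M u})"
  proof
    fix u assume "u \<in> T"
    hence "L2_set (\<lambda>i. norm (u i)) I \<noteq> 0" by (simp add: T_def)
    hence "\<exists>i\<in>I. u i \<noteq> 0" using I by (auto simp: L2_set_eq_0_iff)
    hence ns: "\<not> summable (\<lambda>m. norm (\<Sum>i\<in>I. v (m + M0) i * cnj (u i)))"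
      using div[of u] summable_iff_shift[of "\<lambda>m. norm (\<Sum>i\<in>I. v m i * cnj (u i))" M0] by simp
    show "u \<in> (\<Union>M. {u. R < q M u})"
    proof (rule ccontr)
      assume "u \<notin> (\<Union>M. {u. R < q M u})"
      hence le: "q M u \<le> R" for M by (auto simp: not_less)
      have "(\<Sum>m<n. norm (\<Sum>i\<in>I. v (m + M0) i * cnj (u i))) \<le> R" for n
      proof -
        have "(\<Sum>m<n. norm (\<Sum>i\<in>I. v (m + M0) i * cnj (u i))) = q (n + M0) u"
          unfolding q_def by (simp add: sum.shift_bounds_nat_ivl[of _ 0 M0 n, simplified] atLeast0LessThan)
        thus ?thesis using le by simp
      qed
      hence "summable (\<lambda>m. norm (\<Sum>i\<in>I. v (m + M0) i * cnj (u i)))"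
        by (intro summableI_nonneg_bounded) auto
      with ns show False by contradiction
    qed
  qed
  have op: "open {u. R < q M u}" for M
    by (intro open_Collect_less cont_q continuous_intros)
  obtain C where C: "finite C" "T \<subseteq> (\<Union>M\<in>C. {u. R < q M u})"
    by (rule compactE_image[OF \<open>compact T\<close> op cover])
  define M where "M = Max (insert M0 C)"
  have big: "R < q M u" if u: "u \<in> T" for u
  proof -
    from u C(2) obtain M' where "M' \<in> C" "R < q M' u" by blast
    moreover have "M' \<le> M" unfolding M_def using \<open>M' \<in> C\<close> C by simp
    ultimately show ?thesis using mono_q[of M' M u] by simp
  qed
  have "R * L2_set (\<lambda>i. norm (u i)) I \<le> q M u" for u
  proof (cases "L2_set (\<lambda>i. norm (u i)) I = 0")
    case True
    thus ?thesis by (simp add: q_def sum_nonneg)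
  next
    case False
    define t where "t = L2_set (\<lambda>i. norm (u i)) I"
    have t: "t > 0" using False unfolding t_def by (simp add: less_le)
    define u' where "u' = (\<lambda>i. if i \<in> I then u i / of_real t else 0)"
    have "L2_set (\<lambda>i. norm (u' i)) I = L2_set (\<lambda>i. norm (u i) * inverse t) I"
      using t by (intro L2_set_cong) (auto simp: u'_def norm_divide divide_inverse norm_inverse norm_mult)
    also have "\<dots> = 1" using t by (subst L2_set_left_distrib[symmetric]) (auto simp: t_def)
    finally have n1: "L2_set (\<lambda>i. norm (u' i)) I = 1" .
    have "norm (u' i) \<le> 1" for i
      using member_le_L2_set[of I i "\<lambda>i. norm (u' i)"] I n1 by (cases "i \<in> I") (auto simp: u'_def)
    hence "u' \<in> T" using n1 by (auto simp: T_def)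
    hence "R < q M u'" by (rule big)
    also have "q M u' = q M u / t"
      unfolding q_def sum_divide_distrib
    proof (intro sum.cong refl)
      fix m
      have "(\<Sum>i\<in>I. v m i * cnj (u' i)) = (\<Sum>i\<in>I. v m i * cnj (u i)) / of_real t"
        unfolding sum_divide_distrib by (intro sum.cong) (auto simp: u'_def)
      thus "norm (\<Sum>i\<in>I. v m i * cnj (u' i)) = norm (\<Sum>i\<in>I. v m i * cnj (u i)) / t"
        using t by (simp add: norm_divide)
    qed
    finally show ?thesis using t unfolding t_def[symmetric] by (simp add: field_simps)
  qed
  moreover have "M \<ge> M0" unfolding M_def using C by simp
  ultimately show ?thesis using that[of M] unfolding q_def by blast
qed

lemma finite_index_uniform_tail:
  fixes f :: "'i \<Rightarrow> nat \<Rightarrow> real"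
  assumes "finite I" and "\<And>i. i \<in> I \<Longrightarrow> summable (f i)" and "\<And>i n. 0 \<le> f i n" and "e > 0"
  obtains M where "\<And>i n. i \<in> I \<Longrightarrow> n \<ge> M \<Longrightarrow> (suminf (\<lambda>m. f i (m + n))) < e"
proof -
  have "\<forall>i\<in>I. eventually (\<lambda>n. (suminf (\<lambda>m. f i (m + n))) < e) sequentially"
  proof
    fix i assume "i \<in> I"
    hence "(\<lambda>n. suminf (\<lambda>m. f i (m + n))) \<longlonglongrightarrow> 0" using assms(2) suminf_exist_split2 by blast
    thus "eventually (\<lambda>n. (suminf (\<lambda>m. f i (m + n))) < e) sequentially"
      using \<open>e > 0\<close> by (rule order_tendstoD)
  qed
  hence "eventually (\<lambda>n. \<forall>i\<in>I. (suminf (\<lambda>m. f i (m + n))) < e) sequentially"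
    using \<open>finite I\<close> by (simp add: eventually_ball_finite)
  thus ?thesis using that unfolding eventually_sequentially by blast
qed

text \<open>The threshold \<open>M1\<close> depends only on \<open>e\<close> and the tails of the
  square sums. The cut-off \<open>M0\<close> and the bound \<open>R\<close> stay free, and only
  \<delta> depends on them, because in the applications \<open>R\<close> must also cover the terms
  below the cut-off.\<close>

lemma twisted_series_approx:
  fixes v :: "nat \<Rightarrow> 'i \<Rightarrow> complex" and x :: "nat \<Rightarrow> real"
  assumes I: "finite I"
    and x0: "\<And>m. x m > 0" and x1: "\<And>m. m \<ge> 1 \<Longrightarrow> x m \<ge> 1"
    and div: "\<And>u. \<exists>i\<in>I. u i \<noteq> 0 \<Longrightarrow> \<not> summable (\<lambda>m. norm (\<Sum>i\<in>I. v m i * cnj (u i)) / x m)"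
    and sq: "\<And>i. i \<in> I \<Longrightarrow> summable (\<lambda>m. (norm (v m i) / x m)\<^sup>2)"
    and abs: "\<And>i \<sigma>. i \<in> I \<Longrightarrow> \<sigma> > 1 \<Longrightarrow> summable (\<lambda>m. norm (v m i) * x m powr - \<sigma>)"
    and e: "e > 0"
  shows "\<exists>M1. \<forall>M0 R. M0 \<ge> M1 \<longrightarrow> (\<exists>\<delta>>0. \<forall>\<sigma>. 1 < \<sigma> \<and> \<sigma> < 1 + \<delta> \<longrightarrow>
     (\<forall>y. (\<forall>i\<in>I. norm (y i) \<le> R) \<longrightarrow> (\<exists>\<omega>. (\<forall>m. norm (\<omega> m) = 1) \<and>
        (\<forall>i\<in>I. norm (y i - (suminf (\<lambda>m. if m < M0 then 0 else \<omega> m * of_real (x m powr - \<sigma>) * v m i))) < e))))"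
proof -
  define n where "n = real (card I) + 1"
  have n: "n > 0" unfolding n_def by simp
  \<comment> \<open>Twice the sum of fewer than \<open>n\<close> such tails is at most (e / 2)^2.
    The 1 added in \<open>n\<close> keeps the quotient meaningful for empty
    \<open>I\<close>.\<close>
  have e': "e\<^sup>2 / (8 * n) > 0" using e n by simp
  obtain M1' where M1': "\<And>i k. i \<in> I \<Longrightarrow> k \<ge> M1' \<Longrightarrow> (suminf (\<lambda>m. (norm (v (m + k) i) / x (m + k))\<^sup>2)) < e\<^sup>2 / (8 * n)"
    by (rule finite_index_uniform_tail[OF I sq _ e']) auto
  define M1 where "M1 = max 1 M1'"
  show ?thesis
  proof (intro exI[of _ M1] allI impI)
    fix M0 R assume M0: "M0 \<ge> M1"
    define R' where "R' = n * max R 0"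
    have "\<And>u. \<exists>i\<in>I. u i \<noteq> 0 \<Longrightarrow> \<not> summable (\<lambda>m. norm (\<Sum>i\<in>I. (v m i / of_real (x m)) * cnj (u i)))"
    proof -
      fix u :: "'i \<Rightarrow> complex" assume "\<exists>i\<in>I. u i \<noteq> 0"
      from div[OF this] show "\<not> summable (\<lambda>m. norm (\<Sum>i\<in>I. (v m i / of_real (x m)) * cnj (u i)))"
        using x0 by (simp add: sum_divide_distrib[symmetric] norm_divide less_imp_le)
    qed
    \<comment> \<open>The factor 2 is a reserve: replacing the exponent 1 by \<sigma> near 1 costs
      at most a factor 2 on the finitely many terms below \<open>M\<close>.\<close>
    from divergent_forms_uniform[OF I this, of M0 "2 * R'"] obtain M where M: "M \<ge> M0"
      "\<And>u. 2 * R' * L2_set (\<lambda>i. norm (u i)) I \<le> (\<Sum>m=M0..<M. norm (\<Sum>i\<in>I. (v m i / of_real (x m)) * cnj (u i)))"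
      by blast
    have "\<forall>m\<in>{..<M}. eventually (\<lambda>\<sigma>. x m powr - (\<sigma> - 1) > 1 / 2) (at_right 1)"
    proof
      fix m
      have "((\<lambda>\<sigma>. x m powr - (\<sigma> - 1)) \<longlongrightarrow> x m powr - (1 - 1)) (at_right 1)"
        using x0[of m] by (intro tendsto_intros) auto
      thus "eventually (\<lambda>\<sigma>. x m powr - (\<sigma> - 1) > 1 / 2) (at_right 1)"
        using x0[of m] by (intro order_tendstoD) auto
    qed
    hence "eventually (\<lambda>\<sigma>. \<forall>m\<in>{..<M}. x m powr - (\<sigma> - 1) > 1 / 2) (at_right 1)"
      by (simp add: eventually_ball_finite)
    then obtain b where b: "b > 1" "\<And>\<sigma> m. 1 < \<sigma> \<Longrightarrow> \<sigma> < b \<Longrightarrow> m < M \<Longrightarrow> x m powr - (\<sigma> - 1) > 1 / 2"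
      unfolding eventually_at_right_field by auto
    show "\<exists>\<delta>>0. \<forall>\<sigma>. 1 < \<sigma> \<and> \<sigma> < 1 + \<delta> \<longrightarrow>
     (\<forall>y. (\<forall>i\<in>I. norm (y i) \<le> R) \<longrightarrow> (\<exists>\<omega>. (\<forall>m. norm (\<omega> m) = 1) \<and>
        (\<forall>i\<in>I. norm (y i - (suminf (\<lambda>m. if m < M0 then 0 else \<omega> m * of_real (x m powr - \<sigma>) * v m i))) < e)))"
    proof (intro exI[of _ "b - 1"] conjI allI impI)
      fix \<sigma> :: real and y :: "'i \<Rightarrow> complex"
      assume \<sigma>: "1 < \<sigma> \<and> \<sigma> < 1 + (b - 1)" and y: "\<forall>i\<in>I. norm (y i) \<le> R"
      \<comment> \<open>Unlike \<open>M\<close>, the end \<open>M2\<close> of the adjusted block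
        depends on \<sigma>. The terms beyond it are small in absolute value, and the extra terms
        between \<open>M\<close> and \<open>M2\<close> only help the lower bound.\<close>
      obtain M2' where M2': "\<And>i k. i \<in> I \<Longrightarrow> k \<ge> M2' \<Longrightarrow> (suminf (\<lambda>m. norm (v (m + k) i) * x (m + k) powr - \<sigma>)) < e / 2"
        by (rule finite_index_uniform_tail[OF I abs[of _ \<sigma>], where e = "e / 2"]) (use \<sigma> e in auto)
      define M2 where "M2 = max M M2'"
      define w where "w = (\<lambda>m i. of_real (x m powr - \<sigma>) * v m i)"
      have L2y: "L2_set (\<lambda>i. norm (y i)) I \<le> R'"
      proof -
        have "L2_set (\<lambda>i. norm (y i)) I \<le> (\<Sum>i\<in>I. norm (y i))" by (rule L2_set_le_sum) auto
        also have "\<dots> \<le> (\<Sum>i\<in>I. max R 0)" using y by (intro sum_mono) auto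
        also have "\<dots> \<le> R'" unfolding R'_def n_def by (simp add: algebra_simps)
        finally show ?thesis .
      qed
      have big: "R' * L2_set (\<lambda>i. norm (u i)) I \<le> (\<Sum>m\<in>{M0..<M2}. norm (\<Sum>i\<in>I. w m i * cnj (u i)))" for u
      proof -
        have "R' * L2_set (\<lambda>i. norm (u i)) I \<le> (\<Sum>m=M0..<M. norm (\<Sum>i\<in>I. (v m i / of_real (x m)) * cnj (u i)) / 2)"
          using M(2)[of u] by (simp add: sum_divide_distrib[symmetric])
        also have "\<dots> \<le> (\<Sum>m=M0..<M. norm (\<Sum>i\<in>I. w m i * cnj (u i)))"
        proof (rule sum_mono)
          fix m assume m: "m \<in> {M0..<M}"
          have "x m powr - \<sigma> = x m powr - (\<sigma> - 1) / x m"
            using x0[of m] by (simp add: powr_diff powr_minus divide_simps)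
          hence "(\<Sum>i\<in>I. w m i * cnj (u i)) = of_real (x m powr - (\<sigma> - 1)) * (\<Sum>i\<in>I. (v m i / of_real (x m)) * cnj (u i))"
            unfolding w_def sum_distrib_left by (intro sum.cong refl) simp
          hence "norm (\<Sum>i\<in>I. w m i * cnj (u i)) = x m powr - (\<sigma> - 1) * norm (\<Sum>i\<in>I. (v m i / of_real (x m)) * cnj (u i))"
            by (simp add: norm_mult)
          moreover have "x m powr - (\<sigma> - 1) \<ge> 1 / 2" using b(2)[of \<sigma> m] \<sigma> m by simp
          ultimately show "norm (\<Sum>i\<in>I. (v m i / of_real (x m)) * cnj (u i)) / 2 \<le> norm (\<Sum>i\<in>I. w m i * cnj (u i))"
            using mult_right_mono[of "1/2" "x m powr - (\<sigma> - 1)" "norm (\<Sum>i\<in>I. (v m i / of_real (x m)) * cnj (u i))"] by simp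
        qed
        also have "\<dots> \<le> (\<Sum>m=M0..<M2. norm (\<Sum>i\<in>I. w m i * cnj (u i)))"
          unfolding M2_def by (intro sum_mono2) auto
        finally show ?thesis .
      qed
      obtain c where c: "\<And>m. norm (c m) = 1"
        "(\<Sum>i\<in>I. (norm (y i - (\<Sum>m\<in>{M0..<M2}. c m * w m i)))\<^sup>2) \<le> 2 * (\<Sum>m\<in>{M0..<M2}. \<Sum>i\<in>I. (norm (w m i))\<^sup>2)"
        using unimodular_combination_approx[OF _ I big L2y] by blast
      have w_le: "norm (w m i) \<le> norm (v m i) / x m" if "m \<ge> M0" for m i
      proof -
        \<comment> \<open>From index 1 on the base is at least 1; this is why \<open>M1\<close> is
          at least 1.\<close>
        have "x m powr - \<sigma> \<le> x m powr - 1"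
          using x1[of m] that M0 \<sigma> by (intro powr_mono) (auto simp: M1_def)
        also have "\<dots> = 1 / x m" using x0[of m] by (simp add: powr_minus divide_simps)
        finally have "x m powr - \<sigma> * norm (v m i) \<le> 1 / x m * norm (v m i)" by (intro mult_right_mono) auto
        thus ?thesis unfolding w_def by (simp add: norm_mult)
      qed
      have "(\<Sum>m\<in>{M0..<M2}. \<Sum>i\<in>I. (norm (w m i))\<^sup>2) = (\<Sum>i\<in>I. \<Sum>m\<in>{M0..<M2}. (norm (w m i))\<^sup>2)"
        by (rule sum.swap)
      also have "\<dots> \<le> (\<Sum>i\<in>I. e\<^sup>2 / (8 * n))"
      proof (rule sum_mono)
        fix i assume i: "i \<in> I"
        have "(\<Sum>m\<in>{M0..<M2}. (norm (w m i))\<^sup>2) \<le> (\<Sum>m\<in>{M0..<M2}. (norm (v m i) / x m)\<^sup>2)"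
          by (intro sum_mono power_mono w_le) auto
        also have "\<dots> = (\<Sum>m<M2-M0. (norm (v (m + M0) i) / x (m + M0))\<^sup>2)"
          using sum.shift_bounds_nat_ivl[of "\<lambda>m. (norm (v m i) / x m)\<^sup>2" 0 M0 "M2 - M0"] M(1)
          by (simp add: M2_def atLeast0LessThan)
        also have "\<dots> \<le> (suminf (\<lambda>m. (norm (v (m + M0) i) / x (m + M0))\<^sup>2))"
          using sq[OF i] by (intro sum_le_suminf summable_ignore_initial_segment) auto
        also have "\<dots> \<le> e\<^sup>2 / (8 * n)" using M1'[OF i, of M0] M0 by (simp add: M1_def)
        finally show "(\<Sum>m\<in>{M0..<M2}. (norm (w m i))\<^sup>2) \<le> e\<^sup>2 / (8 * n)" .
      qed
      also have "\<dots> = (e\<^sup>2 / 8) * (real (card I) / n)" by simp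
      also have "\<dots> \<le> (e\<^sup>2 / 8) * 1" using n by (intro mult_left_mono) (auto simp: n_def)
      finally have c2: "(\<Sum>i\<in>I. (norm (y i - (\<Sum>m\<in>{M0..<M2}. c m * w m i)))\<^sup>2) \<le> (e / 2)\<^sup>2"
        using c(2) by (simp add: power_divide)
      show "\<exists>\<omega>. (\<forall>m. norm (\<omega> m) = 1) \<and>
        (\<forall>i\<in>I. norm (y i - (suminf (\<lambda>m. if m < M0 then 0 else \<omega> m * of_real (x m powr - \<sigma>) * v m i))) < e)"
      proof (intro exI[of _ c] conjI allI ballI c(1))
        fix i assume i: "i \<in> I"
        define h where "h = (\<lambda>m. if m < M0 then 0 else c m * of_real (x m powr - \<sigma>) * v m i)"
        have hle: "norm (h m) \<le> norm (v m i) * x m powr - \<sigma>" for m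
          using c(1)[of m] by (simp add: h_def norm_mult)
        have sumv: "summable (\<lambda>m. norm (v m i) * x m powr - \<sigma>)" using abs[OF i] \<sigma> by simp
        have sumh: "summable (\<lambda>m. norm (h m))"
          by (rule summable_comparison_test'[OF sumv]) (use hle in auto)
        have "suminf h = (suminf (\<lambda>m. h (m + M2))) + (\<Sum>m<M2. h m)"
          using suminf_split_initial_segment[OF summable_norm_cancel[OF sumh]] .
        also have "(\<Sum>m<M2. h m) = (\<Sum>m\<in>{M0..<M2}. c m * w m i)"
          by (rule sum.mono_neutral_cong_right) (auto simp: h_def w_def)
        finally have split: "suminf h = (suminf (\<lambda>m. h (m + M2))) + (\<Sum>m\<in>{M0..<M2}. c m * w m i)" .
        have "norm (suminf (\<lambda>m. h (m + M2))) \<le> (suminf (\<lambda>m. norm (h (m + M2))))"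
          using sumh by (intro summable_norm) (simp add: summable_iff_shift[of "\<lambda>m. norm (h m)"])
        also have "\<dots> \<le> (suminf (\<lambda>m. norm (v (m + M2) i) * x (m + M2) powr - \<sigma>))"
          using sumh sumv hle by (intro suminf_le) (simp_all add: summable_iff_shift[of "\<lambda>m. norm (h m)"]
             summable_iff_shift[of "\<lambda>m. norm (v m i) * x m powr - \<sigma>"])
        also have "\<dots> < e / 2" using M2'[OF i, of M2] by (simp add: M2_def)
        finally have tail: "norm (suminf (\<lambda>m. h (m + M2))) < e / 2" .
        have "(norm (y i - (\<Sum>m\<in>{M0..<M2}. c m * w m i)))\<^sup>2 \<le> (\<Sum>i\<in>I. (norm (y i - (\<Sum>m\<in>{M0..<M2}. c m * w m i)))\<^sup>2)"
          using I i by (intro member_le_sum) auto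
        hence "(norm (y i - (\<Sum>m\<in>{M0..<M2}. c m * w m i)))\<^sup>2 \<le> (e / 2)\<^sup>2" using c2 by linarith
        hence "norm (y i - (\<Sum>m\<in>{M0..<M2}. c m * w m i)) \<le> e / 2" using e by (simp add: power2_le_iff_abs_le)
        moreover have "norm (y i - suminf h) \<le> norm (y i - (\<Sum>m\<in>{M0..<M2}. c m * w m i)) + norm (suminf (\<lambda>m. h (m + M2)))"
          unfolding split by (metis diff_diff_eq2 diff_add_eq_diff_diff_swap norm_triangle_ineq4)
        ultimately show "norm (y i - (suminf (\<lambda>m. if m < M0 then 0 else c m * of_real (x m powr - \<sigma>) * v m i))) < e"
          using tail unfolding h_def by linarith
      qed
    qed (use b in auto)
  qed
qed

section \<open>Kronecker approximation and independent frequencies\<close>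

text \<open>Kronecker's theorem yields some \<open>t0\<close> without control of its size. Adding
  \<open>q * T1\<close>, where Dirichlet's theorem makes every \<open>q * T1 * \<theta> i\<close>
  nearly an integer and \<open>q\<close> is a positive integer, pushes it beyond
  \<open>T\<close>.\<close>

lemma kronecker_simultaneous:
  fixes \<theta> \<alpha> :: "'a \<Rightarrow> real"
  assumes J: "finite J"
    and indep: "\<And>c :: 'a \<Rightarrow> int. (\<Sum>i\<in>J. of_int (c i) * \<theta> i) = 0 \<Longrightarrow> \<forall>i\<in>J. c i = 0"
    and e: "e > 0"
  obtains t h where "t > T" "\<And>i. i \<in> J \<Longrightarrow> \<bar>t * \<theta> i - of_int (h i) - \<alpha> i\<bar> < e"
proof -
  \<comment> \<open>Independence in \<open>Kronecker_thm_1\<close> is that of the reals as a module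
    over the integers.\<close>
  interpret Modules.module "(\<lambda>r. (*) (real_of_int r))"
    by (simp add: Modules.module.intro distrib_left mult.commute)
  obtain g where g: "bij_betw g {..<card J} J"
    using ex_bij_betw_nat_finite[OF J] by (auto simp: atLeast0LessThan)
  define g' where "g' = inv_into {..<card J} g"
  have gg: "g (g' i) = i" "g' i < card J" if "i \<in> J" for i
    using that g unfolding g'_def
    by (auto simp: bij_betw_def f_inv_into_f)
       (metis inv_into_into lessThan_iff)
  have inj: "inj_on \<theta> J"
  proof (rule inj_onI, rule ccontr)
    fix i j assume ij: "i \<in> J" "j \<in> J" "\<theta> i = \<theta> j" "i \<noteq> j"
    have "(\<Sum>x\<in>J. of_int (if x = i then 1 else if x = j then - 1 else 0) * \<theta> x)
       = (\<Sum>x\<in>{i, j}. of_int (if x = i then 1 else if x = j then - 1 else 0) * \<theta> x)"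
      using ij J by (intro sum.mono_neutral_right) auto
    also have "\<dots> = 0" using ij by simp
    finally have "\<forall>x\<in>J. (if x = i then 1 else if x = j then - 1 else 0 :: int) = 0" by (rule indep)
    from bspec[OF this ij(1)] show False by simp
  qed
  have "independent (\<theta> ` J)"
  proof
    assume "dependent (\<theta> ` J)"
    then obtain u where u: "\<exists>v\<in>\<theta> ` J. u v \<noteq> 0" "(\<Sum>v\<in>\<theta> ` J. of_int (u v) * v) = 0"
      using J by (auto simp: dependent_finite)
    have "(\<Sum>v\<in>\<theta> ` J. of_int (u v) * v) = (\<Sum>i\<in>J. of_int (u (\<theta> i)) * \<theta> i)"
      by (subst sum.reindex[OF inj]) simp
    hence "\<forall>i\<in>J. u (\<theta> i) = 0" using u(2) by (intro indep) simp
    with u(1) show False by blast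
  qed
  moreover have "(\<theta> \<circ> g) ` {..<card J} = \<theta> ` J"
    using g by (metis bij_betw_imp_surj_on image_comp)
  moreover have "inj_on (\<theta> \<circ> g) {..<card J}"
    using g inj by (auto simp: bij_betw_def intro: comp_inj_on)
  ultimately obtain t0 h0 where t0: "\<And>i. i < card J \<Longrightarrow> \<bar>t0 * (\<theta> \<circ> g) i - of_int (h0 i) - (\<alpha> \<circ> g) i\<bar> < e / 2"
    using Kronecker_thm_1[of "\<theta> \<circ> g" "card J" "e / 2" "\<alpha> \<circ> g"] half_gt_zero[OF e]
    by metis
  \<comment> \<open>Large enough that already \<open>t0 + T1\<close> exceeds \<open>T\<close>,
    whatever the sign of \<open>t0\<close>.\<close>
  define T1 where "T1 = \<bar>T\<bar> + \<bar>t0\<bar> + 1"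
  obtain N :: nat where N: "1 / real N < e / 2" "N > 0"
    using e by (metis half_gt_zero inverse_eq_divide real_arch_inverse gr0I)
  obtain q p where q: "0 < q" "\<And>i. i < card J \<Longrightarrow> \<bar>of_int q * (T1 * (\<theta> \<circ> g) i) - of_int (p i)\<bar> < 1 / N"
    using Dirichlet_approx_simult[OF N(2), of "card J" "\<lambda>i. T1 * (\<theta> \<circ> g) i"] by metis
  show ?thesis
  proof (rule that[of "t0 + of_int q * T1" "\<lambda>i. h0 (g' i) + p (g' i)"])
    have "1 * T1 \<le> of_int q * T1" using q(1) by (intro mult_right_mono) (auto simp: T1_def)
    thus "T < t0 + of_int q * T1" by (simp add: T1_def)
  next
    fix i assume i: "i \<in> J"
    show "\<bar>(t0 + of_int q * T1) * \<theta> i - of_int (h0 (g' i) + p (g' i)) - \<alpha> i\<bar> < e"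
    proof -
      have "(t0 + of_int q * T1) * \<theta> i - of_int (h0 (g' i) + p (g' i)) - \<alpha> i
          = (t0 * \<theta> i - of_int (h0 (g' i)) - \<alpha> i) + (of_int q * (T1 * \<theta> i) - of_int (p (g' i)))"
        by (simp add: algebra_simps)
      moreover have "\<bar>t0 * \<theta> i - of_int (h0 (g' i)) - \<alpha> i\<bar> < e / 2"
        "\<bar>of_int q * (T1 * \<theta> i) - of_int (p (g' i))\<bar> < 1 / real N"
        using t0[OF gg(2)[OF i]] q(2)[OF gg(2)[OF i]] gg(1)[OF i] by simp_all
      ultimately show ?thesis using N(1) by linarith
    qed
  qed
qed

lemma kronecker_unimodular:
  fixes \<theta> :: "'a \<Rightarrow> real" and \<omega> :: "'a \<Rightarrow> complex"
  assumes J: "finite J"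
    and indep: "\<And>c :: 'a \<Rightarrow> int. (\<Sum>i\<in>J. of_int (c i) * \<theta> i) = 0 \<Longrightarrow> \<forall>i\<in>J. c i = 0"
    and e: "e > 0" and \<omega>: "\<And>i. i \<in> J \<Longrightarrow> norm (\<omega> i) = 1"
  obtains t where "t > T" "\<And>i. i \<in> J \<Longrightarrow> norm (cis (- (t * \<theta> i)) - \<omega> i) < e"
proof -
  \<comment> \<open>Angles are converted from radians to full turns; the sign is that of the
    exponent in the conclusion.\<close>
  define \<theta>' where "\<theta>' = (\<lambda>i. - \<theta> i / (2 * pi))"
  have indep': "\<forall>i\<in>J. c i = 0" if "(\<Sum>i\<in>J. of_int (c i) * \<theta>' i) = 0" for c :: "'a \<Rightarrow> int"
  proof (rule indep)
    have "(\<Sum>i\<in>J. of_int (c i) * \<theta>' i) = - (\<Sum>i\<in>J. of_int (c i) * \<theta> i) / (2 * pi)"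
      unfolding \<theta>'_def by (simp add: sum_divide_distrib sum_negf)
    with that show "(\<Sum>i\<in>J. of_int (c i) * \<theta> i) = 0" by simp
  qed
  obtain t h where th: "t > T" "\<And>i. i \<in> J \<Longrightarrow> \<bar>t * \<theta>' i - of_int (h i) - Arg (\<omega> i) / (2 * pi)\<bar> < e / (2 * pi)"
    by (rule kronecker_simultaneous[OF J indep', where e = "e / (2 * pi)" and T = T and \<alpha> = "\<lambda>i. Arg (\<omega> i) / (2 * pi)"])
       (use e in auto)
  show ?thesis
  proof (rule that[OF th(1)])
    fix i assume i: "i \<in> J"
    define d where "d = - (t * \<theta> i) - 2 * pi * of_int (h i) - Arg (\<omega> i)"
    have "d = 2 * pi * (t * \<theta>' i - of_int (h i) - Arg (\<omega> i) / (2 * pi))"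
      by (simp add: d_def \<theta>'_def field_simps)
    hence "\<bar>d\<bar> = 2 * pi * \<bar>t * \<theta>' i - of_int (h i) - Arg (\<omega> i) / (2 * pi)\<bar>"
      by (simp only: abs_mult) simp
    also have "\<dots> < 2 * pi * (e / (2 * pi))"
      using th(2)[OF i] by (intro mult_strict_left_mono) auto
    finally have d: "\<bar>d\<bar> < e" by simp
    have om: "\<omega> i = cis (Arg (\<omega> i))"
      using \<omega>[OF i] by (metis cis_Arg norm_zero sgn_div_norm scaleR_one inverse_1 zero_neq_one)
    have "- (t * \<theta> i) = d + Arg (\<omega> i) + 2 * pi * of_int (h i)" by (simp add: d_def)
    hence "cis (- (t * \<theta> i)) = cis d * \<omega> i"
      using om by (simp add: cis_mult[symmetric] cis_multiple_2pi)
    hence "cis (- (t * \<theta> i)) - \<omega> i = (cis d - 1) * \<omega> i" by (simp add: algebra_simps)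
    hence "norm (cis (- (t * \<theta> i)) - \<omega> i) = norm (exp (\<i> * d) - 1)"
      using \<omega>[OF i] by (simp add: norm_mult cis_conv_exp)
    also have "\<dots> = 2 * \<bar>sin (d / 2)\<bar>" by (simp add: norm_exp_i_times dist_exp_i_1)
    also have "\<dots> \<le> \<bar>d\<bar>" using abs_sin_x_le_abs_x[of "d / 2"] by simp
    finally show "norm (cis (- (t * \<theta> i)) - \<omega> i) < e" using d by simp
  qed
qed

section \<open>Rational polynomials as functions and the independence of the frequencies\<close>

definition monom_value :: "(nat \<Rightarrow> real) \<Rightarrow> (nat \<Rightarrow>\<^sub>0 nat) \<Rightarrow> real" where
  "monom_value x e = (\<Prod>i\<in>Poly_Mapping.keys e. x i ^ Poly_Mapping.lookup e i)"

lemma monom_value_superset: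
  assumes "finite A" "Poly_Mapping.keys e \<subseteq> A"
  shows "monom_value x e = (\<Prod>i\<in>A. x i ^ Poly_Mapping.lookup e i)"
  unfolding monom_value_def using assms
  by (intro prod.mono_neutral_left) (auto simp: in_keys_iff)

lemma monom_value_add: "monom_value x (e + f) = monom_value x e * monom_value x f"
proof -
  let ?A = "Poly_Mapping.keys e \<union> Poly_Mapping.keys f"
  have "Poly_Mapping.keys (e + f) \<subseteq> ?A" by (rule keys_add)
  thus ?thesis
    by (subst (1 2 3) monom_value_superset[of ?A])
       (auto simp: lookup_add power_add prod.distrib)
qed

text \<open>Coefficients can cancel in a sum and shrink the support, so additivity is proved over a
  common superset of the supports.\<close>

lemma eval_rat_mpoly_superset:
  assumes "finite A" "Poly_Mapping.keys P \<subseteq> A"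
  shows "eval_rat_mpoly x P = (\<Sum>e\<in>A. of_rat (Poly_Mapping.lookup P e) * monom_value x e)"
  unfolding eval_rat_mpoly_def monom_value_def[symmetric] using assms
  by (intro sum.mono_neutral_left) (auto simp: in_keys_iff)

lemma eval_rat_mpoly_add: "eval_rat_mpoly x (P + Q) = eval_rat_mpoly x P + eval_rat_mpoly x Q"
proof -
  let ?A = "Poly_Mapping.keys P \<union> Poly_Mapping.keys Q"
  have "Poly_Mapping.keys (P + Q) \<subseteq> ?A" by (rule keys_add)
  thus ?thesis
    by (subst (1 2 3) eval_rat_mpoly_superset[of ?A])
       (auto simp: lookup_add of_rat_add distrib_right sum.distrib)
qed

lemma eval_rat_mpoly_single: "eval_rat_mpoly x (Poly_Mapping.single e c) = of_rat c * monom_value x e"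
  by (subst eval_rat_mpoly_superset[of "{e}"]) auto

lemma eval_rat_mpoly_0: "eval_rat_mpoly x 0 = 0"
  by (simp add: eval_rat_mpoly_def)

lemma eval_rat_mpoly_sum: "eval_rat_mpoly x (sum P A) = (\<Sum>a\<in>A. eval_rat_mpoly x (P a))"
  by (induction A rule: infinite_finite_induct) (auto simp: eval_rat_mpoly_add eval_rat_mpoly_0)

lemma poly_mapping_sum_single:
  "P = (\<Sum>e\<in>Poly_Mapping.keys P. Poly_Mapping.single e (Poly_Mapping.lookup P e))"
  by (rule poly_mapping_eqI)
     (auto simp: lookup_sum lookup_single when_def in_keys_iff)

lemma eval_rat_mpoly_mult: "eval_rat_mpoly x (P * Q) = eval_rat_mpoly x P * eval_rat_mpoly x Q"
proof -
  have "P * Q = (\<Sum>e\<in>Poly_Mapping.keys P. Poly_Mapping.single e (Poly_Mapping.lookup P e))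
              * (\<Sum>f\<in>Poly_Mapping.keys Q. Poly_Mapping.single f (Poly_Mapping.lookup Q f))"
    using poly_mapping_sum_single[of P] poly_mapping_sum_single[of Q] by simp
  also have "eval_rat_mpoly x \<dots> =
    (\<Sum>e\<in>Poly_Mapping.keys P. of_rat (Poly_Mapping.lookup P e) * monom_value x e) *
    (\<Sum>f\<in>Poly_Mapping.keys Q. of_rat (Poly_Mapping.lookup Q f) * monom_value x f)"
    by (simp add: sum_product mult_single eval_rat_mpoly_sum eval_rat_mpoly_single monom_value_add
         of_rat_mult mult_ac)
  finally show ?thesis unfolding eval_rat_mpoly_def monom_value_def .
qed

text \<open>Closure rules for such functions recognise products of powers as polynomials without any
  computation of their coefficients.\<close>

definition rat_poly_fun :: "nat set \<Rightarrow> ((nat \<Rightarrow> real) \<Rightarrow> real) \<Rightarrow> bool" where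
  "rat_poly_fun I f \<longleftrightarrow> (\<exists>P\<in>rat_mpolys_in I. \<forall>x. f x = eval_rat_mpoly x P)"

lemma rat_poly_fun_add:
  assumes "rat_poly_fun I f" "rat_poly_fun I g"
  shows "rat_poly_fun I (\<lambda>x. f x + g x)"
proof -
  obtain P Q where "P \<in> rat_mpolys_in I" "Q \<in> rat_mpolys_in I"
    "\<forall>x. f x = eval_rat_mpoly x P" "\<forall>x. g x = eval_rat_mpoly x Q"
    using assms by (auto simp: rat_poly_fun_def)
  moreover from this have "P + Q \<in> rat_mpolys_in I"
    using keys_add[of P Q] unfolding rat_mpolys_in_def by blast
  ultimately show ?thesis unfolding rat_poly_fun_def
    by (intro bexI[of _ "P + Q"]) (auto simp: eval_rat_mpoly_add)
qed

lemma rat_poly_fun_mult: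
  assumes "rat_poly_fun I f" "rat_poly_fun I g"
  shows "rat_poly_fun I (\<lambda>x. f x * g x)"
proof -
  obtain P Q where PQ: "P \<in> rat_mpolys_in I" "Q \<in> rat_mpolys_in I"
    "\<forall>x. f x = eval_rat_mpoly x P" "\<forall>x. g x = eval_rat_mpoly x Q"
    using assms by (auto simp: rat_poly_fun_def)
  have "Poly_Mapping.keys e \<subseteq> I" if "e \<in> Poly_Mapping.keys (P * Q)" for e
  proof -
    obtain a b where ab: "a \<in> Poly_Mapping.keys P" "b \<in> Poly_Mapping.keys Q" "e = a + b"
      using keys_mult[of P Q] \<open>e \<in> _\<close> by auto
    have "Poly_Mapping.keys a \<subseteq> I" "Poly_Mapping.keys b \<subseteq> I"
      using ab PQ by (auto simp: rat_mpolys_in_def)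
    thus ?thesis using keys_add[of a b] ab by blast
  qed
  hence "P * Q \<in> rat_mpolys_in I" by (auto simp: rat_mpolys_in_def)
  with PQ show ?thesis unfolding rat_poly_fun_def
    by (intro bexI[of _ "P * Q"]) (auto simp: eval_rat_mpoly_mult)
qed

lemma rat_poly_fun_of_rat: "rat_poly_fun I (\<lambda>_. of_rat c)"
  unfolding rat_poly_fun_def
  by (intro bexI[of _ "Poly_Mapping.single 0 c"])
     (auto simp: eval_rat_mpoly_single rat_mpolys_in_def monom_value_def)

lemma rat_poly_fun_var:
  assumes "i \<in> I"
  shows "rat_poly_fun I (\<lambda>x. x i)"
  unfolding rat_poly_fun_def using assms
  by (intro bexI[of _ "Poly_Mapping.single (Poly_Mapping.single i 1) 1"])
     (auto simp: eval_rat_mpoly_single rat_mpolys_in_def monom_value_def)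

lemma rat_poly_fun_of_nat: "rat_poly_fun I (\<lambda>_. of_nat c)"
  using rat_poly_fun_of_rat[of I "of_nat c"] by simp

lemma rat_poly_fun_power:
  assumes "rat_poly_fun I f"
  shows "rat_poly_fun I (\<lambda>x. f x ^ k)"
proof (induction k)
  case 0
  show ?case using rat_poly_fun_of_nat[of I 1] by simp
next
  case (Suc k)
  show ?case using rat_poly_fun_mult[OF assms Suc] by simp
qed

lemma rat_poly_fun_prod:
  assumes "\<And>a. a \<in> A \<Longrightarrow> rat_poly_fun I (f a)"
  shows "rat_poly_fun I (\<lambda>x. \<Prod>a\<in>A. f a x)"
  using assms
proof (induction A rule: infinite_finite_induct)
  case (insert a A)
  thus ?case using rat_poly_fun_mult[of I "f a" "\<lambda>x. \<Prod>a\<in>A. f a x"] by simp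
qed (use rat_poly_fun_of_nat[of I 1] in auto)

text \<open>The difference is a polynomial vanishing at the independent point \<alpha>, hence the
  zero polynomial. A relation at \<alpha> may thus be tested at any convenient point.\<close>

lemma rat_poly_fun_eqI:
  assumes "algebraically_independent_rat I \<alpha>" "rat_poly_fun I f" "rat_poly_fun I g" "f \<alpha> = g \<alpha>"
  shows "f x = g x"
proof -
  have "rat_poly_fun I (\<lambda>x. f x + of_rat (- 1) * g x)"
    using assms by (intro rat_poly_fun_add rat_poly_fun_mult rat_poly_fun_of_rat)
  then obtain P where P: "P \<in> rat_mpolys_in I" "\<And>x. f x - g x = eval_rat_mpoly x P"
    by (auto simp: rat_poly_fun_def of_rat_minus)
  with assms(1,4) have "P = 0" unfolding algebraically_independent_rat_def by (metis diff_self)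
  with P(2)[of x] show ?thesis by (simp add: eval_rat_mpoly_0)
qed

text \<open>Exponentiate, with positive and negative coefficients on different sides so that all
  exponents are natural numbers, and compare multiplicities.\<close>

lemma ln_primes_independent:
  fixes c :: "nat \<Rightarrow> int"
  assumes S: "finite S" "\<And>p. p \<in> S \<Longrightarrow> prime p"
    and eq: "(\<Sum>p\<in>S. of_int (c p) * ln (real p)) = 0" and "p \<in> S"
  shows "c p = 0"
proof -
  have pos: "real p > 0" if "p \<in> S" for p using S(2)[OF that] by (simp add: prime_gt_0_nat)
  have "(\<Sum>p\<in>S. real (nat (c p)) * ln (real p)) = (\<Sum>p\<in>S. real (nat (- c p)) * ln (real p))"
  proof -
    have "of_int (c p) * ln (real p) = real (nat (c p)) * ln (real p) - real (nat (- c p)) * ln (real p)" for p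
      by (cases "c p \<ge> 0") auto
    with eq show ?thesis by (simp add: sum_subtractf)
  qed
  hence "exp (\<Sum>p\<in>S. real (nat (c p)) * ln (real p)) = exp (\<Sum>p\<in>S. real (nat (- c p)) * ln (real p))" by simp
  hence "real (\<Prod>p\<in>S. p ^ nat (c p)) = real (\<Prod>p\<in>S. p ^ nat (- c p))"
    using pos S(1) by (simp add: exp_sum exp_of_nat_mult cong: prod.cong)
  hence "(\<Prod>p\<in>S. p ^ nat (c p)) = (\<Prod>p\<in>S. p ^ nat (- c p))" by (simp only: of_nat_eq_iff)
  moreover have "multiplicity p (\<Prod>p\<in>S. p ^ nat (c p)) = nat (c p)" "multiplicity p (\<Prod>p\<in>S. p ^ nat (- c p)) = nat (- c p)"
    using S \<open>p \<in> S\<close> by (subst multiplicity_prod_prime_powers; simp)+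
  ultimately show ?thesis by simp
qed

text \<open>Exponentiating and separating the signs of the coefficients gives an equality of two
  products that are polynomial in the \<open>\<alpha> j\<close>. It is therefore an identity, and it
  fails at a point where the factor belonging to \<open>x0\<close> vanishes and no other does, since
  that factor occurs on one side only.\<close>

lemma ln_shifts_independent:
  fixes c :: "nat \<times> nat \<Rightarrow> int" and \<alpha> :: "nat \<Rightarrow> real"
  assumes indep: "algebraically_independent_rat I \<alpha>" and pos: "\<And>j. j \<in> I \<Longrightarrow> \<alpha> j > 0"
    and J: "finite J" "J \<subseteq> I \<times> UNIV" and S: "finite S" "\<And>p. p \<in> S \<Longrightarrow> p > 0"
    and eq: "(\<Sum>p\<in>S. of_int (d p) * ln (real p)) + (\<Sum>(j, m)\<in>J. of_int (c (j, m)) * ln (real m + \<alpha> j)) = 0"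
    and x0: "x0 \<in> J"
  shows "c x0 = 0"
proof (rule ccontr)
  assume c0: "c x0 \<noteq> 0"
  \<comment> \<open>The sign \<open>s\<close> selects the side: \<open>F 1\<close> collects the
    positive coefficients and \<open>F (- 1)\<close> the negative ones.\<close>
  define F where "F = (\<lambda>(s::int) y. (\<Prod>p\<in>S. real p ^ nat (s * d p)) * (\<Prod>(j, m)\<in>J. (real m + y j) ^ nat (s * c (j, m))))"
  have poly: "rat_poly_fun I (F s)" for s
    unfolding F_def case_prod_beta using J
    by (intro rat_poly_fun_mult rat_poly_fun_prod rat_poly_fun_power rat_poly_fun_add rat_poly_fun_of_nat
          rat_poly_fun_var) auto
  have expF: "F s \<alpha> = exp ((\<Sum>p\<in>S. real (nat (s * d p)) * ln (real p))
       + (\<Sum>(j, m)\<in>J. real (nat (s * c (j, m))) * ln (real m + \<alpha> j)))" for s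
  proof -
    have "(\<Prod>p\<in>S. real p ^ nat (s * d p)) = exp (\<Sum>p\<in>S. real (nat (s * d p)) * ln (real p))"
      using S by (auto simp: exp_sum exp_of_nat_mult intro!: prod.cong)
    moreover have "real m + \<alpha> j > 0" if "(j, m) \<in> J" for j m
      using pos[of j] J(2) that by auto
    hence "(\<Prod>(j, m)\<in>J. (real m + \<alpha> j) ^ nat (s * c (j, m)))
        = exp (\<Sum>(j, m)\<in>J. real (nat (s * c (j, m))) * ln (real m + \<alpha> j))"
      using J(1) by (auto simp: exp_sum exp_of_nat_mult case_prod_beta intro!: prod.cong)
    ultimately show ?thesis by (simp add: F_def exp_add)
  qed
  have split: "of_int k * t = real (nat (1 * k)) * t - real (nat (- 1 * k)) * t" for k :: int and t :: real
    by (cases "k \<ge> 0") auto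
  have "F 1 \<alpha> = F (- 1) \<alpha>"
    using eq unfolding expF case_prod_beta by (simp only: split sum_subtractf exp_inj_iff)
  hence FF: "F 1 y = F (- 1) y" for y by (rule rat_poly_fun_eqI[OF indep poly poly])
  obtain j0 m0 where x0': "x0 = (j0, m0)" by force
  \<comment> \<open>Here \<open>m0 + y j0\<close> is 0, whereas \<open>m + y j0\<close> with another
    m is a nonzero integer and \<open>m + 1\<close>, for the other indices, is positive.\<close>
  define y where "y = (\<lambda>j. if j = j0 then - real m0 else 1)"
  have nz: "F s y \<noteq> 0" if "s * c x0 \<le> 0" for s
  proof -
    have "(real (snd x) + y (fst x)) ^ nat (s * c x) \<noteq> 0" for x
    proof (cases "x = x0")
      case False
      thus ?thesis by (cases x) (auto simp: y_def x0')
    qed (use that in simp)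
    thus ?thesis unfolding F_def using S J(1) by (auto simp: case_prod_beta)
  qed
  have z: "F s y = 0" if "s * c x0 > 0" for s
  proof -
    have "(real (snd x0) + y (fst x0)) ^ nat (s * c x0) = 0"
      using that by (simp add: x0' y_def)
    thus ?thesis unfolding F_def using J(1) x0 by (auto simp: case_prod_beta intro!: prod_zero)
  qed
  show False
    using c0 nz[of 1] z[of 1] nz[of "- 1"] z[of "- 1"] FF[of y] by (cases "c x0 > 0") auto
qed

section \<open>Generalised Dirichlet series\<close>

lemma ln_power_le_powr:
  assumes "\<eta> > 0"
  obtains K where "K > 0" "\<And>x::real. x \<ge> 1 \<Longrightarrow> \<bar>ln x\<bar> ^ \<nu> \<le> K * x powr \<eta>"
proof -
  \<comment> \<open>The denominator \<nu> + 1 covers \<nu> = 0 and still gives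
    \<open>a * \<nu> \<le> \<eta>\<close>.\<close>
  define a where "a = \<eta> / (real \<nu> + 1)"
  have a: "a > 0" using assms by (simp add: a_def)
  show ?thesis
  proof (rule that[of "1 / a ^ \<nu>"])
    fix x :: real assume x: "x \<ge> 1"
    have "\<bar>ln x\<bar> \<le> x powr a / a" using ln_powr_bound[OF x a] x by simp
    hence "\<bar>ln x\<bar> ^ \<nu> \<le> (x powr a / a) ^ \<nu>" by (rule power_mono) auto
    also have "\<dots> = 1 / a ^ \<nu> * x powr (a * real \<nu>)"
      using x by (simp add: power_divide powr_power mult.commute[of "real \<nu>"])
    also have "\<dots> \<le> 1 / a ^ \<nu> * x powr \<eta>"
      using a x assms by (intro mult_left_mono powr_mono) (auto simp: a_def field_simps)
    finally show "\<bar>ln x\<bar> ^ \<nu> \<le> 1 / a ^ \<nu> * x powr \<eta>" .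
  qed (use a in auto)
qed

lemma summable_shift_powr:
  assumes "\<beta> > 0" "\<tau> > 1"
  shows "summable (\<lambda>m. (real m + \<beta>) powr - \<tau>)"
proof (rule summable_comparison_test_ev)
  show "summable (\<lambda>m. real m powr - \<tau>)" using assms by (subst summable_real_powr_iff) simp
  show "eventually (\<lambda>m. norm ((real m + \<beta>) powr - \<tau>) \<le> real m powr - \<tau>) sequentially"
    using eventually_gt_at_top[of 0]
  proof eventually_elim
    case (elim m)
    thus ?case using assms by (auto intro!: powr_mono2')
  qed
qed

lemma summable_ln_power_powr:
  assumes "\<beta> > 0" "\<tau> > 1"
  shows "summable (\<lambda>m. \<bar>ln (real m + \<beta>)\<bar> ^ \<nu> * (real m + \<beta>) powr - \<tau>)"
proof -
  have "(\<tau> - 1) / 2 > 0" using assms by simp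
  then obtain K where K: "K > 0" "\<And>x::real. x \<ge> 1 \<Longrightarrow> \<bar>ln x\<bar> ^ \<nu> \<le> K * x powr ((\<tau> - 1) / 2)"
    using ln_power_le_powr[of _ \<nu>] by metis
  show ?thesis
  proof (rule summable_comparison_test_ev)
    show "summable (\<lambda>m. K * (real m + \<beta>) powr - ((\<tau> + 1) / 2))"
      using assms by (intro summable_mult summable_shift_powr) auto
    show "eventually (\<lambda>m. norm (\<bar>ln (real m + \<beta>)\<bar> ^ \<nu> * (real m + \<beta>) powr - \<tau>)
        \<le> K * (real m + \<beta>) powr - ((\<tau> + 1) / 2)) sequentially"
      using eventually_gt_at_top[of 0]
    proof eventually_elim
      case (elim m)
      have "\<bar>ln (real m + \<beta>)\<bar> ^ \<nu> * (real m + \<beta>) powr - \<tau> \<le> (K * (real m + \<beta>) powr ((\<tau> - 1) / 2)) * (real m + \<beta>) powr - \<tau>"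
        using K(2)[of "real m + \<beta>"] elim assms by (intro mult_right_mono) auto
      also have "\<dots> = K * (real m + \<beta>) powr ((\<tau> - 1) / 2 + - \<tau>)"
        unfolding powr_add by simp
      also have "(\<tau> - 1) / 2 + - \<tau> = - ((\<tau> + 1) / 2)" by (simp add: field_simps)
      finally show ?case by (simp add: abs_mult)
    qed
  qed
qed

text \<open>The \<open>\<nu>\<close>-th derivative of the series \<open>\<Sum> c m (m + \<beta>) powr (- s)\<close>.\<close>
definition dser :: "real \<Rightarrow> (nat \<Rightarrow> complex) \<Rightarrow> nat \<Rightarrow> complex \<Rightarrow> complex" where
  "dser \<beta> c \<nu> s = (suminf (\<lambda>m. c m * of_real ((- ln (real m + \<beta>)) ^ \<nu>) * of_real (real m + \<beta>) powr (- s)))"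

lemma norm_of_real_powr:
  "x > 0 \<Longrightarrow> norm (complex_of_real x powr s) = x powr Re s"
  by (simp add: norm_powr_real_powr)

text \<open>The exponent \<open>B\<close> admits coefficients of polynomial growth. They occur as
  long as the Euler parameters are only known to be bounded by p, and after multiplication by
  logarithms.\<close>

lemma dser_summable:
  assumes \<beta>: "\<beta> > 0" and c: "\<And>m. norm (c m) \<le> C * (real m + \<beta>) powr B" and s: "Re s > 1 + B"
  shows "summable (\<lambda>m. norm (c m * of_real ((- ln (real m + \<beta>)) ^ \<nu>) * of_real (real m + \<beta>) powr (- s)))"
proof (rule summable_comparison_test')
  show "summable (\<lambda>m. C * (\<bar>ln (real m + \<beta>)\<bar> ^ \<nu> * (real m + \<beta>) powr - (Re s - B)))"
    using assms by (intro summable_mult summable_ln_power_powr) auto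
  fix m :: nat
  have x: "real m + \<beta> > 0" using \<beta> by simp
  have "norm (c m * of_real ((- ln (real m + \<beta>)) ^ \<nu>) * of_real (real m + \<beta>) powr (- s))
      = norm (c m) * (\<bar>ln (real m + \<beta>)\<bar> ^ \<nu> * (real m + \<beta>) powr - Re s)"
    using x by (simp add: norm_mult norm_power norm_of_real_powr del: of_real_add)
  also have "\<dots> \<le> (C * (real m + \<beta>) powr B) * (\<bar>ln (real m + \<beta>)\<bar> ^ \<nu> * (real m + \<beta>) powr - Re s)"
    using c by (intro mult_right_mono) auto
  also have "\<dots> = C * (\<bar>ln (real m + \<beta>)\<bar> ^ \<nu> * (real m + \<beta>) powr - (Re s - B))"
    using x by (simp add: powr_minus powr_diff field_simps)
  finally show "norm (norm (c m * of_real ((- ln (real m + \<beta>)) ^ \<nu>) * of_real (real m + \<beta>) powr (- s)))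
     \<le> C * (\<bar>ln (real m + \<beta>)\<bar> ^ \<nu> * (real m + \<beta>) powr - (Re s - B))" by simp
qed

lemma dser_has_field_derivative:
  assumes \<beta>: "\<beta> > 0" and c: "\<And>m. norm (c m) \<le> C * (real m + \<beta>) powr B" and s: "Re s > 1 + B"
  shows "(dser \<beta> c \<nu> has_field_derivative dser \<beta> c (Suc \<nu>) s) (at s)"
proof -
  define \<sigma>1 where "\<sigma>1 = (Re s + 1 + B) / 2"
  define \<sigma>2 where "\<sigma>2 = Re s + 1"
  \<comment> \<open>The strip is bounded on the right as well: for \<open>m = 0\<close> the base
    \<beta> may be below 1, and then the term grows with Re z. The majorant is the sum of the values
    at both edges.\<close>
  define S where "S = {z. Re z > \<sigma>1} \<inter> {z. Re z < \<sigma>2}"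
  define f where "f = (\<lambda>\<nu> m s. c m * of_real ((- ln (real m + \<beta>)) ^ \<nu>) * of_real (real m + \<beta>) powr (- s))"
  have \<sigma>: "\<sigma>1 > 1 + B" "\<sigma>1 < Re s" "\<sigma>2 > Re s" using s by (auto simp: \<sigma>1_def \<sigma>2_def)
  have sm: "summable (\<lambda>m. norm (f \<nu> m z))" if "Re z > 1 + B" for \<nu> z
    using dser_summable[OF \<beta> c that] unfolding f_def .
  have "((\<lambda>s. suminf (\<lambda>m. f \<nu> m s)) has_field_derivative (suminf (\<lambda>m. f (Suc \<nu>) m s))) (at s)"
  proof (rule has_field_derivative_series'(2))
    show "convex S" unfolding S_def
      by (intro convex_Int convex_halfspace_Re_gt convex_halfspace_Re_lt)
    have "open S" unfolding S_def by (intro open_Int open_halfspace_Re_gt open_halfspace_Re_lt)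
    thus "s \<in> interior S" using \<sigma> by (subst interior_open) (auto simp: S_def)
    show "s \<in> S" using \<sigma> by (simp add: S_def)
    show "summable (\<lambda>m. f \<nu> m s)" by (rule summable_norm_cancel[OF sm[OF s]])
    show "(f \<nu> n has_field_derivative f (Suc \<nu>) n x) (at x within S)" for n x
    proof -
      have x: "real n + \<beta> > 0" using \<beta> by simp
      have "((\<lambda>z. complex_of_real (real n + \<beta>) powr z) has_field_derivative
          Ln (of_real (real n + \<beta>)) * of_real (real n + \<beta>) powr (- z)) (at (- z))" for z
        using x by (intro has_field_derivative_powr_right) (simp del: of_real_add)
      from DERIV_chain2[OF this DERIV_minus[OF DERIV_ident]]
      have "((\<lambda>z. complex_of_real (real n + \<beta>) powr (- z)) has_field_derivative
          - of_real (ln (real n + \<beta>)) * of_real (real n + \<beta>) powr (- x)) (at x within S)"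
        using Ln_of_real[OF x] by simp
      from DERIV_cmult[OF this, of "c n * of_real ((- ln (real n + \<beta>)) ^ \<nu>)"]
      show ?thesis unfolding f_def by (simp add: mult_ac del: of_real_add)
    qed
    show "uniformly_convergent_on S (\<lambda>n x. \<Sum>i<n. f (Suc \<nu>) i x)"
    proof (rule Weierstrass_m_test')
      show "summable (\<lambda>m. norm (f (Suc \<nu>) m (of_real \<sigma>1)) + norm (f (Suc \<nu>) m (of_real \<sigma>2)))"
        using \<sigma> by (intro summable_add sm) auto
      fix m z assume z: "z \<in> S"
      have x: "real m + \<beta> > 0" using \<beta> by simp
      have nf: "norm (f \<nu> m z) = norm (c m) * \<bar>ln (real m + \<beta>)\<bar> ^ \<nu> * (real m + \<beta>) powr - Re z" for \<nu> z
        using x unfolding f_def by (simp add: norm_mult norm_power norm_of_real_powr del: of_real_add)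
      have "(real m + \<beta>) powr - Re z \<le> (real m + \<beta>) powr - \<sigma>1 + (real m + \<beta>) powr - \<sigma>2"
      proof (cases "real m + \<beta> \<ge> 1")
        case True
        hence "(real m + \<beta>) powr - Re z \<le> (real m + \<beta>) powr - \<sigma>1"
          using z by (intro powr_mono) (auto simp: S_def)
        thus ?thesis by (simp add: add_increasing2)
      next
        case False
        hence "(real m + \<beta>) powr - Re z \<le> (real m + \<beta>) powr - \<sigma>2"
          using z x by (intro powr_mono') (auto simp: S_def)
        thus ?thesis by (simp add: add_increasing)
      qed
      hence "norm (c m) * \<bar>ln (real m + \<beta>)\<bar> ^ Suc \<nu> * (real m + \<beta>) powr - Re z \<le>
          norm (c m) * \<bar>ln (real m + \<beta>)\<bar> ^ Suc \<nu> * ((real m + \<beta>) powr - \<sigma>1 + (real m + \<beta>) powr - \<sigma>2)"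
        by (intro mult_left_mono) auto
      thus "norm (f (Suc \<nu>) m z) \<le> norm (f (Suc \<nu>) m (of_real \<sigma>1)) + norm (f (Suc \<nu>) m (of_real \<sigma>2))"
        unfolding nf by (simp add: distrib_left)
    qed
  qed
  thus ?thesis unfolding dser_def f_def .
qed

lemma higher_deriv_eq_dser:
  assumes \<beta>: "\<beta> > 0" and c: "\<And>m. norm (c m) \<le> C * (real m + \<beta>) powr B"
    and eq: "\<And>s. Re s > 1 + B \<Longrightarrow> f s = dser \<beta> c 0 s" and s: "Re s > 1 + B"
  shows "(deriv ^^ \<nu>) f s = dser \<beta> c \<nu> s"
  using s
proof (induction \<nu> arbitrary: s)
  case 0
  thus ?case using eq by simp
next
  case (Suc \<nu>)
  have "open {z. Re z > 1 + B}" by (rule open_halfspace_Re_gt)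
  hence "eventually (\<lambda>z. z \<in> {z. Re z > 1 + B}) (nhds s)"
    using Suc.prems by (intro eventually_nhds_in_open) auto
  hence ev: "eventually (\<lambda>z. (deriv ^^ \<nu>) f z = dser \<beta> c \<nu> z) (nhds s)"
    by eventually_elim (use Suc.IH in auto)
  have "(deriv ^^ Suc \<nu>) f s = deriv (dser \<beta> c \<nu>) s"
    using deriv_cong_ev[OF ev refl] by simp
  also have "\<dots> = dser \<beta> c (Suc \<nu>) s"
    by (rule DERIV_imp_deriv[OF dser_has_field_derivative[OF \<beta> c Suc.prems]])
  finally show ?case .
qed

text \<open>\<open>M\<close> and \<eta> depend on \<open>g\<close> and \<open>e\<close> alone.
  Beyond \<open>M\<close> two unimodular choices differ by at most twice the tail, that is e / 2;
  below \<open>M\<close> the difference is at most \<eta> times the total mass, again e / 2.\<close>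

lemma phase_perturbation:
  fixes g :: "nat \<Rightarrow> complex"
  assumes g: "summable (\<lambda>m. norm (g m))" and e: "e > 0"
  obtains M \<eta> where "\<eta> > 0"
    "\<And>\<omega> \<omega>' :: nat \<Rightarrow> complex. (\<And>m. norm (\<omega> m) \<le> 1) \<Longrightarrow> (\<And>m. norm (\<omega>' m) \<le> 1) \<Longrightarrow>
       (\<And>m. m < M \<Longrightarrow> norm (\<omega> m - \<omega>' m) < \<eta>) \<Longrightarrow>
       norm ((suminf (\<lambda>m. g m * \<omega> m)) - (suminf (\<lambda>m. g m * \<omega>' m))) < e"
proof -
  have "(\<lambda>n. suminf (\<lambda>m. norm (g (m + n)))) \<longlonglongrightarrow> 0" using suminf_exist_split2[OF g] by simp
  hence "eventually (\<lambda>n. (suminf (\<lambda>m. norm (g (m + n)))) < e / 4) sequentially"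
    using e by (intro order_tendstoD) auto
  then obtain M where M: "(suminf (\<lambda>m. norm (g (m + M)))) < e / 4" by (auto simp: eventually_sequentially)
  define S where "S = (suminf (\<lambda>m. norm (g m))) + 1"
  have S: "S > 0" unfolding S_def using suminf_nonneg[OF g] by simp
  define \<eta> where "\<eta> = e / (2 * S)"
  show ?thesis
  proof (rule that[of \<eta> M])
    show "\<eta> > 0" using e S by (simp add: \<eta>_def)
    fix \<omega> \<omega>' :: "nat \<Rightarrow> complex"
    assume n1: "\<And>m. norm (\<omega> m) \<le> 1" and n2: "\<And>m. norm (\<omega>' m) \<le> 1"
      and d: "\<And>m. m < M \<Longrightarrow> norm (\<omega> m - \<omega>' m) < \<eta>"
    have sm: "summable (\<lambda>m. norm (g m * \<omega> m))" if "\<And>m. norm (\<omega> m) \<le> 1" for \<omega>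
      by (rule summable_comparison_test'[OF g]) (use that in \<open>auto simp: norm_mult intro: mult_left_le\<close>)
    define h where "h = (\<lambda>m. norm (g m * \<omega> m - g m * \<omega>' m))"
    have hle: "h m \<le> 2 * norm (g m)" for m
    proof -
      have "norm (\<omega> m - \<omega>' m) \<le> 2" using norm_triangle_ineq4[of "\<omega> m" "\<omega>' m"] n1[of m] n2[of m] by simp
      hence "norm (g m) * norm (\<omega> m - \<omega>' m) \<le> norm (g m) * 2" by (intro mult_left_mono) auto
      thus ?thesis unfolding h_def by (simp add: right_diff_distrib[symmetric] norm_mult)
    qed
    have sh: "summable h"
      by (rule summable_comparison_test'[OF summable_mult[OF g, of 2]]) (use hle in \<open>auto simp: h_def\<close>)
    have "(suminf (\<lambda>m. g m * \<omega> m)) - (suminf (\<lambda>m. g m * \<omega>' m)) = (suminf (\<lambda>m. g m * \<omega> m - g m * \<omega>' m))"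
      using sm[OF n1] sm[OF n2] by (intro suminf_diff) (auto intro: summable_norm_cancel)
    hence "norm ((suminf (\<lambda>m. g m * \<omega> m)) - (suminf (\<lambda>m. g m * \<omega>' m))) \<le> suminf h"
      using summable_norm[of "\<lambda>m. g m * \<omega> m - g m * \<omega>' m"] sh by (simp add: h_def)
    also have "\<dots> = (suminf (\<lambda>m. h (m + M))) + (\<Sum>m<M. h m)" using sh by (rule suminf_split_initial_segment)
    also have "(suminf (\<lambda>m. h (m + M))) \<le> (suminf (\<lambda>m. 2 * norm (g (m + M))))"
      using sh g hle by (intro suminf_le summable_mult) (auto simp: summable_iff_shift[of h] summable_iff_shift[of "\<lambda>m. norm (g m)"])
    also have "\<dots> = 2 * (suminf (\<lambda>m. norm (g (m + M))))"
      using g by (intro suminf_mult) (auto simp: summable_iff_shift[of "\<lambda>m. norm (g m)"])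
    also have "(\<Sum>m<M. h m) \<le> (\<Sum>m<M. \<eta> * norm (g m))"
    proof (rule sum_mono)
      fix m assume "m \<in> {..<M}"
      hence "norm (g m) * norm (\<omega> m - \<omega>' m) \<le> norm (g m) * \<eta>" using d[of m] by (intro mult_left_mono) auto
      thus "h m \<le> \<eta> * norm (g m)" unfolding h_def by (simp add: right_diff_distrib[symmetric] norm_mult mult.commute[of "norm (g m)" \<eta>])
    qed
    also have "\<dots> = \<eta> * (\<Sum>m<M. norm (g m))" by (simp add: sum_distrib_left)
    also have "\<dots> \<le> \<eta> * S"
    proof (rule mult_left_mono)
      show "(\<Sum>m<M. norm (g m)) \<le> S"
        using sum_le_suminf[OF g, of "{..<M}"] by (simp add: S_def)
      show "0 \<le> \<eta>" using e S by (simp add: \<eta>_def)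
    qed
    also have "\<eta> * S = e / 2" using S by (simp add: \<eta>_def)
    finally show "norm ((suminf (\<lambda>m. g m * \<omega> m)) - (suminf (\<lambda>m. g m * \<omega>' m))) < e" using M by simp
  qed
qed

lemma of_real_powr_vertical:
  assumes "x > 0"
  shows "complex_of_real x powr - Complex \<sigma> t = of_real (x powr - \<sigma>) * cis (- (t * ln x))"
proof -
  have "complex_of_real x powr - Complex \<sigma> t = exp (- Complex \<sigma> t * Ln (of_real x))"
    using assms by (simp add: powr_def)
  also have "Ln (complex_of_real x) = of_real (ln x)" by (rule Ln_of_real[OF assms])
  also have "- Complex \<sigma> t * of_real (ln x) = of_real (- \<sigma> * ln x) + \<i> * of_real (- (t * ln x))"
    by (simp add: complex_eq_iff)
  also have "exp \<dots> = exp (of_real (- \<sigma> * ln x)) * exp (\<i> * of_real (- (t * ln x)))"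
    by (rule exp_add)
  also have "exp (complex_of_real (- \<sigma> * ln x)) = of_real (x powr - \<sigma>)"
    using assms by (subst exp_of_real) (simp add: powr_def)
  also have "exp (\<i> * of_real (- (t * ln x))) = cis (- (t * ln x))" by (rule cis_conv_exp[symmetric])
  finally show ?thesis .
qed

lemma dser_vertical:
  assumes "\<beta> > 0"
  shows "dser \<beta> c \<nu> (Complex \<sigma> t) =
    (suminf (\<lambda>m. (c m * of_real ((- ln (real m + \<beta>)) ^ \<nu> * (real m + \<beta>) powr - \<sigma>)) * cis (- (t * ln (real m + \<beta>)))))"
  unfolding dser_def
proof (rule suminf_cong)
  fix m
  have x: "real m + \<beta> > 0" using assms by simp
  show "c m * of_real ((- ln (real m + \<beta>)) ^ \<nu>) * of_real (real m + \<beta>) powr - Complex \<sigma> t =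
    (c m * of_real ((- ln (real m + \<beta>)) ^ \<nu> * (real m + \<beta>) powr - \<sigma>)) * cis (- (t * ln (real m + \<beta>)))"
    unfolding of_real_powr_vertical[OF x] of_real_mult by (simp only: mult.assoc)
qed

section \<open>Continuation of the periodic Hurwitz zeta-function\<close>

text \<open>The falling factorial; \<open>falling w k / fact k\<close> is the binomial coefficient
  of \<open>w\<close> over \<open>k\<close>, which makes it the Taylor coefficient of
  \<open>(x + 1) powr w\<close>.\<close>

definition falling :: "complex \<Rightarrow> nat \<Rightarrow> complex" where
  "falling w k = (\<Prod>j<k. w - of_nat j)"

text \<open>Taylor's formula on the segment from \<open>x\<close> to \<open>x + 1\<close>. The
  hypothesis on \<open>Re w\<close> makes the derivative of order n + 1 largest at the left
  endpoint.\<close>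

lemma powr_increment_taylor:
  fixes w :: complex and x :: real
  assumes x: "x > 0" and n: "Re w \<le> real (Suc n)"
  shows "norm (of_real (x + 1) powr w - (\<Sum>k\<le>n. falling w k / fact k * of_real x powr (w - of_nat k)))
      \<le> norm (falling w (Suc n)) * x powr (Re w - real (Suc n))"
proof -
  define S where "S = closed_segment (complex_of_real x) (of_real (x + 1))"
  define f where "f = (\<lambda>i z. falling w i * z powr (w - of_nat i))"
  have S: "\<exists>y. z = of_real y \<and> y \<ge> x" if z: "z \<in> S" for z
  proof -
    from z obtain u where u: "0 \<le> u" "z = (1 - u) *\<^sub>R of_real x + u *\<^sub>R of_real (x + 1)"
      by (auto simp: S_def closed_segment_def simp del: of_real_add)
    have "z = of_real (x + u)" unfolding u(2) by (simp add: scaleR_conv_of_real algebra_simps)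
    thus ?thesis using u(1) by (intro exI[of _ "x + u"]) auto
  qed
  have "norm (f 0 (of_real (x + 1)) - (\<Sum>i\<le>n. f i (of_real x) * (of_real (x + 1) - of_real x) ^ i / fact i))
    \<le> (norm (falling w (Suc n)) * x powr (Re w - real (Suc n))) * norm (complex_of_real (x + 1) - of_real x) ^ Suc n / fact n"
  proof (rule complex_Taylor)
    show "convex S" by (simp add: S_def)
    show "complex_of_real x \<in> S" "complex_of_real (x + 1) \<in> S" by (simp_all add: S_def)
    fix z assume z: "z \<in> S"
    obtain y where y: "z = of_real y" "y \<ge> x" using S[OF z] by blast
    have "z \<notin> \<real>\<^sub>\<le>\<^sub>0" using y x by (auto simp: complex_nonpos_Reals_iff)
    thus "(f i has_field_derivative f (Suc i) z) (at z within S)" for i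
      unfolding f_def falling_def
      by (auto intro!: derivative_eq_intros has_field_derivative_powr[THEN DERIV_subset] simp: algebra_simps)
    have "norm (f (Suc n) z) = norm (falling w (Suc n)) * y powr (Re w - real (Suc n))"
      using x y by (simp add: f_def norm_mult norm_of_real_powr)
    also have "\<dots> \<le> norm (falling w (Suc n)) * x powr (Re w - real (Suc n))"
      using x y n by (intro mult_left_mono powr_mono2') auto
    finally show "norm (f (Suc n) z) \<le> norm (falling w (Suc n)) * x powr (Re w - real (Suc n))" .
  qed
  also have "\<dots> = (norm (falling w (Suc n)) * x powr (Re w - real (Suc n))) / fact n" by simp
  also have "\<dots> \<le> norm (falling w (Suc n)) * x powr (Re w - real (Suc n))"
    using mult_left_mono[of 1 "fact n" "norm (falling w (Suc n)) * x powr (Re w - real (Suc n))"]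
    by (simp add: divide_le_eq fact_ge_1)
  finally show ?thesis by (simp add: f_def falling_def)
qed

text \<open>The Taylor remainder at the point q + \<beta>. Its size is q^(- Re s - n), so its sum
  over q makes sense and is holomorphic as far as Re s > 1 - n.\<close>

definition hurwitz_remainder :: "real \<Rightarrow> nat \<Rightarrow> nat \<Rightarrow> complex \<Rightarrow> complex" where
  "hurwitz_remainder \<beta> n q s = of_real (real q + \<beta> + 1) powr (1 - s)
     - (\<Sum>k\<le>n. falling (1 - s) k / fact k * of_real (real q + \<beta>) powr (1 - s - of_nat k))"

lemma hurwitz_remainder_holomorphic:
  assumes \<beta>: "\<beta> > 0"
  shows "(\<lambda>s. suminf (\<lambda>q. hurwitz_remainder \<beta> n q s)) holomorphic_on {s. Re s > 1 - real n}"
    and "Re s > 1 - real n \<Longrightarrow> summable (\<lambda>q. hurwitz_remainder \<beta> n q s)"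
proof -
  have bound: "norm (hurwitz_remainder \<beta> n q z) \<le> (W + real n + 2) ^ Suc n * ((real q + \<beta>) powr - (a + real n) + (real q + \<beta>) powr - (b + real n))"
    if z: "norm z \<le> W" "a \<le> Re z" "Re z \<le> b" and a: "a > 1 - real n" for q z W a b
  proof -
    define x where "x = real q + \<beta>"
    have x: "x > 0" using \<beta> by (simp add: x_def)
    have "norm (hurwitz_remainder \<beta> n q z) \<le> norm (falling (1 - z) (Suc n)) * x powr (Re (1 - z) - real (Suc n))"
      unfolding hurwitz_remainder_def x_def[symmetric]
      by (rule powr_increment_taylor) (use x z a in auto)
    also have "Re (1 - z) - real (Suc n) = - (Re z + real n)" by simp
    also have "norm (falling (1 - z) (Suc n)) * x powr - (Re z + real n)
        \<le> (W + real n + 2) ^ Suc n * (x powr - (a + real n) + x powr - (b + real n))"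
    proof (rule mult_mono)
      have "norm (falling (1 - z) (Suc n)) = (\<Prod>j<Suc n. norm (1 - z - of_nat j))"
        unfolding falling_def by (rule prod_norm[symmetric])
      also have "\<dots> \<le> (\<Prod>j<Suc n. W + real n + 2)"
      proof (rule prod_mono)
        fix j assume "j \<in> {..<Suc n}"
        hence j: "j \<le> n" by simp
        have "norm (1 - z - of_nat j) \<le> norm (1 - z) + norm (of_nat j :: complex)" by (rule norm_triangle_ineq4)
        also have "norm (1 - z) \<le> 1 + norm z" using norm_triangle_ineq4[of 1 z] by simp
        finally show "0 \<le> norm (1 - z - of_nat j) \<and> norm (1 - z - of_nat j) \<le> W + real n + 2"
          using z j by simp
      qed
      finally show "norm (falling (1 - z) (Suc n)) \<le> (W + real n + 2) ^ Suc n" by simp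
      show "x powr - (Re z + real n) \<le> x powr - (a + real n) + x powr - (b + real n)"
      proof (cases "x \<ge> 1")
        case True
        hence "x powr - (Re z + real n) \<le> x powr - (a + real n)" using z by (intro powr_mono) auto
        thus ?thesis by (simp add: add_increasing2)
      next
        case False
        hence "x powr - (Re z + real n) \<le> x powr - (b + real n)" using z x by (intro powr_mono') auto
        thus ?thesis by (simp add: add_increasing)
      qed
      have "norm z \<ge> 0" by simp
      hence "W \<ge> 0" using z by linarith
      thus "0 \<le> (W + real n + 2) ^ Suc n" by simp
    qed simp_all
    finally show ?thesis unfolding x_def .
  qed
  have sm: "summable (\<lambda>q. (W + real n + 2) ^ Suc n * ((real q + \<beta>) powr - (a + real n) + (real q + \<beta>) powr - (b + real n)))"
    if "a > 1 - real n" "b \<ge> a" for W a b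
    using that \<beta> by (intro summable_mult summable_add summable_shift_powr) auto
  show "summable (\<lambda>q. hurwitz_remainder \<beta> n q s)" if s: "Re s > 1 - real n"
    by (rule summable_comparison_test'[OF sm[OF s order.refl]]) (rule bound, use s in auto)
  show "(\<lambda>s. suminf (\<lambda>q. hurwitz_remainder \<beta> n q s)) holomorphic_on {s. Re s > 1 - real n}"
  proof (rule holomorphic_uniform_sequence[of _ "\<lambda>m s. \<Sum>q<m. hurwitz_remainder \<beta> n q s"])
    show "open {s. Re s > 1 - real n}" by (rule open_halfspace_Re_gt)
    have "(\<lambda>s. complex_of_real y powr (1 - s - c)) holomorphic_on A" if "y > 0" for y c A
      using that by (intro holomorphic_intros) auto
    from this[of _ _ 0] this show "(\<lambda>s. \<Sum>q<m. hurwitz_remainder \<beta> n q s) holomorphic_on {s. Re s > 1 - real n}" for m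
      unfolding hurwitz_remainder_def falling_def using \<beta>
      by (intro holomorphic_intros) (auto simp del: of_real_add)
    fix s assume "s \<in> {s. Re s > 1 - real n}"
    define d where "d = (Re s - (1 - real n)) / 2"
    have d: "d > 0" "Re s - d > 1 - real n" using \<open>s \<in> _\<close> by (auto simp: d_def field_simps)
    have re: "\<bar>Re z - Re s\<bar> \<le> d" "norm z \<le> norm s + d" if "z \<in> cball s d" for z
      using that abs_Re_le_cmod[of "z - s"] norm_triangle_ineq2[of z s]
      by (auto simp: dist_norm norm_minus_commute)
    have "uniform_limit (cball s d) (\<lambda>m s. \<Sum>q<m. hurwitz_remainder \<beta> n q s) (\<lambda>s. suminf (\<lambda>q. hurwitz_remainder \<beta> n q s)) sequentially"
    proof (rule Weierstrass_m_test)
      show "norm (hurwitz_remainder \<beta> n q z) \<le> (norm s + d + real n + 2) ^ Suc n * ((real q + \<beta>) powr - (Re s - d + real n) + (real q + \<beta>) powr - (Re s + d + real n))"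
        if "z \<in> cball s d" for q z
        using re[OF that] d by (intro bound) auto
      show "summable (\<lambda>q. (norm s + d + real n + 2) ^ Suc n * ((real q + \<beta>) powr - (Re s - d + real n) + (real q + \<beta>) powr - (Re s + d + real n)))"
        by (rule sm) (use d in auto)
    qed
    moreover have "cball s d \<subseteq> {s. Re s > 1 - real n}"
      using re d by fastforce
    ultimately show "\<exists>d>0. cball s d \<subseteq> {s. Re s > 1 - real n} \<and>
       uniform_limit (cball s d) (\<lambda>m s. \<Sum>q<m. hurwitz_remainder \<beta> n q s) (\<lambda>s. suminf (\<lambda>q. hurwitz_remainder \<beta> n q s)) sequentially"
      using d by blast
  qed
qed

text \<open>
  Summing the Taylor expansion of \<open>(x + 1) powr (1 - s)\<close> at the points \<open>x = q + \<beta>\<close> telescopes on the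
  left, and expresses \<open>(s - 1) \<zeta>(s)\<close> through \<open>\<zeta>(s + 1), \<zeta>(s + 2), \<dots>\<close>.
\<close>
lemma hurwitz_recursion:
  assumes \<beta>: "\<beta> > 0" and s: "Re s > 1"
  shows "(s - 1) * dser \<beta> (\<lambda>_. 1) 0 s = of_real \<beta> powr (1 - s)
    + (\<Sum>k=2..n+1. falling (1 - s) k / fact k * dser \<beta> (\<lambda>_. 1) 0 (s + of_nat k - 1))
    + (suminf (\<lambda>q. hurwitz_remainder \<beta> (n + 1) q s))"
proof -
  define Z where "Z = dser \<beta> (\<lambda>_. 1) 0"
  define p where "p = (\<lambda>q. complex_of_real (real q + \<beta>) powr (1 - s))"
  have Z: "(\<lambda>q. of_real (real q + \<beta>) powr - z) sums Z z" if "Re z > 1" for z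
  proof -
    have "summable (\<lambda>q. norm (1 * complex_of_real ((- ln (real q + \<beta>)) ^ 0) * of_real (real q + \<beta>) powr (- z)))"
      by (rule dser_summable[OF \<beta>, of _ 1 0]) (use \<beta> that in auto)
    from summable_sums[OF summable_norm_cancel[OF this]] show ?thesis
      unfolding Z_def dser_def by simp
  qed
  have "p \<longlonglongrightarrow> 0"
  proof (rule tendsto_norm_zero_cancel)
    have "(\<lambda>q. (real q + \<beta>) powr (1 - Re s)) \<longlonglongrightarrow> 0"
    proof (rule tendsto_neg_powr)
      show "filterlim (\<lambda>q. real q + \<beta>) at_top sequentially"
        using filterlim_tendsto_add_at_top[OF tendsto_const filterlim_real_sequentially, of \<beta>]
        by (simp add: add.commute)
    qed (use s in auto)
    thus "(\<lambda>q. norm (p q)) \<longlonglongrightarrow> 0" using \<beta> by (simp add: p_def norm_of_real_powr del: of_real_add)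
  qed
  from telescope_sums[OF this] have "(\<lambda>q. p (Suc q) - p q) sums (- (of_real \<beta> powr (1 - s)))"
    by (simp add: p_def)
  moreover have "(\<lambda>q. p (Suc q) - p q) sums ((\<Sum>k=1..n+1. falling (1 - s) k / fact k * Z (s + of_nat k - 1)) + (suminf (\<lambda>q. hurwitz_remainder \<beta> (n + 1) q s)))"
  proof -
    have "(\<lambda>q. (\<Sum>k=1..n+1. falling (1 - s) k / fact k * of_real (real q + \<beta>) powr - (s + of_nat k - 1)) + hurwitz_remainder \<beta> (n + 1) q s)
      sums ((\<Sum>k=1..n+1. falling (1 - s) k / fact k * Z (s + of_nat k - 1)) + (suminf (\<lambda>q. hurwitz_remainder \<beta> (n + 1) q s)))"
      using s by (intro sums_add sums_sum sums_mult Z summable_sums hurwitz_remainder_holomorphic(2)[OF \<beta>]) auto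
    moreover have "(\<Sum>k=1..n+1. falling (1 - s) k / fact k * of_real (real q + \<beta>) powr - (s + of_nat k - 1)) + hurwitz_remainder \<beta> (n + 1) q s = p (Suc q) - p q" for q
    proof -
      have "(\<Sum>k\<le>n+1. falling (1 - s) k / fact k * of_real (real q + \<beta>) powr (1 - s - of_nat k))
        = p q + (\<Sum>k=1..n+1. falling (1 - s) k / fact k * of_real (real q + \<beta>) powr - (s + of_nat k - 1))"
        unfolding atMost_atLeast0
        by (subst sum.atLeast_Suc_atMost) (auto simp: p_def falling_def algebra_simps intro!: sum.cong)
      thus ?thesis by (simp add: hurwitz_remainder_def p_def algebra_simps)
    qed
    ultimately show ?thesis by simp
  qed
  ultimately have "- (of_real \<beta> powr (1 - s)) = (\<Sum>k=1..n+1. falling (1 - s) k / fact k * Z (s + of_nat k - 1)) + (suminf (\<lambda>q. hurwitz_remainder \<beta> (n + 1) q s))"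
    by (rule sums_unique2)
  \<comment> \<open>The term k = 1 is \<open>(1 - s) * Z s\<close>; moved to the other side it
    becomes the left-hand side of the claim.\<close>
  also have "(\<Sum>k=1..n+1. falling (1 - s) k / fact k * Z (s + of_nat k - 1)) = 
     (1 - s) * Z s + (\<Sum>k=2..n+1. falling (1 - s) k / fact k * Z (s + of_nat k - 1))"
    by (subst sum.atLeast_Suc_atMost) (auto simp: falling_def numeral_2_eq_2)
  finally show ?thesis unfolding Z_def by (simp add: algebra_simps)
qed

text \<open>The recursion expresses the value at s through those at s + 1, s + 2 and so on, so each
  application gains a strip of width 1.\<close>

lemma hurwitz_meromorphic_halfplane:
  assumes \<beta>: "\<beta> > 0"
  shows "\<exists>f. f meromorphic_on {s. Re s > 1 - real K} \<and> (\<forall>s. Re s > 1 \<longrightarrow> f s = dser \<beta> (\<lambda>_. 1) 0 s)"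
proof (induction K)
  case 0
  have "dser \<beta> (\<lambda>_. 1) 0 holomorphic_on {s. Re s > 1}"
    by (subst holomorphic_on_open[OF open_halfspace_Re_gt])
       (use dser_has_field_derivative[OF \<beta>, of "\<lambda>_. 1" 1 0] \<beta> in auto)
  hence "dser \<beta> (\<lambda>_. 1) 0 meromorphic_on {s. Re s > 1}"
    by (intro analytic_on_imp_meromorphic_on) (simp add: analytic_on_open open_halfspace_Re_gt)
  thus ?case by auto
next
  case (Suc K)
  then obtain f where f: "f meromorphic_on {s. Re s > 1 - real K}" "\<And>s. Re s > 1 \<Longrightarrow> f s = dser \<beta> (\<lambda>_. 1) 0 s"
    by blast
  \<comment> \<open>The remainder of order \<open>K + 2\<close> converges for Re s > - 1 - K, a half
    plane containing the new one. The division by s - 1 accounts for the pole at 1.\<close>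
  define g where "g = (\<lambda>s. (of_real \<beta> powr (1 - s)
    + (\<Sum>k=2..K+2. falling (1 - s) k / fact k * f (s + of_nat k - 1))
    + (suminf (\<lambda>q. hurwitz_remainder \<beta> (K + 2) q s))) / (s - 1))"
  let ?A = "{s. Re s > 1 - real (Suc K)}"
  have "g s = dser \<beta> (\<lambda>_. 1) 0 s" if s: "Re s > 1" for s
  proof -
    have "g s = ((s - 1) * dser \<beta> (\<lambda>_. 1) 0 s) / (s - 1)"
      unfolding g_def hurwitz_recursion[OF \<beta> s, of "K + 1"]
      by (rule arg_cong[of _ _ "\<lambda>x. x / (s - 1)"]) (use s in \<open>auto simp: f(2) numeral_2_eq_2 intro!: sum.cong\<close>)
    thus ?thesis using s by auto
  qed
  moreover have "g meromorphic_on ?A"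
  proof -
    have "(\<lambda>s. f (s + of_nat k - 1)) meromorphic_on ?A" if "k \<ge> 2" for k
      by (rule meromorphic_on_compose[OF f(1)]) (use that in \<open>auto intro!: analytic_intros\<close>)
    moreover have "(\<lambda>s. falling (1 - s) k / fact k) meromorphic_on ?A" for k
      unfolding falling_def by (intro meromorphic_intros analytic_on_imp_meromorphic_on analytic_intros) auto
    ultimately have "(\<lambda>s. \<Sum>k=2..K+2. falling (1 - s) k / fact k * f (s + of_nat k - 1)) meromorphic_on ?A"
      by (intro meromorphic_on_sum meromorphic_on_mult) auto
    moreover have "(\<lambda>s. suminf (\<lambda>q. hurwitz_remainder \<beta> (K + 2) q s)) meromorphic_on ?A"
    proof (rule meromorphic_on_subset)
      have "open {s. Re s > 1 - real (K + 2)}" by (rule open_halfspace_Re_gt)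
      thus "(\<lambda>s. suminf (\<lambda>q. hurwitz_remainder \<beta> (K + 2) q s)) meromorphic_on {s. Re s > 1 - real (K + 2)}"
        using hurwitz_remainder_holomorphic(1)[OF \<beta>, of "K + 2"]
        by (intro analytic_on_imp_meromorphic_on) (simp only: analytic_on_open)
    qed auto
    moreover have "(\<lambda>s. of_real \<beta> powr (1 - s)) meromorphic_on ?A"
      using \<beta> by (intro analytic_on_imp_meromorphic_on analytic_intros) auto
    ultimately show ?thesis unfolding g_def
      by (intro meromorphic_on_divide meromorphic_on_add)
         (auto intro!: analytic_on_imp_meromorphic_on analytic_intros)
  qed
  ultimately show ?case by blast
qed

text \<open>This glues continuations on nested half planes. The difference, with its singularities
  removed, vanishes near \<open>z0\<close> and hence on the connected set; niceness then settles the
  values at the isolated exceptional points.\<close>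

lemma nicely_meromorphic_eqI:
  assumes nice: "f nicely_meromorphic_on A" "g nicely_meromorphic_on A"
    and A: "open A" "connected A" and z0: "z0 \<in> A" "eventually (\<lambda>z. f z = g z) (at z0)"
    and z: "z \<in> A"
  shows "f z = g z"
proof -
  define h where "h = remove_sings (\<lambda>z. f z - g z)"
  have mero: "(\<lambda>z. f z - g z) meromorphic_on A"
    using nice unfolding nicely_meromorphic_on_def by (intro meromorphic_intros) auto
  have h: "h nicely_meromorphic_on A"
    unfolding h_def by (rule remove_sings_nicely_meromorphic[OF mero])
  have ev_h: "eventually (\<lambda>w. h w = f w - g w) (at z)" if "z \<in> A" for z
    unfolding h_def
    by (rule eventually_remove_sings_eq_at)
       (use mero that in \<open>auto intro: meromorphic_on_isolated_singularity meromorphic_on_subset\<close>)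
  have "eventually (\<lambda>w. h w = 0) (at z0)"
    using ev_h[OF z0(1)] z0(2) by eventually_elim simp
  hence "frequently (\<lambda>w. h w = 0) (at z0)"
    by (intro eventually_frequently) auto
  hence h0: "h w = 0" if "w \<in> A" for w
    using frequently_eq_meromorphic_imp_constant[OF _ h A z0(1)] that by blast
  have "eventually (\<lambda>w. w \<in> A) (at z)" using A z by (intro eventually_at_in_open') auto
  hence ev: "eventually (\<lambda>w. f w = g w) (at z)"
    using ev_h[OF z] by eventually_elim (simp add: h0)
  have pole: "is_pole f z \<longleftrightarrow> is_pole g z" using ev by (intro is_pole_cong refl)
  have f: "is_pole f z \<and> f z = 0 \<or> f \<midarrow>z\<rightarrow> f z" and g: "is_pole g z \<and> g z = 0 \<or> g \<midarrow>z\<rightarrow> g z"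
    using nice z by (auto simp: nicely_meromorphic_on_def)
  show "f z = g z"
  proof (cases "is_pole f z")
    case True
    hence "\<not> f \<midarrow>z\<rightarrow> f z" "\<not> g \<midarrow>z\<rightarrow> g z"
      using pole not_tendsto_and_filterlim_at_infinity[of "at z"] unfolding is_pole_def by fastforce+
    with f g show ?thesis by auto
  next
    case False
    hence "f \<midarrow>z\<rightarrow> f z" "g \<midarrow>z\<rightarrow> g z" using f g pole by auto
    moreover from this have "f \<midarrow>z\<rightarrow> g z" using tendsto_cong[OF ev] by blast
    ultimately show ?thesis using LIM_unique by blast
  qed
qed

lemma hurwitz_meromorphic_continuation:
  assumes \<beta>: "\<beta> > 0"
  obtains f where "f meromorphic_on UNIV" "\<And>s. Re s > 1 \<Longrightarrow> f s = dser \<beta> (\<lambda>_. 1) 0 s"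
proof -
  obtain f where f: "\<And>K. f K meromorphic_on {s. Re s > 1 - real K}"
    "\<And>K s. Re s > 1 \<Longrightarrow> f K s = dser \<beta> (\<lambda>_. 1) 0 s"
    using hurwitz_meromorphic_halfplane[OF \<beta>] by metis
  \<comment> \<open>Nice representatives have determined values also at poles and removable
    singularities, so on overlaps they agree pointwise and not merely off a discrete set.\<close>
  define g where "g = (\<lambda>K. remove_sings (f K))"
  have g: "g K nicely_meromorphic_on {s. Re s > 1 - real K}" for K
    unfolding g_def by (rule remove_sings_nicely_meromorphic[OF f(1)])
  have analytic: "f K analytic_on {s}" if s: "Re s > 1" for K s
  proof -
    have "dser \<beta> (\<lambda>_. 1) 0 holomorphic_on {s. Re s > 1}"
      by (subst holomorphic_on_open[OF open_halfspace_Re_gt])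
         (use dser_has_field_derivative[OF \<beta>, of "\<lambda>_. 1" 1 0] \<beta> in auto)
    hence "f K holomorphic_on {s. Re s > 1}" by (rule holomorphic_transform) (simp add: f(2))
    hence "f K analytic_on {s. Re s > 1}" by (simp add: analytic_on_open open_halfspace_Re_gt)
    thus ?thesis using s by (auto intro: analytic_on_subset)
  qed
  have g1: "g K s = dser \<beta> (\<lambda>_. 1) 0 s" if "Re s > 1" for K s
    unfolding g_def using analytic[OF that] f(2)[OF that] by simp
  have ev: "eventually (\<lambda>z. z \<in> {s. Re s > a}) (nhds z0)" if "Re z0 > a" for z0 a
    using that by (intro eventually_nhds_in_open open_halfspace_Re_gt) auto
  have gg: "g K s = g L s" if "K \<le> L" "Re s > 1 - real K" for K L s
  proof (rule nicely_meromorphic_eqI[OF g[of K] nicely_meromorphic_on_subset[OF g[of L]] open_halfspace_Re_gt, of 2])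
    show "connected {s. Re s > 1 - real K}" by (intro convex_connected convex_halfspace_Re_gt)
    have "eventually (\<lambda>z::complex. z \<in> {s. Re s > 1}) (at 2)"
      using ev[of 1 2] by (simp add: eventually_at_filter eventually_mono)
    thus "eventually (\<lambda>z. g K z = g L z) (at 2)"
      by eventually_elim (simp add: g1)
  qed (use that in auto)
  \<comment> \<open>An explicit index whose half plane contains s; by \<open>gg\<close> every other
    such index gives the same value.\<close>
  define F where "F = (\<lambda>s. g (nat \<lceil>1 - Re s\<rceil> + 1) s)"
  have F: "F s = g K s" if "Re s > 1 - real K" for K s
  proof -
    have "1 - real (nat \<lceil>1 - Re s\<rceil> + 1) < Re s" by linarith
    thus ?thesis unfolding F_def using gg[of K _ s] gg[of _ K s] that by (metis nle_le)
  qed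
  show ?thesis
  proof (rule that[of F])
    show "F s = dser \<beta> (\<lambda>_. 1) 0 s" if "Re s > 1" for s
      unfolding F_def by (rule g1[OF that])
    have "F meromorphic_on {z}" for z
    proof -
      obtain K :: nat where K: "Re z > 1 - real K"
        using reals_Archimedean2[of "1 - Re z"] by (metis diff_less_eq add.commute)
      have "eventually (\<lambda>w. w \<in> {s. Re s > 1 - real K}) (at z)"
        using ev[OF K] by (simp add: eventually_at_filter eventually_mono)
      hence "eventually (\<lambda>w. F w = g K w) (at z)" by eventually_elim (simp add: F)
      moreover have "g K meromorphic_on {z}"
        using g[of K] K by (auto simp: nicely_meromorphic_on_def intro: meromorphic_on_subset)
      ultimately show ?thesis using meromorphic_on_cong[of "{z}" F "g K" "{z}"] by auto
    qed
    thus "F meromorphic_on UNIV" by (simp add: meromorphic_on_def)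
  qed
qed

text \<open>Splitting m = q k + i by residues reduces the series to Hurwitz zeta-functions with
  shifts (i + \<alpha>) / k. Existence is what makes the description behind
  \<open>periodic_hurwitz_zeta\<close> usable.\<close>

lemma periodic_hurwitz_exists:
  assumes \<alpha>: "\<alpha> > 0" and b: "is_period b k"
  shows "is_periodic_hurwitz_zeta \<alpha> b (periodic_hurwitz_zeta \<alpha> b)"
proof -
  have k: "k > 0" and per: "\<And>m. b (m + k) = b m" using b by (auto simp: is_period_def)
  have per': "b (q * k + i) = b i" for q i
  proof (induction q)
    case (Suc q)
    thus ?case using per[of "q * k + i"] by (simp add: add_ac)
  qed simp
  have pos: "(real i + \<alpha>) / real k > 0" for i using \<alpha> k by simp
  have "\<exists>f. f meromorphic_on UNIV \<and> (\<forall>s. Re s > 1 \<longrightarrow> f s = dser ((real i + \<alpha>) / real k) (\<lambda>_. 1) 0 s)" for i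
    by (rule hurwitz_meromorphic_continuation[OF pos[of i]]) blast
  then obtain H where H: "\<And>i. H i meromorphic_on UNIV" "\<And>i s. Re s > 1 \<Longrightarrow> H i s = dser ((real i + \<alpha>) / real k) (\<lambda>_. 1) 0 s"
    by metis
  define f where "f = (\<lambda>s. of_nat k powr - s * (\<Sum>i<k. b i * H i s))"
  have "f meromorphic_on UNIV"
    unfolding f_def
  proof (intro meromorphic_on_mult meromorphic_on_sum meromorphic_on_const H)
    show "(\<lambda>s. complex_of_nat k powr - s) meromorphic_on UNIV"
      using k by (intro analytic_on_imp_meromorphic_on analytic_intros) auto
  qed
  have bdd: "norm (b m) \<le> (\<Sum>i<k. norm (b i))" for m
  proof -
    have "b m = b (m mod k)" using per'[of "m div k" "m mod k"] by simp
    also have "norm \<dots> \<le> (\<Sum>i<k. norm (b i))" using k by (intro member_le_sum) auto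
    finally show ?thesis .
  qed
  have sums_f: "(\<lambda>m. b m * of_real (real m + \<alpha>) powr (- s)) sums f s" if s: "Re s > 1" for s
  proof -
    define t where "t = (\<lambda>m. b m * of_real (real m + \<alpha>) powr (- s))"
    have "summable (\<lambda>m. norm (b m * complex_of_real ((- ln (real m + \<alpha>)) ^ 0) * of_real (real m + \<alpha>) powr (- s)))"
      by (rule dser_summable[OF \<alpha>, of b "\<Sum>i<k. norm (b i)" 0]) (use bdd \<alpha> s in auto)
    hence sums_t: "t sums suminf t" unfolding t_def by (intro summable_sums) (auto dest: summable_norm_cancel)
    have "(\<lambda>q. sum t {q*k..<q*k+k}) sums suminf t" by (rule sums_group[OF sums_t k])
    moreover have "(\<lambda>q. sum t {q*k..<q*k+k}) sums f s"
    proof -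
      \<comment> \<open>The factors 1 and \<open>^ 0\<close> keep the shape that
        \<open>dser_def\<close> takes for constant coefficients and \<nu> = 0.\<close>
      have "sum t {q*k..<q*k+k} = of_nat k powr - s * (\<Sum>i<k. b i * (1 * complex_of_real ((- ln (real q + (real i + \<alpha>) / real k)) ^ 0) * of_real (real q + (real i + \<alpha>) / real k) powr - s))" for q
      proof -
        have "sum t {q*k..<q*k+k} = (\<Sum>i<k. t (q * k + i))"
          using sum.shift_bounds_nat_ivl[of t 0 "q*k" k] by (simp add: atLeast0LessThan add.commute)
        also have "\<dots> = (\<Sum>i<k. of_nat k powr - s * (b i * of_real (real q + (real i + \<alpha>) / real k) powr - s))"
        proof (rule sum.cong[OF refl])
          fix i
          have "real (q * k + i) + \<alpha> = real k * (real q + (real i + \<alpha>) / real k)"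
            using k by (simp add: field_simps)
          hence "complex_of_real (real (q * k + i) + \<alpha>) powr - s
             = (of_real (real k) * of_real (real q + (real i + \<alpha>) / real k)) powr - s"
            by (simp only: of_real_mult)
          also have "\<dots> = of_real (real k) powr - s * of_real (real q + (real i + \<alpha>) / real k) powr - s"
            using \<alpha> k by (intro powr_times_real) auto
          finally show "t (q * k + i) = of_nat k powr - s * (b i * of_real (real q + (real i + \<alpha>) / real k) powr - s)"
            unfolding t_def per' by simp
        qed
        finally show ?thesis by (simp add: sum_distrib_left)
      qed
      moreover have "(\<lambda>q. of_nat k powr - s * (\<Sum>i<k. b i * (1 * complex_of_real ((- ln (real q + (real i + \<alpha>) / real k)) ^ 0) * of_real (real q + (real i + \<alpha>) / real k) powr - s))) sums f s"
        unfolding f_def H(2)[OF s] dser_def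
      proof (intro sums_mult sums_sum summable_sums)
        fix i
        have nz: "real q + (real i + \<alpha>) / real k \<noteq> 0" for q
          using add_nonneg_pos[OF of_nat_0_le_iff[of q] pos[of i]] by simp
        have "summable (\<lambda>q. norm (1 * complex_of_real ((- ln (real q + (real i + \<alpha>) / real k)) ^ 0) * of_real (real q + (real i + \<alpha>) / real k) powr - s))"
          by (rule dser_summable[OF pos[of i], of _ 1 0]) (use s pos nz in \<open>auto simp: less_imp_le\<close>)
        thus "summable (\<lambda>q. 1 * complex_of_real ((- ln (real q + (real i + \<alpha>) / real k)) ^ 0) * of_real (real q + (real i + \<alpha>) / real k) powr - s)"
          by (rule summable_norm_cancel)
      qed
      ultimately show ?thesis by simp
    qed
    ultimately have "suminf t = f s" by (rule sums_unique2)
    thus ?thesis using sums_t unfolding t_def by simp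
  qed
  have bound0: "norm (b m) \<le> (\<Sum>i<k. norm (b i)) * (real m + \<alpha>) powr 0" for m
    using bdd[of m] \<alpha> by simp
  have f_dser: "f s = dser \<alpha> b 0 s" if "Re s > 1" for s
    using sums_f[OF that] unfolding dser_def by (simp add: sums_iff)
  have "dser \<alpha> b 0 holomorphic_on {s. Re s > 1}"
    by (subst holomorphic_on_open[OF open_halfspace_Re_gt])
       (use dser_has_field_derivative[OF \<alpha> bound0] in auto)
  hence "f holomorphic_on {s. Re s > 1}" by (rule holomorphic_transform) (simp add: f_dser)
  hence "f analytic_on {s. Re s > 1}" by (simp add: analytic_on_open open_halfspace_Re_gt)
  hence ana: "f analytic_on {s}" if "Re s > 1" for s using that by (auto intro: analytic_on_subset)
  \<comment> \<open>Removing singularities makes \<open>f\<close> nice; for Re s > 1 it is analytic,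
    so the values given by the series are kept.\<close>
  have "is_periodic_hurwitz_zeta \<alpha> b (remove_sings f)"
    unfolding is_periodic_hurwitz_zeta_def
    using remove_sings_nicely_meromorphic[OF \<open>f meromorphic_on UNIV\<close>] sums_f ana by simp
  thus ?thesis using periodic_hurwitz_zeta_eqI by metis
qed

section \<open>Divergent series over primes and residue classes\<close>

lemma nat_eq_prod_times_square:
  fixes n :: nat
  assumes "n > 0"
  shows "n = \<Prod>{p \<in> prime_factors n. odd (multiplicity p n)} * (\<Prod>p\<in>prime_factors n. p ^ (multiplicity p n div 2))\<^sup>2"
proof -
  have "n = (\<Prod>p\<in>prime_factors n. p ^ multiplicity p n)"
    using prime_factorization_nat[OF assms] by simp
  also have "\<dots> = (\<Prod>p\<in>prime_factors n. p ^ (multiplicity p n mod 2) * (p ^ (multiplicity p n div 2))\<^sup>2)"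
  proof (rule prod.cong[OF refl])
    fix p
    have "p ^ multiplicity p n = p ^ (multiplicity p n mod 2 + (multiplicity p n div 2) * 2)" by simp
    thus "p ^ multiplicity p n = p ^ (multiplicity p n mod 2) * (p ^ (multiplicity p n div 2))\<^sup>2"
      by (simp only: power_add power_mult)
  qed
  also have "\<dots> = (\<Prod>p\<in>prime_factors n. p ^ (multiplicity p n mod 2)) * (\<Prod>p\<in>prime_factors n. p ^ (multiplicity p n div 2))\<^sup>2"
    by (simp add: prod.distrib prod_power_distrib)
  also have "(\<Prod>p\<in>prime_factors n. p ^ (multiplicity p n mod 2)) = \<Prod>{p \<in> prime_factors n. odd (multiplicity p n)}"
    by (rule prod.mono_neutral_cong_right) (auto simp: odd_iff_mod_2_eq_one)
  finally show ?thesis .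
qed

text \<open>Such a number is a squarefree number, given by a set of primes below \<open>K\<close>,
  times the square of a number at most \<open>L\<close>.\<close>

lemma card_smooth_numbers_le:
  "card {n \<in> {1..L\<^sup>2}. \<forall>p\<in>prime_factors n. p < K} \<le> 2 ^ K * (L + 1)"
proof -
  have "{n \<in> {1..L\<^sup>2}. \<forall>p\<in>prime_factors n. p < K} \<subseteq> (\<lambda>(S, q). \<Prod>S * q\<^sup>2) ` (Pow {..<K} \<times> {..L})"
  proof
    fix n assume n: "n \<in> {n \<in> {1..L\<^sup>2}. \<forall>p\<in>prime_factors n. p < K}"
    define S where "S = {p \<in> prime_factors n. odd (multiplicity p n)}"
    define q where "q = (\<Prod>p\<in>prime_factors n. p ^ (multiplicity p n div 2))"
    have eq: "n = \<Prod>S * q\<^sup>2" using n nat_eq_prod_times_square[of n] by (simp add: S_def q_def)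
    have "\<Prod>S \<noteq> 0" using n eq by (intro notI) simp
    hence "q\<^sup>2 \<le> n" using eq by (cases "\<Prod>S") auto
    also have "n \<le> L\<^sup>2" using n by simp
    finally have "q\<^sup>2 \<le> L\<^sup>2" .
    hence "q \<le> L" by (rule power2_le_imp_le) simp
    moreover have "S \<subseteq> {..<K}" using n by (auto simp: S_def)
    ultimately have "(S, q) \<in> Pow {..<K} \<times> {..L}" by simp
    thus "n \<in> (\<lambda>(S, q). \<Prod>S * q\<^sup>2) ` (Pow {..<K} \<times> {..L})"
      by (rule image_eqI[rotated]) (use eq in simp)
  qed
  hence "card {n \<in> {1..L\<^sup>2}. \<forall>p\<in>prime_factors n. p < K} \<le> card ((\<lambda>(S, q). \<Prod>S * q\<^sup>2) ` (Pow {..<K} \<times> {..L}))"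
    by (intro card_mono) auto
  also have "\<dots> \<le> card (Pow {..<K} \<times> {..L})" by (intro card_image_le) auto
  also have "\<dots> = 2 ^ K * (L + 1)" by (simp add: card_cartesian_product card_Pow)
  finally show ?thesis .
qed

text \<open>Erdos's argument: too few numbers have all their prime factors among finitely many primes.\<close>
lemma not_summable_prime_reciprocals:
  "\<not> summable (\<lambda>n::nat. if prime n then 1 / real n else 0)"
proof
  define f where "f = (\<lambda>n::nat. if prime n then 1 / real n else 0)"
  assume "summable (\<lambda>n::nat. if prime n then 1 / real n else 0)"
  hence sm: "summable f" by (simp add: f_def)
  have f0: "f n \<ge> 0" for n by (simp add: f_def)
  have "(\<lambda>n. suminf (\<lambda>m. f (m + n))) \<longlonglongrightarrow> 0" using suminf_exist_split2[OF sm] .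
  hence "eventually (\<lambda>n. suminf (\<lambda>m. f (m + n)) < 1 / 2) sequentially" by (rule order_tendstoD) auto
  then obtain K where K: "suminf (\<lambda>m. f (m + K)) < 1 / 2" by (auto simp: eventually_sequentially)
  \<comment> \<open>With \<open>L = 4 * 2 ^ K\<close> the final count reads L^2 \<le> (L / 2) * (L +
    1), which is false for L > 1.\<close>
  define L :: nat where "L = 2 ^ (K + 2)"
  define A where "A = {n \<in> {1..L\<^sup>2}. \<forall>p\<in>prime_factors n. p < K}"
  define P where "P = {p \<in> {K..L\<^sup>2}. prime p}"
  have "{1..L\<^sup>2} \<subseteq> A \<union> (\<Union>p\<in>P. {n \<in> {1..L\<^sup>2}. p dvd n})"
  proof
    fix n assume n: "n \<in> {1..L\<^sup>2}"
    show "n \<in> A \<union> (\<Union>p\<in>P. {n \<in> {1..L\<^sup>2}. p dvd n})"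
    proof (cases "n \<in> A")
      case False
      then obtain p where p: "prime p" "p dvd n" "K \<le> p" using n by (auto simp: A_def not_less)
      moreover have "p \<le> n" using p n by (intro dvd_imp_le) auto
      ultimately have "p \<in> P" using n by (auto simp: P_def)
      thus ?thesis using p n by auto
    qed auto
  qed
  hence "card {1..L\<^sup>2} \<le> card (A \<union> (\<Union>p\<in>P. {n \<in> {1..L\<^sup>2}. p dvd n}))"
    by (intro card_mono) (auto simp: A_def P_def)
  also have "\<dots> \<le> card A + card (\<Union>p\<in>P. {n \<in> {1..L\<^sup>2}. p dvd n})" by (rule card_Un_le)
  also have "card (\<Union>p\<in>P. {n \<in> {1..L\<^sup>2}. p dvd n}) \<le> (\<Sum>p\<in>P. card {n \<in> {1..L\<^sup>2}. p dvd n})"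
    by (rule card_UN_le) (auto simp: P_def)
  finally have "real (card {1..L\<^sup>2}) \<le> real (card A + (\<Sum>p\<in>P. card {n \<in> {1..L\<^sup>2}. p dvd n}))"
    by linarith
  hence "real (L\<^sup>2) \<le> real (card A) + (\<Sum>p\<in>P. real (card {n \<in> {1..L\<^sup>2}. p dvd n}))" by simp
  also have "(\<Sum>p\<in>P. real (card {n \<in> {1..L\<^sup>2}. p dvd n})) \<le> (\<Sum>p\<in>P. real (L\<^sup>2) * f p)"
  proof (rule sum_mono)
    fix p assume p: "p \<in> P"
    hence p0: "p > 0" by (auto simp: P_def prime_gt_0_nat)
    have "{n \<in> {1..L\<^sup>2}. p dvd n} \<subseteq> (\<lambda>k. p * k) ` {1..L\<^sup>2 div p}"
    proof
      fix n assume n: "n \<in> {n \<in> {1..L\<^sup>2}. p dvd n}"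
      then obtain k where k: "n = p * k" by (auto elim: dvdE)
      have "k \<le> L\<^sup>2 div p" using n k p0 by (simp add: less_eq_div_iff_mult_less_eq mult.commute)
      moreover have "k \<ge> 1" using n k by (cases k) auto
      ultimately show "n \<in> (\<lambda>k. p * k) ` {1..L\<^sup>2 div p}" using k by auto
    qed
    hence "card {n \<in> {1..L\<^sup>2}. p dvd n} \<le> card ((\<lambda>k. p * k) ` {1..L\<^sup>2 div p})" by (intro card_mono) auto
    also have "\<dots> \<le> L\<^sup>2 div p" using card_image_le[of "{1..L\<^sup>2 div p}" "\<lambda>k. p * k"] by simp
    finally have "real (card {n \<in> {1..L\<^sup>2}. p dvd n}) \<le> real (L\<^sup>2 div p)" by simp
    also have "\<dots> \<le> real (L\<^sup>2) / real p" by (rule of_nat_div_le_of_nat)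
    finally show "real (card {n \<in> {1..L\<^sup>2}. p dvd n}) \<le> real (L\<^sup>2) * f p"
      using p by (simp add: P_def f_def)
  qed
  also have "(\<Sum>p\<in>P. real (L\<^sup>2) * f p) = real (L\<^sup>2) * (\<Sum>p\<in>P. f p)" by (simp add: sum_distrib_left)
  also have "(\<Sum>p\<in>P. f p) \<le> suminf (\<lambda>m. f (m + K))"
  proof -
    have "(\<Sum>p\<in>P. f p) = (\<Sum>m\<in>(\<lambda>p. p - K) ` P. f (m + K))"
      by (subst sum.reindex) (auto simp: P_def inj_on_def)
    also have "\<dots> \<le> suminf (\<lambda>m. f (m + K))"
      using sm f0 by (intro sum_le_suminf) (auto simp: P_def summable_iff_shift[of f])
    finally show ?thesis .
  qed
  also have "\<dots> \<le> 1 / 2" using K by simp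
  finally have "real (L\<^sup>2) \<le> real (card A) + real (L\<^sup>2) * (1 / 2)" by (simp add: mult_left_mono)
  hence "real (L\<^sup>2) \<le> 2 * real (card A)" by simp
  hence "real (L\<^sup>2) \<le> real (2 * card A)" by simp
  hence "L\<^sup>2 \<le> 2 * card A" by (simp only: of_nat_le_iff)
  moreover have "card A \<le> 2 ^ K * (L + 1)" unfolding A_def by (rule card_smooth_numbers_le)
  ultimately have "L\<^sup>2 \<le> 2 * (2 ^ K * (L + 1))" by linarith
  moreover have "L = 4 * 2 ^ K" by (simp add: L_def)
  ultimately have "L * (L * 2) \<le> L * (L + 1)" by (simp add: power2_eq_square)
  moreover have "L > 0" by (simp add: L_def)
  ultimately have "L * 2 \<le> L + 1" by (simp only: mult_le_cancel1)
  moreover have "L > 1" unfolding L_def by (rule one_less_power) auto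
  ultimately show False by simp
qed

text \<open>
  Abel summation: since \<open>\<Sum>\<^bsub>p\<le>n\<^esub> (a p - \<kappa>/2)\<close> is eventually nonnegative, the sums
  \<open>\<Sum>\<^bsub>p\<le>n\<^esub> (a p - \<kappa>/2)/p\<close> are bounded below.
\<close>
lemma not_summable_prime_weights:
  fixes a :: "nat \<Rightarrow> real"
  assumes lim: "((\<lambda>x::real. (\<Sum>p | prime p \<and> real p \<le> x. a p) /
                  real (card {p::nat. prime p \<and> real p \<le> x})) \<longlongrightarrow> \<kappa>) at_top"
    and \<kappa>: "\<kappa> > 0"
  shows "\<not> summable (\<lambda>p. if prime p then a p / real p else 0)"
proof
  assume sm: "summable (\<lambda>p. if prime p then a p / real p else 0)"
  define h where "h = (\<lambda>p. if prime p then a p - \<kappa> / 2 else 0)"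
  define H where "H = (\<lambda>n. \<Sum>p\<le>n. h p)"
  \<comment> \<open>The subtracted quotient is the boundary term of the summation by parts; with it,
    \<open>T\<close> grows by \<open>H n * (1 / n - 1 / (n + 1))\<close> at each step.\<close>
  define T where "T = (\<lambda>n. (\<Sum>p\<le>n. h p / real p) - H n / real n)"
  have "eventually (\<lambda>x::real. (\<Sum>p | prime p \<and> real p \<le> x. a p) /
                  real (card {p::nat. prime p \<and> real p \<le> x}) > \<kappa> / 2) at_top"
    using lim \<kappa> by (intro order_tendstoD) auto
  then obtain x0 where x0: "\<And>x. x \<ge> x0 \<Longrightarrow> (\<Sum>p | prime p \<and> real p \<le> x. a p) /
                  real (card {p::nat. prime p \<and> real p \<le> x}) > \<kappa> / 2"
    by (auto simp: eventually_at_top_linorder)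
  define N0 where "N0 = max 1 (nat \<lceil>x0\<rceil>)"
  have H0: "H n \<ge> 0" if "n \<ge> N0" for n
  proof -
    have "real n \<ge> x0" using that unfolding N0_def by linarith
    from x0[OF this] have gt: "(\<Sum>p | prime p \<and> p \<le> n. a p) / real (card {p. prime p \<and> p \<le> n}) > \<kappa> / 2" by simp
    define C where "C = real (card {p. prime p \<and> p \<le> n})"
    \<comment> \<open>A quotient by 0 is 0 in HOL and could not exceed \<kappa> / 2, so there is a
      prime up to \<open>n\<close>.\<close>
    have "C \<noteq> 0"
    proof
      assume "C = 0"
      with gt[folded C_def] \<kappa> show False by simp
    qed
    moreover have "C \<ge> 0" unfolding C_def by (rule of_nat_0_le_iff)
    ultimately have "C > 0" by simp
    with gt have "(\<Sum>p | prime p \<and> p \<le> n. a p) > \<kappa> / 2 * C"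
      unfolding C_def[symmetric] by (simp add: pos_less_divide_eq)
    moreover have "H n = (\<Sum>p | prime p \<and> p \<le> n. a p - \<kappa> / 2)"
      unfolding H_def h_def by (rule sum.mono_neutral_cong_right) auto
    hence "H n = (\<Sum>p | prime p \<and> p \<le> n. a p) - \<kappa> / 2 * C"
      by (simp add: sum_subtractf C_def mult.commute)
    ultimately show ?thesis by linarith
  qed
  have T: "T n \<ge> T N0" if "n \<ge> N0" for n
    using that
  proof (induction n rule: dec_induct)
    case (step n)
    have n: "n > 0" using step by (simp add: N0_def)
    have "T (Suc n) - T n = h (Suc n) / real (Suc n) - (H n + h (Suc n)) / real (Suc n) + H n / real n"
      by (simp add: T_def H_def)
    also have "\<dots> = H n * (1 / real n - 1 / real (Suc n))"
      by (simp add: add_divide_distrib right_diff_distrib del: of_nat_Suc)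
    also have "\<dots> \<ge> 0" using H0[OF step(1)] n by (intro mult_nonneg_nonneg) (auto simp: field_simps)
    finally show ?case using step by simp
  qed simp
  \<comment> \<open>The reciprocals of the primes, times \<kappa> / 2, are the given weights minus
    those of \<open>h\<close>. The former are assumed to converge and the latter have partial sums
    bounded below.\<close>
  have "\<not> summable (\<lambda>p. \<kappa> / 2 * (if prime p then 1 / real p else 0))"
    using not_summable_prime_reciprocals \<kappa> by (simp add: summable_cmult_iff)
  moreover have "summable (\<lambda>p. \<kappa> / 2 * (if prime p then 1 / real p else 0))"
  proof -
    from sm obtain S0 where "(\<lambda>p. if prime p then a p / real p else 0) sums S0"
      by (auto simp: summable_def)
    hence "(\<lambda>n. \<Sum>p\<le>n. (if prime p then a p / real p else 0)) \<longlonglongrightarrow> S0"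
      by (simp only: sums_def_le)
    hence "bounded (range (\<lambda>n. \<Sum>p\<le>n. (if prime p then a p / real p else 0)))"
      by (rule convergent_imp_bounded)
    then obtain S where S: "\<And>n. \<bar>\<Sum>p\<le>n. (if prime p then a p / real p else 0)\<bar> \<le> S"
      unfolding bounded_iff by (auto simp: real_norm_def)
    have bd: "(\<Sum>p\<le>n. \<kappa> / 2 * (if prime p then 1 / real p else 0)) \<le> S - T N0" if "n \<ge> N0" for n
    proof -
      have "(\<Sum>p\<le>n. h p / real p) \<ge> T n" using H0[OF that] by (simp add: T_def)
      moreover have "(\<Sum>p\<le>n. \<kappa> / 2 * (if prime p then 1 / real p else 0)) + (\<Sum>p\<le>n. h p / real p)
         = (\<Sum>p\<le>n. (if prime p then a p / real p else 0))"
        unfolding sum.distrib[symmetric] by (intro sum.cong refl) (auto simp: h_def diff_divide_distrib)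
      ultimately show ?thesis using T[OF that] S[of n] by linarith
    qed
    have bd': "(\<Sum>p<n. \<kappa> / 2 * (if prime p then 1 / real p else 0)) \<le> S - T N0" for n
    proof -
      have "(\<Sum>p<n. \<kappa> / 2 * (if prime p then 1 / real p else 0)) \<le> (\<Sum>p\<le>n + N0. \<kappa> / 2 * (if prime p then 1 / real p else 0))"
        using \<kappa> by (intro sum_mono2) auto
      also have "\<dots> \<le> S - T N0" by (rule bd) simp
      finally show ?thesis .
    qed
    show ?thesis by (rule summableI_nonneg_bounded[OF _ bd']) (use \<kappa> in auto)
  qed
  ultimately show False by contradiction
qed

text \<open>A nonconstant polynomial tends to infinity, and a nonzero constant bounds itself. The
  argument is - y because each differentiation of a Dirichlet series brings down a factor -
  ln.\<close>

lemma poly_lower_bound: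
  fixes z :: "nat \<Rightarrow> complex"
  assumes "\<exists>\<nu><N. z \<nu> \<noteq> 0"
  obtains c Y where "c > 0" "\<And>y::real. y \<ge> Y \<Longrightarrow> norm (\<Sum>\<nu><N. of_real ((- y) ^ \<nu>) * z \<nu>) \<ge> c"
proof (cases "\<exists>\<nu><N. \<nu> \<noteq> 0 \<and> z \<nu> \<noteq> 0")
  case True
  then obtain \<nu> where \<nu>: "\<nu> < N" "\<nu> \<noteq> 0" "z \<nu> \<noteq> 0" by blast
  hence "\<exists>k. k \<noteq> 0 \<and> k \<le> N - 1 \<and> z k \<noteq> 0" by (intro exI[of _ \<nu>]) auto
  from polyfun_extremal[OF this, of 1] obtain r where
    r: "\<And>w. norm w \<ge> r \<Longrightarrow> norm (\<Sum>i\<le>N - 1. z i * w ^ i) \<ge> 1"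
    unfolding eventually_at_infinity by blast
  have N: "{..N - 1} = {..<N}" using \<nu> by auto
  show ?thesis
  proof (rule that[of 1 "max r 0"])
    fix y :: real assume "y \<ge> max r 0"
    hence "norm (\<Sum>i<N. z i * (of_real (- y)) ^ i) \<ge> 1"
      unfolding N[symmetric] by (intro r) simp
    thus "1 \<le> norm (\<Sum>\<nu><N. of_real ((- y) ^ \<nu>) * z \<nu>)" by (simp add: mult.commute)
  qed simp
next
  case False
  with assms have z0: "z 0 \<noteq> 0" "N > 0" by (auto intro: gr0I)
  show ?thesis
  proof (rule that[of "norm (z 0)" 0])
    fix y :: real
    have "(\<Sum>\<nu><N. of_real ((- y) ^ \<nu>) * z \<nu>) = (\<Sum>\<nu>\<in>{0}. of_real ((- y) ^ \<nu>) * z \<nu>)"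
      using False z0 by (intro sum.mono_neutral_right) auto
    thus "norm (z 0) \<le> norm (\<Sum>\<nu><N. of_real ((- y) ^ \<nu>) * z \<nu>)" by simp
  qed (use z0 in simp)
qed

lemma not_summable_lower_bound:
  fixes g h :: "nat \<Rightarrow> real"
  assumes "\<not> summable g" "c > 0" "\<And>m. g m \<ge> 0" "\<And>m. m \<ge> M \<Longrightarrow> c * g m \<le> h m"
  shows "\<not> summable h"
proof
  assume "summable h"
  hence "summable (\<lambda>m. c * g m)"
    by (rule summable_comparison_test') (use assms in auto)
  thus False using assms by (simp add: summable_cmult_iff)
qed

lemma not_summable_residue_class:
  assumes \<alpha>: "\<alpha> > 0" and k: "k > 0"
  shows "\<not> summable (\<lambda>m. if [m = i] (mod k) then 1 / (real m + \<alpha>) else 0)"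
proof
  assume "summable (\<lambda>m. if [m = i] (mod k) then 1 / (real m + \<alpha>) else 0)"
  hence "summable ((\<lambda>m. if [m = i] (mod k) then 1 / (real m + \<alpha>) else 0) \<circ> (\<lambda>q. q * k + i))"
    by (rule summable_reindex) (use \<alpha> k in \<open>auto simp: inj_on_def\<close>)
  hence "summable (\<lambda>q. 1 / (real (q * k + i) + \<alpha>))" by (simp add: o_def cong_def)
  moreover have "\<not> summable (\<lambda>q. 1 / (real (q * k + i) + \<alpha>))"
  proof (rule not_summable_lower_bound[of "\<lambda>q. inverse (real q)" "1 / (real k + real i + \<alpha>)" 1])
    show "\<not> summable (\<lambda>q. inverse (real q))" by (rule not_summable_harmonic)
    show "1 / (real k + real i + \<alpha>) > 0" using \<alpha> by simp
    fix q :: nat assume q: "q \<ge> 1"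
    have "real (q * k + i) + \<alpha> \<le> (real k + real i + \<alpha>) * real q"
    proof -
      have "(real i + \<alpha>) * 1 \<le> (real i + \<alpha>) * real q" using q \<alpha> by (intro mult_left_mono) auto
      thus ?thesis by (simp add: algebra_simps)
    qed
    hence "1 / ((real k + real i + \<alpha>) * real q) \<le> 1 / (real (q * k + i) + \<alpha>)"
      using \<alpha> q by (intro divide_left_mono mult_pos_pos) (auto intro: add_nonneg_pos)
    thus "1 / (real k + real i + \<alpha>) * inverse (real q) \<le> 1 / (real (q * k + i) + \<alpha>)"
      by (simp add: divide_simps)
  qed simp
  ultimately show False by contradiction
qed

text \<open>Independence refers to the set of columns, so repeated columns have to be excluded
  first: a repetition would leave fewer than \<open>nc\<close> vectors to span the column
  space.\<close>

lemma full_column_rank_injective: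
  fixes A :: "complex mat" and u :: "nat \<Rightarrow> complex"
  assumes A: "A \<in> carrier_mat n nc" and rank: "vec_space.rank n A = nc"
    and u: "i0 < nc" "u i0 \<noteq> 0"
  shows "\<exists>m<n. (\<Sum>i<nc. A $$ (m, i) * u i) \<noteq> 0"
proof (rule ccontr)
  assume "\<not> (\<exists>m<n. (\<Sum>i<nc. A $$ (m, i) * u i) \<noteq> 0)"
  hence z: "\<And>m. m < n \<Longrightarrow> (\<Sum>i<nc. A $$ (m, i) * u i) = 0" by blast
  interpret vec_space "TYPE(complex)" n .
  have dist: "distinct (cols A)"
  proof (rule ccontr)
    assume nd: "\<not> distinct (cols A)"
    obtain S where S: "maximal S (\<lambda>T. T \<subseteq> set (cols A) \<and> lin_indpt T)"
      using maximal_exists[of "(\<lambda>T. T \<subseteq> set (cols A) \<and> lin_indpt T)" "card (set (cols A))" "{}"]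
      by (meson List.finite_set card_mono empty_iff empty_subsetI finite_lin_indpt2 rev_finite_subset)
    then have "card S \<le> card (set (cols A))" by (simp add: card_mono maximal_def)
    also have "\<dots> < length (cols A)" using nd card_distinct card_length nat_less_le by metis
    also have "\<dots> = nc" using A by simp
    finally have "card S < nc" .
    thus False using rank_card_indpt[OF A S] rank by simp
  qed
  define v where "v = vec nc u"
  have "lin_dep (set (cols A))"
  proof (rule lin_depI[OF A _ _ _ dist])
    show "v \<in> carrier_vec nc" by (simp add: v_def)
    show "v \<noteq> 0\<^sub>v nc" using u unfolding v_def by (metis index_vec index_zero_vec(1))
    show "A *\<^sub>v v = 0\<^sub>v n"
      using A z by (intro eq_vecI) (auto simp: v_def scalar_prod_def atLeast0LessThan)
  qed
  moreover have "lin_indpt (set (cols A))" by (rule full_rank_lin_indpt[OF A rank dist])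
  ultimately show False by contradiction
qed

section \<open>The logarithm of a function with an Euler product\<close>

text \<open>The Dirichlet coefficients of the logarithm of the Euler product, read off from the
  expansion of - Ln (1 - z) in powers of z.\<close>

definition log_coeff :: "nat \<Rightarrow> (nat \<Rightarrow> nat \<Rightarrow> complex) \<Rightarrow> nat \<Rightarrow> complex" where
  "log_coeff l A n = (if primepow n then
     (\<Sum>j=1..l. A j (aprimedivisor n) ^ multiplicity (aprimedivisor n) n) / of_nat (multiplicity (aprimedivisor n) n)
   else 0)"

lemma log_coeff_prime_power:
  assumes "prime p" "k > 0"
  shows "log_coeff l A (p ^ k) = (\<Sum>j=1..l. A j p ^ k) / of_nat k"
  using assms by (simp add: log_coeff_def aprimedivisor_prime_power)

text \<open>Applied with \<open>B = 1\<close> to the crude bound on the Euler parameters and with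
  \<open>B = 0\<close> to the final one.\<close>

lemma norm_log_coeff_le:
  assumes A: "\<And>j p. j \<in> {1..l} \<Longrightarrow> prime p \<Longrightarrow> norm (A j p) \<le> real p powr B"
    and B: "B \<ge> 0" and n: "n > 0"
  shows "norm (log_coeff l A n) \<le> real l * real n powr B"
proof (cases "primepow n")
  case True
  then obtain p k where pk: "prime p" "k > 0" "n = p ^ k" by (auto simp: primepow_def)
  have p: "p > 0" using pk by (simp add: prime_gt_0_nat)
  have "norm (log_coeff l A n) = norm (\<Sum>j=1..l. A j p ^ k) / real k"
    using pk by (simp add: log_coeff_prime_power norm_divide)
  also have "\<dots> \<le> norm (\<Sum>j=1..l. A j p ^ k) / 1" using pk by (intro divide_left_mono) auto
  also have "\<dots> \<le> (\<Sum>j=1..l. norm (A j p ^ k))" by (simp add: norm_sum)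
  also have "\<dots> \<le> (\<Sum>j=1..l. (real p powr B) ^ k)"
    unfolding norm_power using A pk by (intro sum_mono power_mono) auto
  also have "(real p powr B) ^ k = real n powr B"
    using p pk by (simp add: powr_powr powr_realpow[symmetric] powr_power mult.commute)
  finally show ?thesis by simp
next
  case False
  thus ?thesis by (simp add: log_coeff_def)
qed

lemma of_nat_power_powr:
  assumes "p > 0"
  shows "of_nat (p ^ k) powr s = (of_nat p powr s :: complex) ^ k"
proof (induction k)
  case (Suc k)
  have "of_nat (p ^ Suc k) powr s = (of_nat p * of_nat (p ^ k) :: complex) powr s" by simp
  also have "\<dots> = of_nat p powr s * of_nat (p ^ k) powr s"
    by (rule powr_times_real) auto
  finally show ?case using Suc by simp
qed simp

lemma minus_Ln_sums:
  fixes z :: complex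
  assumes "norm z < 1"
  shows "(\<lambda>k. z ^ Suc k / of_nat (Suc k)) sums (- Ln (1 - z))"
proof -
  have "(\<lambda>n. - ((- (- z)) ^ n) / of_nat n) sums Ln (1 + - z)" by (rule Ln_series') (use assms in simp)
  hence "(\<lambda>n. z ^ n / of_nat n) sums (- Ln (1 - z))"
    using sums_minus by fastforce
  thus ?thesis by (subst sums_Suc_iff) simp
qed

lemma dser_1_eq: "dser 1 c 0 s = suminf (\<lambda>m. c m * of_nat (Suc m) powr (- s))"
proof -
  have "complex_of_real (real m + 1) = of_nat (Suc m)" for m by simp
  note eq = this
  show ?thesis unfolding dser_def eq by simp
qed

lemma dser_1_summable:
  assumes "\<And>m. norm (c m) \<le> C * (real m + 1) powr B" "Re s > 1 + B"
  shows "summable (\<lambda>m. norm (c m * of_nat (Suc m) powr (- s)))"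
proof -
  have "complex_of_real (real m + 1) = of_nat (Suc m)" for m by simp
  note eq = this
  show ?thesis using dser_summable[OF _ assms, of 0] unfolding eq by simp
qed

text \<open>Absolute convergence allows the series to be summed prime by prime, which gives
  principal logarithms of the single Euler factors. Exponentiating partial sums yields partial
  products, so no branch of the logarithm of the whole product has to be chosen.\<close>

lemma exp_log_series_eq_euler_product:
  assumes A: "\<And>j p. j \<in> {1..l} \<Longrightarrow> prime p \<Longrightarrow> norm (A j p) \<le> real p powr B"
    and B: "B \<ge> 0" and s: "Re s > 1 + B"
    and prod: "(\<lambda>p. if prime p then \<Prod>j=1..l. inverse (1 - A j p * of_nat p powr (- s)) else 1) has_prod P"
  shows "exp (dser 1 (\<lambda>m. log_coeff l A (Suc m)) 0 s) = P"
proof -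
  define g where "g = (\<lambda>n. log_coeff l A n * of_nat n powr (- s))"
  define S where "S = dser 1 (\<lambda>m. log_coeff l A (Suc m)) 0 s"
  define L where "L = (\<lambda>p. \<Sum>j=1..l. - Ln (1 - A j p * of_nat p powr (- s)))"
  have le: "norm (log_coeff l A (Suc m)) \<le> real l * (real m + 1) powr B" for m
  proof -
    have "norm (log_coeff l A (Suc m)) \<le> real l * real (Suc m) powr B"
      by (rule norm_log_coeff_le) (use A B in auto)
    also have "real (Suc m) = real m + 1" by simp
    finally show ?thesis .
  qed
  have sm: "summable (\<lambda>m. norm (g (Suc m)))"
    unfolding g_def by (rule dser_1_summable[OF le s])
  have z1: "norm (A j p * of_nat p powr (- s)) < 1" if "j \<in> {1..l}" "prime p" for j p
  proof -
    have p: "p > 1" using that prime_gt_1_nat by blast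
    have "norm (A j p * of_nat p powr (- s)) = norm (A j p) * real p powr (- Re s)"
      using p norm_of_real_powr[of "real p" "- s"] by (simp add: norm_mult)
    also have "\<dots> \<le> real p powr B * real p powr (- Re s)"
      using A[OF that] by (intro mult_right_mono) auto
    also have "\<dots> = real p powr (B - Re s)" by (simp add: powr_add[symmetric])
    also have "\<dots> < real p powr 0" using p s B by (intro powr_less_mono) auto
    finally show ?thesis using p by simp
  qed
  have "(\<lambda>m. g (Suc m)) sums S"
    using summable_sums[OF summable_norm_cancel[OF sm]] unfolding S_def dser_1_eq g_def .
  hence "((\<lambda>m. g (Suc m)) has_sum S) UNIV" by (rule norm_summable_imp_has_sum[OF sm])
  hence "(g has_sum S) (range Suc)" by (subst has_sum_reindex) (simp_all add: o_def)
  \<comment> \<open>Off the prime powers \<open>g\<close> vanishes; in the next reindexing the pair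
    (p, k) stands for \<open>p ^ Suc k\<close>.\<close>
  also have "?this \<longleftrightarrow> (g has_sum S) (Collect primepow)"
  proof (rule has_sum_cong_neutral)
    fix n assume "n \<in> Collect primepow - range Suc"
    hence "n = 0" by (cases n) auto
    thus "g n = 0" by (simp add: g_def log_coeff_def)
  qed (auto simp: g_def log_coeff_def)
  also have "\<dots> \<longleftrightarrow> ((\<lambda>x. g ((\<lambda>(p, k). p ^ Suc k) x)) has_sum S) (Collect prime \<times> UNIV)"
    by (rule has_sum_reindex_bij_betw[OF bij_betw_primepows, symmetric])
  also have "(\<lambda>x. g ((\<lambda>(p, k). p ^ Suc k) x)) = (\<lambda>(p, k). g (p ^ Suc k))" by (simp add: fun_eq_iff)
  finally have pairs: "((\<lambda>(p, k). g (p ^ Suc k)) has_sum S) (Sigma (Collect prime) (\<lambda>_. UNIV))" .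
  have "(L has_sum S) (Collect prime)"
  proof (rule has_sum_SigmaD[OF pairs])
    fix p :: nat assume "p \<in> Collect prime"
    hence p: "prime p" "p > 0" by (auto simp: prime_gt_0_nat)
    have "(\<lambda>k. g (p ^ Suc k)) summable_on UNIV"
      by (rule summable_on_SigmaD1[OF has_sum_imp_summable[OF pairs] \<open>p \<in> Collect prime\<close>])
    then obtain x where x: "((\<lambda>k. g (p ^ Suc k)) has_sum x) UNIV" unfolding summable_on_def ..
    have "(\<lambda>k. g (p ^ Suc k)) sums x" by (rule has_sum_imp_sums[OF x])
    moreover have "(\<lambda>k. g (p ^ Suc k)) sums L p"
    proof -
      have "(\<lambda>k. \<Sum>j=1..l. (A j p * of_nat p powr (- s)) ^ Suc k / of_nat (Suc k)) sums L p"
        unfolding L_def using z1 p by (intro sums_sum minus_Ln_sums) auto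
      moreover have "(\<Sum>j=1..l. (A j p * of_nat p powr (- s)) ^ Suc k / of_nat (Suc k)) = g (p ^ Suc k)" for k
        unfolding g_def log_coeff_prime_power[OF p(1) zero_less_Suc] of_nat_power_powr[OF p(2)]
        by (simp only: power_mult_distrib sum_distrib_right sum_divide_distrib times_divide_eq_left)
      ultimately show ?thesis by (simp only:)
    qed
    ultimately have "x = L p" by (rule sums_unique2)
    with x show "((\<lambda>k. case (p, k) of (p, k) \<Rightarrow> g (p ^ Suc k)) has_sum L p) UNIV"
      by (simp only: prod.case)
  qed
  also have "?this \<longleftrightarrow> ((\<lambda>p. if prime p then L p else 0) has_sum S) UNIV"
    by (rule has_sum_cong_neutral) auto
  finally have "(\<lambda>p. if prime p then L p else 0) sums S" by (rule has_sum_imp_sums)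
  hence "(\<lambda>n. \<Sum>p\<le>n. if prime p then L p else 0) \<longlonglongrightarrow> S" by (simp add: sums_def_le)
  hence "(\<lambda>n. exp (\<Sum>p\<le>n. if prime p then L p else 0)) \<longlonglongrightarrow> exp S" by (rule tendsto_exp)
  moreover have "exp (\<Sum>p\<le>n. if prime p then L p else 0) =
      (\<Prod>p\<le>n. if prime p then \<Prod>j=1..l. inverse (1 - A j p * of_nat p powr (- s)) else 1)" for n
  proof -
    have "exp (L p) = (\<Prod>j=1..l. inverse (1 - A j p * of_nat p powr (- s)))" if "prime p" for p
      unfolding L_def
    proof (subst exp_sum, simp, rule prod.cong[OF refl])
      fix j assume "j \<in> {1..l}"
      with z1[OF this that] have "1 - A j p * of_nat p powr (- s) \<noteq> 0" by auto
      thus "exp (- Ln (1 - A j p * of_nat p powr (- s))) = inverse (1 - A j p * of_nat p powr (- s))"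
        by (simp add: exp_minus)
    qed
    thus ?thesis by (subst exp_sum, simp) (intro prod.cong refl, auto)
  qed
  ultimately have lim1: "(\<lambda>n. \<Prod>p\<le>n. if prime p then \<Prod>j=1..l. inverse (1 - A j p * of_nat p powr (- s)) else 1) \<longlonglongrightarrow> exp S"
    by simp
  \<comment> \<open>A product in the sense of \<open>has_prod\<close> may have vanishing factors,
    which are then set aside. Once none vanishes, it is the limit of the partial products.\<close>
  have "(if prime p then \<Prod>j=1..l. inverse (1 - A j p * of_nat p powr (- s)) else 1) \<noteq> 0" for p
  proof (cases "prime p")
    case True
    have "1 - A j p * of_nat p powr (- s) \<noteq> 0" if "j \<in> {1..l}" for j
      using z1[OF that True] by auto
    thus ?thesis by simp
  qed simp
  with prod have "(\<lambda>n. \<Prod>p\<le>n. if prime p then \<Prod>j=1..l. inverse (1 - A j p * of_nat p powr (- s)) else 1) \<longlonglongrightarrow> P"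
    unfolding has_prod_def raw_has_prod_def add_0_right by auto
  with lim1 show ?thesis unfolding S_def by (rule LIMSEQ_unique)
qed

text \<open>At the first index \<open>M\<close> where the coefficients differ, multiply the
  vanishing difference of the series by (M + 1)^\<sigma>. The term at \<open>M\<close> then stays
  constant, while all later ones tend to 0 together as \<sigma> grows.\<close>

lemma dser_unique:
  assumes c: "\<And>m. norm (c m) \<le> C * (real m + 1) powr B" and d: "\<And>m. norm (d m) \<le> D * (real m + 1) powr B"
    and eq: "\<And>\<sigma>. \<sigma> > \<sigma>1 \<Longrightarrow> dser 1 c 0 (of_real \<sigma>) = dser 1 d 0 (of_real \<sigma>)"
  shows "c = d"
proof (rule ccontr)
  assume "c \<noteq> d"
  define e where "e = (\<lambda>m. c m - d m)"
  have "\<exists>m. e m \<noteq> 0" using \<open>c \<noteq> d\<close> by (auto simp: e_def fun_eq_iff)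
  define M where "M = (LEAST m. e m \<noteq> 0)"
  have M: "e M \<noteq> 0" "\<And>m. m < M \<Longrightarrow> e m = 0"
    using LeastI_ex[OF \<open>\<exists>m. e m \<noteq> 0\<close>] not_less_Least unfolding M_def by blast+
  define \<sigma>2 where "\<sigma>2 = max \<sigma>1 (1 + B) + 1"
  define t where "t = (\<lambda>\<sigma> m. e m * of_real ((real m + 1) powr - \<sigma>))"
  define u where "u = (\<lambda>m. norm (e m) * ((real M + 1) / (real m + 1)) powr \<sigma>2)"
  \<comment> \<open>The largest ratio (M + 1) / (m + 1) with m > M. Passing from
    \<open>\<sigma>2\<close> to \<open>\<sigma>2 + \<tau>\<close> multiplies each later term by at
    most \<open>q powr \<tau>\<close>.\<close>
  define q where "q = (real M + 1) / (real M + 2)"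
  have q: "0 < q" "q < 1" by (auto simp: q_def)
  have nt: "(real M + 1) powr \<sigma> * norm (t \<sigma> m) = norm (e m) * ((real M + 1) / (real m + 1)) powr \<sigma>" for \<sigma> m
  proof -
    have "norm (t \<sigma> m) = norm (e m) * (real m + 1) powr - \<sigma>"
      unfolding t_def norm_mult norm_of_real by simp
    thus ?thesis by (simp add: powr_divide powr_minus_divide)
  qed
  have sumt: "summable (\<lambda>m. norm (t \<sigma> m))" "suminf (t \<sigma>) = 0" if \<sigma>: "\<sigma> \<ge> \<sigma>2" for \<sigma>
  proof -
    have conv: "complex_of_real (real m + 1) powr (- of_real \<sigma>) = of_real ((real m + 1) powr - \<sigma>)" for m
      using powr_of_real[of "real m + 1" "- \<sigma>"] by simp
    have "summable (\<lambda>m. norm (c m * of_real ((- ln (real m + 1)) ^ 0) * of_real (real m + 1) powr (- of_real \<sigma>)))"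
      by (rule dser_summable[OF _ c]) (use \<sigma> in \<open>auto simp: \<sigma>2_def\<close>)
    hence c': "summable (\<lambda>m. norm (c m * of_real ((real m + 1) powr - \<sigma>)))" unfolding conv by simp
    have "summable (\<lambda>m. norm (d m * of_real ((- ln (real m + 1)) ^ 0) * of_real (real m + 1) powr (- of_real \<sigma>)))"
      by (rule dser_summable[OF _ d]) (use \<sigma> in \<open>auto simp: \<sigma>2_def\<close>)
    hence d': "summable (\<lambda>m. norm (d m * of_real ((real m + 1) powr - \<sigma>)))" unfolding conv by simp
    show "summable (\<lambda>m. norm (t \<sigma> m))"
      by (rule summable_comparison_test'[OF summable_add[OF c' d']])
         (simp add: t_def e_def left_diff_distrib norm_triangle_ineq4)
    have "suminf (t \<sigma>) = dser 1 c 0 (of_real \<sigma>) - dser 1 d 0 (of_real \<sigma>)"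
      unfolding dser_def conv t_def e_def left_diff_distrib
      using suminf_diff[OF summable_norm_cancel[OF c'] summable_norm_cancel[OF d']] by simp
    also have "\<dots> = 0" using eq[of \<sigma>] \<sigma> by (simp add: \<sigma>2_def)
    finally show "suminf (t \<sigma>) = 0" .
  qed
  have u: "summable u"
  proof -
    have "summable (\<lambda>m. (real M + 1) powr \<sigma>2 * norm (t \<sigma>2 m))" using sumt(1)[of \<sigma>2] by (intro summable_mult) simp
    moreover have "(real M + 1) powr \<sigma>2 * norm (t \<sigma>2 m) = u m" for m
      unfolding u_def by (rule nt)
    ultimately show ?thesis by simp
  qed
  have bound: "norm (e M) \<le> q powr \<tau> * suminf u" if \<tau>: "\<tau> \<ge> 0" for \<tau>
  proof -
    define \<sigma> where "\<sigma> = \<sigma>2 + \<tau>"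
    define h where "h = (\<lambda>m. if m = M then 0 else t \<sigma> m)"
    have \<sigma>: "\<sigma> \<ge> \<sigma>2" using \<tau> by (simp add: \<sigma>_def)
    have sh: "summable (\<lambda>m. norm (h m))"
      by (rule summable_comparison_test'[OF sumt(1)[OF \<sigma>]]) (auto simp: h_def)
    have "t \<sigma> sums 0" using sumt[OF \<sigma>] by (metis summable_norm_cancel summable_sums)
    hence "h sums (0 - t \<sigma> M)"
      unfolding h_def using sums_If_finite_set'[of "t \<sigma>" 0 "{M}" "- t \<sigma> M" "\<lambda>_. 0"] by simp
    hence "t \<sigma> M = - suminf h" by (simp add: sums_iff)
    hence "norm (t \<sigma> M) \<le> (suminf (\<lambda>m. norm (h m)))" using summable_norm[OF sh] by simp
    hence "(real M + 1) powr \<sigma> * norm (t \<sigma> M) \<le> (real M + 1) powr \<sigma> * (suminf (\<lambda>m. norm (h m)))"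
      by (intro mult_left_mono) auto
    also have "(real M + 1) powr \<sigma> * norm (t \<sigma> M) = norm (e M)"
      using nt[of \<sigma> M] by simp
    also have "(real M + 1) powr \<sigma> * (suminf (\<lambda>m. norm (h m))) = (suminf (\<lambda>m. (real M + 1) powr \<sigma> * norm (h m)))"
      by (rule suminf_mult[OF sh, symmetric])
    also have "\<dots> \<le> (suminf (\<lambda>m. q powr \<tau> * u m))"
    proof (rule suminf_le)
      show "summable (\<lambda>m. (real M + 1) powr \<sigma> * norm (h m))" by (intro summable_mult sh)
      show "summable (\<lambda>m. q powr \<tau> * u m)" by (intro summable_mult u)
      fix m
      show "(real M + 1) powr \<sigma> * norm (h m) \<le> q powr \<tau> * u m"
      proof (cases "m > M")
        case True
        have "(real M + 1) powr \<sigma> * norm (h m) = norm (e m) * ((real M + 1) / (real m + 1)) powr \<sigma>"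
          using True nt[of \<sigma> m] by (simp add: h_def)
        also have "\<dots> = u m * ((real M + 1) / (real m + 1)) powr \<tau>"
          unfolding \<sigma>_def powr_add u_def by (simp only: mult.assoc)
        also have "\<dots> \<le> u m * q powr \<tau>"
        proof (rule mult_left_mono)
          show "((real M + 1) / (real m + 1)) powr \<tau> \<le> q powr \<tau>"
            using True \<tau> unfolding q_def by (intro powr_mono2 divide_left_mono) auto
        qed (simp add: u_def)
        finally show ?thesis by (simp only: mult.commute)
      next
        case False
        hence "h m = 0" using M(2)[of m] by (auto simp: h_def t_def)
        thus ?thesis by (simp add: u_def)
      qed
    qed
    also have "\<dots> = q powr \<tau> * suminf u" by (rule suminf_mult[OF u])
    finally show ?thesis .
  qed
  have "(\<lambda>n. q ^ n * suminf u) \<longlonglongrightarrow> 0 * suminf u"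
    using q by (intro tendsto_mult LIMSEQ_power_zero tendsto_const) auto
  moreover have "norm (e M) \<le> q ^ n * suminf u" for n
    using bound[of "real n"] q by (simp add: powr_realpow)
  ultimately have "norm (e M) \<le> 0" by (intro LIMSEQ_le_const[of _ 0]) auto
  thus False using M(1) by simp
qed

text \<open>Sequences are numbered from 0, entry i being the coefficient at the integer i + 1; hence
  the successors in the condition.\<close>

definition dirichlet_conv :: "(nat \<Rightarrow> complex) \<Rightarrow> (nat \<Rightarrow> complex) \<Rightarrow> nat \<Rightarrow> complex" where
  "dirichlet_conv f g n = (\<Sum>(i, j) | Suc i * Suc j = Suc n. f i * g j)"

lemma finite_factor_pairs: "finite {(i, j). Suc i * Suc j = Suc n}"
  and factor_pairs_le: "Suc i * Suc j = Suc n \<Longrightarrow> i \<le> n \<and> j \<le> n"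
proof -
  show le: "i \<le> n \<and> j \<le> n" if "Suc i * Suc j = Suc n" for i j
    using that by (metis Suc_le_mono dvd_imp_le dvd_triv_left dvd_triv_right zero_less_Suc)
  have "{(i, j). Suc i * Suc j = Suc n} \<subseteq> {..n} \<times> {..n}" using le by auto
  thus "finite {(i, j). Suc i * Suc j = Suc n}" by (rule finite_subset) simp
qed

lemma dirichlet_conv_sums:
  assumes f: "summable (\<lambda>m. norm (f m * of_nat (Suc m) powr (- s)))"
    and g: "summable (\<lambda>m. norm (g m * of_nat (Suc m) powr (- s)))"
  shows "(\<lambda>n. dirichlet_conv f g n * of_nat (Suc n) powr (- s)) sums
     (suminf (\<lambda>m. f m * of_nat (Suc m) powr (- s)) * suminf (\<lambda>m. g m * of_nat (Suc m) powr (- s)))"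
proof -
  define F where "F = (\<lambda>m. f m * of_nat (Suc m) powr (- s))"
  define G where "G = (\<lambda>m. g m * of_nat (Suc m) powr (- s))"
  have F: "(F has_sum suminf F) UNIV" and G: "(G has_sum suminf G) UNIV"
    using norm_summable_imp_has_sum[OF f summable_sums[OF summable_norm_cancel[OF f]]]
      norm_summable_imp_has_sum[OF g summable_sums[OF summable_norm_cancel[OF g]]]
    unfolding F_def G_def by blast+
  have nF: "(\<lambda>m. norm (F m)) summable_on UNIV" and nG: "(\<lambda>m. norm (G m)) summable_on UNIV"
  proof -
    have "summable (\<lambda>m. norm (norm (F m)))" "summable (\<lambda>m. norm (norm (G m)))"
      using f g by (simp_all add: F_def G_def)
    from this[THEN norm_summable_imp_summable_on]
    show "(\<lambda>m. norm (F m)) summable_on UNIV" "(\<lambda>m. norm (G m)) summable_on UNIV" .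
  qed
  obtain x where x: "((\<lambda>m. norm (G m)) has_sum x) UNIV" using nG unfolding summable_on_def ..
  have "(\<lambda>(i, j). norm (F i) * norm (G j)) summable_on (UNIV \<times> UNIV)"
  proof (rule summable_on_SigmaI)
    show "((\<lambda>j. case (i, j) of (i, j) \<Rightarrow> norm (F i) * norm (G j)) has_sum norm (F i) * x) UNIV" for i
      using has_sum_cmult_right[OF x] by simp
    show "(\<lambda>i. norm (F i) * x) summable_on UNIV" by (intro summable_on_cmult_left nF)
  qed auto
  also have "(\<lambda>(i, j). norm (F i) * norm (G j)) = (\<lambda>x. norm ((\<lambda>(i, j). F i * G j) x))"
    by (simp add: fun_eq_iff norm_mult)
  finally have "(\<lambda>x. norm ((\<lambda>(i, j). F i * G j) x)) summable_on (UNIV \<times> UNIV)" .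
  hence "(\<lambda>(i, j). F i * G j) summable_on (UNIV \<times> UNIV)" by (rule abs_summable_summable)
  hence pairs: "((\<lambda>(i, j). F i * G j) has_sum (suminf F * suminf G)) (UNIV \<times> UNIV)"
  proof (rule has_sum_SigmaI[rotated -1])
    show "((\<lambda>j. case (i, j) of (i, j) \<Rightarrow> F i * G j) has_sum F i * suminf G) UNIV" for i
      using has_sum_cmult_right[OF G] by simp
    show "((\<lambda>i. F i * suminf G) has_sum suminf F * suminf G) UNIV" by (rule has_sum_cmult_left[OF F])
  qed
  define h where "h = (\<lambda>(n::nat, ij::nat \<times> nat). ij)"
  have bij: "bij_betw h (Sigma UNIV (\<lambda>n. {(i, j). Suc i * Suc j = Suc n})) (UNIV \<times> UNIV)"
    by (rule bij_betwI[of _ _ _ "\<lambda>(i, j). (Suc i * Suc j - 1, (i, j))"]) (auto simp: h_def)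
  have "((\<lambda>y. (\<lambda>(i, j). F i * G j) (h y)) has_sum (suminf F * suminf G)) (Sigma UNIV (\<lambda>n. {(i, j). Suc i * Suc j = Suc n}))"
    using pairs by (subst has_sum_reindex_bij_betw[OF bij])
  hence "((\<lambda>n. dirichlet_conv f g n * of_nat (Suc n) powr (- s)) has_sum (suminf F * suminf G)) UNIV"
  proof (rule has_sum_SigmaD)
    fix n :: nat
    have "(\<Sum>y\<in>{(i, j). Suc i * Suc j = Suc n}. (\<lambda>(i, j). F i * G j) (h (n, y))) = dirichlet_conv f g n * of_nat (Suc n) powr (- s)"
      unfolding dirichlet_conv_def sum_distrib_right
    proof (rule sum.cong[OF refl])
      fix y assume "y \<in> {(i, j). Suc i * Suc j = Suc n}"
      then obtain i j where ij: "y = (i, j)" "Suc i * Suc j = Suc n" by auto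
      have "complex_of_nat (Suc n) powr (- s) = (of_nat (Suc i) * of_nat (Suc j)) powr (- s)"
        unfolding ij(2)[symmetric] of_nat_mult ..
      also have "\<dots> = of_nat (Suc i) powr (- s) * of_nat (Suc j) powr (- s)"
        by (rule powr_times_real) (auto simp del: of_nat_Suc)
      finally show "(\<lambda>(i, j). F i * G j) (h (n, y)) = (case y of (i, j) \<Rightarrow> f i * g j) * of_nat (Suc n) powr (- s)"
        by (simp add: h_def ij(1) F_def G_def mult_ac del: of_nat_Suc)
    qed
    thus "((\<lambda>y. (\<lambda>(i, j). F i * G j) (h (n, y))) has_sum dirichlet_conv f g n * of_nat (Suc n) powr (- s)) {(i, j). Suc i * Suc j = Suc n}"
      by (intro has_sum_finiteI finite_factor_pairs) simp
  qed
  thus ?thesis unfolding F_def G_def by (rule has_sum_imp_sums)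
qed

text \<open>The exponent 5 is 1 and 2 from the two factors plus 2 from the number of factor pairs.
  Any polynomial bound would do for \<open>dser_unique\<close>.\<close>

lemma norm_dirichlet_conv_le:
  assumes f: "\<And>m. norm (f m) \<le> C * (real m + 1)" and g: "\<And>m. norm (g m) \<le> D * (real m + 1) powr 2"
    and "C \<ge> 0" "D \<ge> 0"
  shows "norm (dirichlet_conv f g n) \<le> C * D * (real n + 1) powr 5"
proof -
  have "norm (dirichlet_conv f g n) \<le> (\<Sum>(i, j) | Suc i * Suc j = Suc n. norm (f i) * norm (g j))"
    unfolding dirichlet_conv_def by (rule order_trans[OF norm_sum]) (simp add: norm_mult case_prod_beta)
  also have "\<dots> \<le> (\<Sum>(i, j) | Suc i * Suc j = Suc n. C * D * (real n + 1) powr 3)"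
  proof (rule sum_mono)
    fix x assume "x \<in> {(i, j). Suc i * Suc j = Suc n}"
    then obtain i j where x: "x = (i, j)" "i \<le> n" "j \<le> n" using factor_pairs_le by auto
    have "norm (f i) * norm (g j) \<le> (C * (real n + 1)) * (D * (real n + 1) powr 2)"
    proof (rule mult_mono)
      show "norm (f i) \<le> C * (real n + 1)"
        by (rule order_trans[OF f]) (use x assms(3) in \<open>auto intro!: mult_left_mono\<close>)
      show "norm (g j) \<le> D * (real n + 1) powr 2"
        by (rule order_trans[OF g]) (use x assms(4) in \<open>auto intro!: mult_left_mono powr_mono2\<close>)
    qed (use assms in auto)
    also have "(C * (real n + 1)) * (D * (real n + 1) powr 2) = C * D * ((real n + 1) powr 1 * (real n + 1) powr 2)"
      by simp
    also have "(real n + 1) powr 1 * (real n + 1) powr 2 = (real n + 1) powr 3"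
      by (simp only: powr_add[symmetric]) simp
    finally show "(case x of (i, j) \<Rightarrow> norm (f i) * norm (g j)) \<le> (case x of (i, j) \<Rightarrow> C * D * (real n + 1) powr 3)"
      by (simp add: x)
  qed
  also have "\<dots> = real (card {(i, j). Suc i * Suc j = Suc n}) * (C * D * (real n + 1) powr 3)"
    by (simp add: case_prod_beta)
  also have "\<dots> \<le> (real n + 1) powr 2 * (C * D * (real n + 1) powr 3)"
  proof (rule mult_right_mono)
    have "card {(i, j). Suc i * Suc j = Suc n} \<le> card ({..n} \<times> {..n})"
      using factor_pairs_le by (intro card_mono) auto
    hence "real (card {(i, j). Suc i * Suc j = Suc n}) \<le> real (Suc n * Suc n)"
      by (simp only: card_cartesian_product card_atMost of_nat_le_iff)
    also have "\<dots> = (real n + 1) powr 2" by (simp add: powr_numeral power2_eq_square algebra_simps)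
    finally show "real (card {(i, j). Suc i * Suc j = Suc n}) \<le> (real n + 1) powr 2" .
  qed (use assms in simp)
  also have "\<dots> = C * D * ((real n + 1) powr 2 * (real n + 1) powr 3)" by simp
  also have "(real n + 1) powr 2 * (real n + 1) powr 3 = (real n + 1) powr 5"
    by (simp only: powr_add[symmetric]) simp
  finally show ?thesis .
qed

lemma ln_power_1_le:
  assumes "x \<ge> (1::real)"
  shows "\<bar>ln x\<bar> \<le> x"
proof -
  have "0 \<le> ln x" using assms by simp
  moreover have "ln x \<le> x - 1" by (rule ln_le_minus_one) (use assms in linarith)
  ultimately show ?thesis by linarith
qed

text \<open>Comparing coefficients in \<open>\<phi>' = (log \<phi>)' \<phi>\<close>.\<close>
lemma log_derivative_coefficients:
  assumes a: "\<And>m. norm (a m) \<le> C * (real m + 1)" and c: "\<And>m. norm (c m) \<le> D * (real m + 1)"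
    and C: "C \<ge> 0" and D: "D \<ge> 0"
    and eq: "\<And>s. Re s > 2 \<Longrightarrow> dser 1 a 0 s = exp (dser 1 c 0 s)"
  shows "a n * ln (real (Suc n)) = dirichlet_conv a (\<lambda>m. c m * ln (real (Suc m))) n"
proof -
  define c' where "c' = (\<lambda>m. c m * of_real (- ln (real m + 1)))"
  define a' where "a' = (\<lambda>m. a m * of_real (- ln (real m + 1)))"
  have a1: "norm (a m) \<le> C * (real m + 1) powr 1" and c1: "norm (c m) \<le> D * (real m + 1) powr 1" for m
    using a[of m] c[of m] by simp_all
  have log_bound: "norm (x * complex_of_real (- ln (real m + 1))) \<le> E * (real m + 1) powr 2"
    if "norm x \<le> E * (real m + 1)" "E \<ge> 0" for x E m
  proof -
    have "norm (x * complex_of_real (- ln (real m + 1))) = norm x * \<bar>ln (real m + 1)\<bar>"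
      by (simp add: norm_mult)
    also have "\<dots> \<le> (E * (real m + 1)) * (real m + 1)"
      using that ln_power_1_le[of "real m + 1"] by (intro mult_mono) auto
    also have "\<dots> = E * (real m + 1) powr 2" by (simp add: powr_numeral power2_eq_square)
    finally show ?thesis .
  qed
  have c2: "norm (c' m) \<le> D * (real m + 1) powr 2" for m
    unfolding c'_def by (rule log_bound[OF c D])
  have a2: "norm (a' m) \<le> C * (real m + 1) powr 2" for m
    unfolding a'_def by (rule log_bound[OF a C])
  have der1: "dser 1 f 1 s = dser 1 (\<lambda>m. f m * of_real (- ln (real m + 1))) 0 s" for f s
    unfolding dser_def by simp
  have "dirichlet_conv a c' = a'"
  \<comment> \<open>5 is the growth exponent of the convolution. To the right of 3 the series of
    \<open>a\<close> and of \<open>c'\<close> both converge absolutely, the logarithm having raised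
    the exponent of \<open>c'\<close> to 2.\<close>
  proof (rule dser_unique[where B = 5 and ?\<sigma>1.0 = 3])
    show "norm (dirichlet_conv a c' m) \<le> C * D * (real m + 1) powr 5" for m
      by (rule norm_dirichlet_conv_le[OF a c2 C D])
    show "norm (a' m) \<le> C * (real m + 1) powr 5" for m
      by (rule order_trans[OF a2]) (intro mult_left_mono powr_mono, use C in auto)
    fix \<sigma> :: real assume \<sigma>: "\<sigma> > 3"
    define s where "s = complex_of_real \<sigma>"
    have s: "Re s > 1 + 2" "Re s > 1 + 1" using \<sigma> by (auto simp: s_def)
    have "open {s. Re s > 2}" by (rule open_halfspace_Re_gt)
    hence "eventually (\<lambda>z. z \<in> {s. Re s > 2}) (nhds s)" using s by (intro eventually_nhds_in_open) auto
    hence ev: "eventually (\<lambda>z. dser 1 a 0 z = exp (dser 1 c 0 z)) (nhds s)"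
      by eventually_elim (simp add: eq)
    have d1: "(dser 1 a 0 has_field_derivative dser 1 a (Suc 0) s) (at s)"
      by (rule dser_has_field_derivative[OF _ a1 s(2)]) simp
    have "(dser 1 c 0 has_field_derivative dser 1 c (Suc 0) s) (at s)"
      by (rule dser_has_field_derivative[OF _ c1 s(2)]) simp
    from DERIV_chain2[OF DERIV_exp this]
    have "((\<lambda>z. exp (dser 1 c 0 z)) has_field_derivative exp (dser 1 c 0 s) * dser 1 c (Suc 0) s) (at s)" .
    hence "(dser 1 a 0 has_field_derivative exp (dser 1 c 0 s) * dser 1 c (Suc 0) s) (at s)"
      using DERIV_cong_ev[OF refl ev refl] by simp
    with d1 have "dser 1 a (Suc 0) s = exp (dser 1 c 0 s) * dser 1 c (Suc 0) s" by (rule DERIV_unique)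
    also have "exp (dser 1 c 0 s) = dser 1 a 0 s" using eq s by simp
    finally have "dser 1 a' 0 s = dser 1 a 0 s * dser 1 c' 0 s"
      using der1 unfolding a'_def c'_def by simp
    also have "\<dots> = dser 1 (dirichlet_conv a c') 0 s"
      using dirichlet_conv_sums[OF dser_1_summable[OF a1 s(2)] dser_1_summable[OF c2 s(1)]]
      unfolding dser_1_eq by (simp add: sums_iff)
    finally show "dser 1 (dirichlet_conv a c') 0 (of_real \<sigma>) = dser 1 a' 0 (of_real \<sigma>)"
      unfolding s_def by simp
  qed
  hence "dirichlet_conv a c' n = a' n" by simp
  moreover have "dirichlet_conv a c' n = - dirichlet_conv a (\<lambda>m. c m * ln (real (Suc m))) n"
    unfolding dirichlet_conv_def c'_def
    by (simp add: sum_negf[symmetric] case_prod_beta add.commute)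
  ultimately show ?thesis by (simp add: a'_def add.commute)
qed

section \<open>The Euler factor at a single prime as a formal power series\<close>

lemma factor_pairs_prime_power:
  assumes "prime p"
  shows "{(i, j). Suc i * Suc j = p ^ k} = (\<lambda>e. (p ^ (k - e) - 1, p ^ e - 1)) ` {..k}"
proof (rule subset_antisym; rule subsetI)
  fix x assume "x \<in> {(i, j). Suc i * Suc j = p ^ k}"
  then obtain i j where x: "x = (i, j)" "Suc i * Suc j = p ^ k" by auto
  have "Suc j dvd p ^ k" using x(2) by (metis dvd_triv_right)
  then obtain e where e: "e \<le> k" "Suc j = p ^ e" using divides_primepow_nat[OF assms] by blast
  have p: "p > 0" using assms by (simp add: prime_gt_0_nat)
  have "Suc i * p ^ e = p ^ (k - e) * p ^ e" using x e by (simp add: power_add[symmetric])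
  hence "Suc i = p ^ (k - e)" using p by (simp only: mult_cancel2) simp
  hence "i = p ^ (k - e) - 1" by (metis diff_Suc_1)
  moreover have "j = p ^ e - 1" using e(2) by (metis diff_Suc_1)
  ultimately show "x \<in> (\<lambda>e. (p ^ (k - e) - 1, p ^ e - 1)) ` {..k}" using e x by auto
next
  fix x assume "x \<in> (\<lambda>e. (p ^ (k - e) - 1, p ^ e - 1)) ` {..k}"
  then obtain e where e: "e \<le> k" "x = (p ^ (k - e) - 1, p ^ e - 1)" by auto
  have p: "p > 0" using assms by (simp add: prime_gt_0_nat)
  have "p ^ (k - e) * p ^ e = p ^ k" using e by (simp add: power_add[symmetric])
  moreover have "Suc (p ^ (k - e) - 1) = p ^ (k - e)" "Suc (p ^ e - 1) = p ^ e" using p by simp_all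
  ultimately show "x \<in> {(i, j). Suc i * Suc j = p ^ k}" using e(2) by (simp only: mem_Collect_eq prod.case)
qed

lemma dirichlet_conv_prime_power:
  assumes p: "prime p"
  shows "dirichlet_conv f g (p ^ k - 1) = (\<Sum>e\<le>k. f (p ^ (k - e) - 1) * g (p ^ e - 1))"
proof -
  have p1: "p > 1" using p by (rule prime_gt_1_nat)
  hence eq: "Suc (p ^ k - 1) = p ^ k" by simp
  have "inj_on (\<lambda>e. (p ^ (k - e) - 1, p ^ e - 1)) {..k}"
  proof (rule inj_onI)
    fix x y assume "(p ^ (k - x) - 1, p ^ x - 1) = (p ^ (k - y) - 1, p ^ y - 1)"
    hence "p ^ x - 1 = p ^ y - 1" by simp
    moreover have "p ^ x > 0" "p ^ y > 0" using p1 by simp_all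
    ultimately have "p ^ x = p ^ y" by linarith
    thus "x = y" using p1 by simp
  qed
  thus ?thesis unfolding dirichlet_conv_def eq factor_pairs_prime_power[OF p]
    by (subst sum.reindex) simp_all
qed

text \<open>With G_j = A_j X / (1 - A_j X), the recursion says that X F' is F times the sum of the
  G_j. The product D of the factors 1 - A_j X satisfies the same equation with the opposite sign, so
  the derivative of F D is 0.\<close>

lemma fps_euler_factor:
  fixes F :: "complex fps" and A :: "'j \<Rightarrow> complex"
  assumes J: "finite J"
    and rec: "\<And>k. of_nat k * fps_nth F k = (\<Sum>e=1..k. fps_nth F (k - e) * (\<Sum>j\<in>J. A j ^ e))"
  shows "F * (\<Prod>j\<in>J. 1 - fps_const (A j) * fps_X) = fps_const (fps_nth F 0)"
proof -
  define G where "G = (\<lambda>j. Abs_fps (\<lambda>e. if e = 0 then 0 else A j ^ e))"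
  define D where "D = (\<lambda>J. \<Prod>j\<in>J. 1 - fps_const (A j) * fps_X :: complex fps)"
  have GD: "G j * (1 - fps_const (A j) * fps_X) = fps_const (A j) * fps_X" for j
  proof (rule fps_ext)
    fix n show "fps_nth (G j * (1 - fps_const (A j) * fps_X)) n = fps_nth (fps_const (A j) * fps_X) n"
      by (cases n) (auto simp: G_def right_diff_distrib mult.assoc[symmetric] mult.commute[of _ "fps_const _"]
            fps_mult_right_const_nth split: nat.splits)
  qed
  have XD: "fps_X * fps_deriv (D J) = - (\<Sum>j\<in>J. G j) * D J" if "finite J" for J
    using that
  proof induction
    case empty
    thus ?case by (simp add: D_def)
  next
    case (insert x J)
    have DJ: "D (insert x J) = (1 - fps_const (A x) * fps_X) * D J"
      using insert by (simp add: D_def)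
    have "fps_X * fps_deriv (D (insert x J)) = - (fps_const (A x) * fps_X) * D J + (1 - fps_const (A x) * fps_X) * (fps_X * fps_deriv (D J))"
      unfolding DJ by (simp add: algebra_simps)
    also have "\<dots> = - (G x * (1 - fps_const (A x) * fps_X)) * D J + (1 - fps_const (A x) * fps_X) * (- (\<Sum>j\<in>J. G j) * D J)"
      unfolding GD insert.IH ..
    also have "\<dots> = - (\<Sum>j\<in>insert x J. G j) * D (insert x J)"
      unfolding DJ using insert by (simp add: algebra_simps)
    finally show ?case .
  qed
  have XF: "fps_X * fps_deriv F = F * (\<Sum>j\<in>J. G j)"
  proof (rule fps_ext)
    fix k
    have "fps_nth (F * (\<Sum>j\<in>J. G j)) k = (\<Sum>e=0..k. fps_nth F (k - e) * fps_nth (\<Sum>j\<in>J. G j) e)"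
      unfolding mult.commute[of F] fps_mult_nth by (intro sum.cong refl mult.commute)
    also have "\<dots> = (\<Sum>e=1..k. fps_nth F (k - e) * fps_nth (\<Sum>j\<in>J. G j) e)"
      by (rule sum.mono_neutral_right) (auto simp: fps_sum_nth G_def not_less_eq_eq)
    also have "\<dots> = (\<Sum>e=1..k. fps_nth F (k - e) * (\<Sum>j\<in>J. A j ^ e))"
      by (intro sum.cong refl) (auto simp: fps_sum_nth G_def)
    also have "\<dots> = of_nat k * fps_nth F k" by (rule rec[symmetric])
    also have "\<dots> = fps_nth (fps_X * fps_deriv F) k" by (cases k) auto
    finally show "fps_nth (fps_X * fps_deriv F) k = fps_nth (F * (\<Sum>j\<in>J. G j)) k" ..
  qed
  have "fps_X * fps_deriv (F * D J) = F * (fps_X * fps_deriv (D J)) + (fps_X * fps_deriv F) * D J"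
    by (simp add: algebra_simps)
  also have "\<dots> = 0" unfolding XD[OF J] XF by (simp add: algebra_simps)
  finally have "fps_deriv (F * D J) = 0" by simp
  hence "F * D J = fps_const (fps_nth (F * D J) 0)" by (simp only: fps_deriv_eq_0_iff)
  moreover have "fps_nth (D J) 0 = 1"
    unfolding D_def using J by (induction J rule: finite_induct) auto
  ultimately show ?thesis unfolding D_def by simp
qed

text \<open>
  If \<open>|A j| > 1\<close>, then \<open>1 / A j\<close> lies in the disc of convergence of \<open>F\<close>, and evaluating the identity
  there makes its left-hand side vanish.
\<close>
lemma euler_parameters_bounded:
  fixes F :: "complex fps" and A :: "'j \<Rightarrow> complex"
  assumes J: "finite J" and F0: "fps_nth F 0 \<noteq> 0" and j: "j \<in> J"
    and eq: "F * (\<Prod>j\<in>J. 1 - fps_const (A j) * fps_X) = fps_const (fps_nth F 0)"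
    and summable: "\<And>r::real. 0 < r \<Longrightarrow> r < 1 \<Longrightarrow> summable (\<lambda>k. fps_nth F k * of_real r ^ k)"
  shows "norm (A j) \<le> 1"
proof (rule ccontr)
  assume "\<not> norm (A j) \<le> 1"
  hence A: "norm (A j) > 1" by simp
  \<comment> \<open>Read as a polynomial, the product has a power series converging everywhere, so
    only the radius of \<open>F\<close> restricts the evaluation at \<open>z\<close>.\<close>
  define P where "P = (\<Prod>j\<in>J. [:1, - A j:])"
  define z where "z = inverse (A j)"
  have P: "fps_of_poly P = (\<Prod>j\<in>J. 1 - fps_const (A j) * fps_X)"
    unfolding P_def fps_of_poly_prod
    by (intro prod.cong refl) (simp add: fps_of_poly_pCons fps_const_neg[symmetric] del: fps_const_neg)
  have "A j \<noteq> 0" using A by auto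
  hence "poly P z = 0"
    unfolding P_def poly_prod using J j by (intro prod_zero bexI[of _ j]) (auto simp: z_def)
  have z: "norm z < 1" "norm z > 0" using A by (auto simp: z_def norm_inverse inverse_less_1_iff)
  define r where "r = (norm z + 1) / 2"
  have r: "0 < r" "r < 1" "norm z < r"
  proof -
    have "norm z + 1 > 0" "norm z + 1 < 2" "norm z * 2 < norm z + 1" using z by linarith+
    thus "0 < r" "r < 1" "norm z < r" by (simp_all add: r_def)
  qed
  have "norm (complex_of_real r) \<le> fps_conv_radius F"
    unfolding fps_conv_radius_def by (rule conv_radius_geI[OF summable[OF r(1,2)]])
  moreover have "ereal (norm z) < ereal (norm (complex_of_real r))" using r by simp
  ultimately have "ereal (norm z) < fps_conv_radius F" by (rule less_le_trans[rotated])
  hence "eval_fps (F * fps_of_poly P) z = eval_fps F z * eval_fps (fps_of_poly P) z"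
    by (intro eval_fps_mult) auto
  also have "\<dots> = 0" using \<open>poly P z = 0\<close> by simp
  also have "eval_fps (F * fps_of_poly P) z = fps_nth F 0"
    unfolding P eq by simp
  finally show False using F0 by simp
qed

text \<open>The finitely many exceptional \<open>m\<close> are absorbed into the constant, because
  \<open>m powr \<epsilon>\<close> is at least 1.\<close>

lemma bigo_powr_imp_bound:
  fixes a :: "nat \<Rightarrow> complex"
  assumes "(\<lambda>m. norm (a m)) \<in> O(\<lambda>m. real m powr \<epsilon>)" "\<epsilon> > 0"
  obtains C where "C \<ge> 0" "\<And>m. m > 0 \<Longrightarrow> norm (a m) \<le> C * real m powr \<epsilon>"
proof -
  from assms(1) obtain C where C: "C > 0" "eventually (\<lambda>m. norm (norm (a m)) \<le> C * norm (real m powr \<epsilon>)) sequentially"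
    by (elim landau_o.bigE)
  from C(2) obtain M where M: "\<And>m. m \<ge> M \<Longrightarrow> norm (a m) \<le> C * real m powr \<epsilon>"
    by (auto simp: eventually_sequentially)
  define D where "D = C + (\<Sum>m<M. norm (a m))"
  have D: "D \<ge> C" unfolding D_def by (simp add: sum_nonneg)
  show ?thesis
  proof (rule that[of D])
    show "D \<ge> 0" using C D by simp
    fix m :: nat assume m: "m > 0"
    have m1: "real m powr \<epsilon> \<ge> 1" using m assms(2) by (intro ge_one_powr_ge_zero) auto
    show "norm (a m) \<le> D * real m powr \<epsilon>"
    proof (cases "m \<ge> M")
      case True
      from M[OF this] show ?thesis by (rule order_trans) (intro mult_right_mono D, simp)
    next
      case False
      have "norm (a m) \<le> (\<Sum>m<M. norm (a m))" using False by (intro member_le_sum) auto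
      also have "\<dots> \<le> D * 1" unfolding D_def using C by simp
      also have "\<dots> \<le> D * real m powr \<epsilon>" using m1 D C by (intro mult_left_mono) auto
      finally show ?thesis .
    qed
  qed
qed

text \<open>For |c| > p the point Ln c / ln p would have real part above 1 and annihilate the
  factor. This is the crude bound from which the estimate of the Euler parameters starts.\<close>

lemma nonvanishing_euler_factor_bound:
  assumes p: "prime p" and nz: "\<And>s. Re s > 1 \<Longrightarrow> 1 - c * of_nat p powr (- s) \<noteq> (0 :: complex)"
  shows "norm c \<le> real p"
proof (rule ccontr)
  assume "\<not> norm c \<le> real p"
  hence c: "norm c > real p" by simp
  have p1: "p > 1" using p by (rule prime_gt_1_nat)
  hence c0: "c \<noteq> 0" using c by auto
  define s where "s = Ln c / of_real (ln (real p))"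
  have lnp: "ln (real p) > 0" using p1 by simp
  have "Re s = ln (norm c) / ln (real p)" using c0 by (simp add: s_def)
  moreover have "ln (norm c) > ln (real p)" using c p1 c0 by (subst ln_less_cancel_iff) auto
  ultimately have "Re s > 1" using lnp by simp
  moreover have "of_nat p powr (- s) = inverse c"
  proof -
    have "of_nat p powr (- s) = exp (- s * Ln (of_nat p))" using p1 by (simp add: powr_def)
    also have "Ln (of_nat p) = of_real (ln (real p))" using p1 Ln_of_real[of "real p"] by simp
    also have "- s * of_real (ln (real p)) = - Ln c" using lnp by (simp add: s_def)
    also have "exp (- Ln c) = inverse c" using c0 by (simp add: exp_minus)
    finally show ?thesis .
  qed
  ultimately show False using nz[of s] c0 by simp
qed

text \<open>The crude bound |A j p| \<le> p gives the logarithm for Re s > 2, enough to compare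
  coefficients. The comparison improves the bound to 1, and with it the logarithm extends to Re s >
  1.\<close>

lemma class_S_tilde_exp_log:
  assumes "in_class_S_tilde \<sigma>0 \<phi>"
  obtains l A where
    "\<And>j p. j \<in> {1..l} \<Longrightarrow> prime p \<Longrightarrow> norm (A j p) \<le> 1"
    "\<And>s. Re s > 1 \<Longrightarrow> \<phi> s = exp (dser 1 (\<lambda>m. log_coeff l A (Suc m)) 0 s)"
    "\<not> summable (\<lambda>p. if prime p then norm (\<Sum>j=1..l. A j p) / real p else 0)"
proof -
  have "\<exists>a :: nat \<Rightarrow> complex.
        (\<forall>\<epsilon>>0. (\<lambda>m. norm (a m)) \<in> O(\<lambda>m. real m powr \<epsilon>)) \<and>
        (\<forall>s. Re s > 1 \<longrightarrow> (\<lambda>m. a (Suc m) * of_nat (Suc m) powr (- s)) sums \<phi> s) \<and>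
        (\<exists>l>0. \<exists>A :: nat \<Rightarrow> nat \<Rightarrow> complex. \<forall>s. Re s > 1 \<longrightarrow>
           (\<forall>p j. prime p \<longrightarrow> j \<in> {1..l} \<longrightarrow> 1 - A j p * of_nat p powr (- s) \<noteq> 0) \<and>
           (\<lambda>p. if prime p then \<Prod>j=1..l. inverse (1 - A j p * of_nat p powr (- s)) else 1)
             has_prod \<phi> s) \<and>
        (\<exists>\<kappa>>0. ((\<lambda>x::real. (\<Sum>p | prime p \<and> real p \<le> x. (norm (a p))\<^sup>2) /
                  real (card {p::nat. prime p \<and> real p \<le> x})) \<longlongrightarrow> \<kappa>) at_top)"
    using assms unfolding in_class_S_tilde_def by (elim conjE)
  then obtain a :: "nat \<Rightarrow> complex" and l :: nat and A :: "nat \<Rightarrow> nat \<Rightarrow> complex" and \<kappa> :: real where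
    O': "\<forall>\<epsilon>>0. (\<lambda>m. norm (a m)) \<in> O(\<lambda>m. real m powr \<epsilon>)" and
    sums': "\<forall>s. Re s > 1 \<longrightarrow> (\<lambda>m. a (Suc m) * of_nat (Suc m) powr (- s)) sums \<phi> s" and
    euler: "\<forall>s. Re s > 1 \<longrightarrow>
           (\<forall>p j. prime p \<longrightarrow> j \<in> {1..l} \<longrightarrow> 1 - A j p * of_nat p powr (- s) \<noteq> 0) \<and>
           (\<lambda>p. if prime p then \<Prod>j=1..l. inverse (1 - A j p * of_nat p powr (- s)) else 1)
             has_prod \<phi> s" and
    \<kappa>: "\<kappa> > 0" "((\<lambda>x::real. (\<Sum>p | prime p \<and> real p \<le> x. (norm (a p))\<^sup>2) /
                  real (card {p::nat. prime p \<and> real p \<le> x})) \<longlongrightarrow> \<kappa>) at_top"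
    by (elim exE conjE) (rule that; assumption)
  from O' have O: "(\<lambda>m. norm (a m)) \<in> O(\<lambda>m. real m powr \<epsilon>)" if "\<epsilon> > 0" for \<epsilon>
    using that by (elim allE impE)
  from sums' have sums: "(\<lambda>m. a (Suc m) * of_nat (Suc m) powr (- s)) sums \<phi> s" if "Re s > 1" for s
    using that by (elim allE impE)
  from euler have nz: "1 - A j p * of_nat p powr (- s) \<noteq> 0" if "Re s > 1" "prime p" "j \<in> {1..l}" for s p j
    using that by blast
  from euler have prod: "(\<lambda>p. if prime p then \<Prod>j=1..l. inverse (1 - A j p * of_nat p powr (- s)) else 1)
             has_prod \<phi> s" if "Re s > 1" for s
    using that by blast
  have Ap: "norm (A j p) \<le> real p powr 1" if "j \<in> {1..l}" "prime p" for j p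
    using nonvanishing_euler_factor_bound[OF that(2), of "A j p"] nz that by (simp add: prime_gt_0_nat)
  obtain C where C: "C \<ge> 0" "\<And>m. m > 0 \<Longrightarrow> norm (a m) \<le> C * real m powr 1"
    by (rule bigo_powr_imp_bound[OF O[of 1]]) auto
  have conv: "a (Suc n) * ln (real (Suc n)) = dirichlet_conv (\<lambda>m. a (Suc m)) (\<lambda>m. log_coeff l A (Suc m) * ln (real (Suc m))) n" for n
  proof (rule log_derivative_coefficients)
    show "norm (a (Suc m)) \<le> C * (real m + 1)" for m
      using C(2)[of "Suc m"] by (simp add: add.commute)
    show "norm (log_coeff l A (Suc m)) \<le> real l * (real m + 1)" for m
      using norm_log_coeff_le[of l A 1 "Suc m"] Ap by (simp add: add.commute)
    fix s :: complex assume s: "Re s > 2"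
    have "dser 1 (\<lambda>m. a (Suc m)) 0 s = \<phi> s"
      unfolding dser_1_eq using sums[of s] s by (simp add: sums_iff)
    also have "\<phi> s = exp (dser 1 (\<lambda>m. log_coeff l A (Suc m)) 0 s)"
      by (rule exp_log_series_eq_euler_product[where B = 1, symmetric]) (use Ap prod s in auto)
    finally show "dser 1 (\<lambda>m. a (Suc m)) 0 s = exp (dser 1 (\<lambda>m. log_coeff l A (Suc m)) 0 s)" .
  qed (use C in auto)
  \<comment> \<open>The coefficient identity at p^k: its divisors are powers of p, and every
    logarithm in it is a multiple of \<open>ln p\<close>, which cancels.\<close>
  have rec: "of_nat k * a (p ^ k) = (\<Sum>e=1..k. a (p ^ (k - e)) * (\<Sum>j\<in>{1..l}. A j p ^ e))" if p: "prime p" for p k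
  proof -
    have p1: "p > 1" using p by (rule prime_gt_1_nat)
    have Sp: "Suc (p ^ e - Suc 0) = p ^ e" for e using p1 by simp
    have lnp: "complex_of_real (ln (real p)) \<noteq> 0" using p1 by simp
    have lnk: "ln (real (p ^ e)) = real e * ln (real p)" for e using p1 by (simp add: ln_realpow)
    have "of_nat k * a (p ^ k) * ln (real p) = a (Suc (p ^ k - 1)) * ln (real (Suc (p ^ k - 1)))"
      using lnk[of k] by (simp add: Sp)
    also have "\<dots> = (\<Sum>e\<le>k. a (p ^ (k - e)) * (log_coeff l A (p ^ e) * ln (real (p ^ e))))"
      unfolding conv dirichlet_conv_prime_power[OF p] by (simp add: Sp)
    also have "\<dots> = (\<Sum>e=1..k. a (p ^ (k - e)) * (log_coeff l A (p ^ e) * ln (real (p ^ e))))"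
      by (rule sum.mono_neutral_right) (auto simp: not_less_eq_eq)
    also have "\<dots> = (\<Sum>e=1..k. a (p ^ (k - e)) * (\<Sum>j\<in>{1..l}. A j p ^ e) * ln (real p))"
    proof (rule sum.cong[OF refl])
      fix e assume "e \<in> {1..k}"
      hence e: "e > 0" by simp
      have "log_coeff l A (p ^ e) * complex_of_real (ln (real (p ^ e))) = (\<Sum>j\<in>{1..l}. A j p ^ e) * of_real (ln (real p))"
        unfolding log_coeff_prime_power[OF p e] lnk using e by simp
      thus "a (p ^ (k - e)) * (log_coeff l A (p ^ e) * ln (real (p ^ e))) = a (p ^ (k - e)) * (\<Sum>j\<in>{1..l}. A j p ^ e) * ln (real p)"
        by (simp only: mult.assoc)
    qed
    also have "\<dots> = (\<Sum>e=1..k. a (p ^ (k - e)) * (\<Sum>j\<in>{1..l}. A j p ^ e)) * ln (real p)"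
      by (rule sum_distrib_right[symmetric])
    finally show ?thesis by (rule mult_right_cancel[OF lnp, THEN iffD1])
  qed
  have ap: "a p = a 1 * (\<Sum>j=1..l. A j p)" if "prime p" for p
    using rec[OF that, of 1] by simp
  \<comment> \<open>If \<open>a 1\<close> vanished, so would \<open>a p\<close> for every prime p,
    and the mean value would be 0 instead of \<kappa>.\<close>
  have a1: "a 1 \<noteq> 0"
  proof
    assume "a 1 = 0"
    hence "(\<Sum>p | prime p \<and> real p \<le> x. (norm (a p))\<^sup>2) = 0" for x
      using ap by (intro sum.neutral) auto
    hence "((\<lambda>x::real. 0 :: real) \<longlongrightarrow> \<kappa>) at_top" using \<kappa>(2) by simp
    hence "\<kappa> = 0" using tendsto_unique[OF trivial_limit_at_top_linorder _ tendsto_const] by metis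
    thus False using \<kappa>(1) by simp
  qed
  have A1: "norm (A j p) \<le> 1" if jp: "j \<in> {1..l}" "prime p" for j p
  proof -
    define F where "F = Abs_fps (\<lambda>k. a (p ^ k))"
    have p1: "p > 1" using jp(2) by (rule prime_gt_1_nat)
    show ?thesis
    proof (rule euler_parameters_bounded[where J = "{1..l}" and F = F and A = "\<lambda>j. A j p"])
      show "F * (\<Prod>j\<in>{1..l}. 1 - fps_const (A j p) * fps_X) = fps_const (fps_nth F 0)"
        by (rule fps_euler_factor) (simp_all add: F_def rec[OF jp(2)])
      show "fps_nth F 0 \<noteq> 0" using a1 by (simp add: F_def)
      fix r :: real assume r: "0 < r" "r < 1"
      \<comment> \<open>Chosen so that p^\<epsilon> = r^(- 1 / 2). The terms are then dominated by
        powers of q = r^(1 / 2), which is below 1.\<close>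
      define \<epsilon> where "\<epsilon> = - ln r / (2 * ln (real p))"
      have lnp: "ln (real p) > 0" using p1 by simp
      have \<epsilon>: "\<epsilon> > 0" using r lnp by (simp add: \<epsilon>_def divide_neg_pos)
      obtain D where D: "D \<ge> 0" "\<And>m. m > 0 \<Longrightarrow> norm (a m) \<le> D * real m powr \<epsilon>"
        by (rule bigo_powr_imp_bound[OF O[OF \<epsilon>] \<epsilon>]) auto
      define q where "q = real p powr \<epsilon> * r"
      have "real p powr \<epsilon> = exp (\<epsilon> * ln (real p))" using p1 by (simp add: powr_def)
      also have "\<epsilon> * ln (real p) = - ln r / 2" using lnp by (simp add: \<epsilon>_def)
      finally have "q = exp (- ln r / 2) * exp (ln r)" using r by (simp add: q_def)
      also have "\<dots> = exp (- ln r / 2 + ln r)" by (rule exp_add[symmetric])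
      also have "- ln r / 2 + ln r = ln r / 2" by simp
      finally have "q = exp (ln r / 2)" .
      hence q: "0 \<le> q" "q < 1" using r by simp_all
      show "summable (\<lambda>k. fps_nth F k * of_real r ^ k)"
      proof (rule summable_comparison_test')
        show "summable (\<lambda>k. D * q ^ k)" using q by (intro summable_mult summable_geometric) auto
        fix k :: nat
        have "norm (fps_nth F k * of_real r ^ k) = norm (a (p ^ k)) * r ^ k"
          using r by (simp add: F_def norm_mult norm_power)
        also have "\<dots> \<le> (D * real (p ^ k) powr \<epsilon>) * r ^ k"
          using D(2)[of "p ^ k"] p1 r by (intro mult_right_mono) auto
        also have "real (p ^ k) powr \<epsilon> = (real p powr \<epsilon>) ^ k"
          using p1 by (simp add: powr_power powr_powr powr_realpow[symmetric] mult.commute)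
        also have "D * (real p powr \<epsilon>) ^ k * r ^ k = D * q ^ k" by (simp add: q_def power_mult_distrib)
        finally show "norm (fps_nth F k * of_real r ^ k) \<le> D * q ^ k" .
      qed
    qed (use jp in auto)
  qed
  show ?thesis
  proof (rule that[of l A])
    show "\<phi> s = exp (dser 1 (\<lambda>m. log_coeff l A (Suc m)) 0 s)" if "Re s > 1" for s
      by (rule exp_log_series_eq_euler_product[where B = 0, symmetric])
         (use A1 prod that in \<open>auto simp: prime_gt_0_nat\<close>)
    show "\<not> summable (\<lambda>p. if prime p then norm (\<Sum>j=1..l. A j p) / real p else 0)"
    proof
      assume sm: "summable (\<lambda>p. if prime p then norm (\<Sum>j=1..l. A j p) / real p else 0)"
      \<comment> \<open>As |A j p| \<le> 1, the sum of the \<open>A j p\<close> has absolute value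
        at most \<open>l\<close>, so one factor of the square can be traded for the constant
        \<open>l\<close>.\<close>
      have "summable (\<lambda>p. if prime p then (norm (a p))\<^sup>2 / real p else 0)"
      proof (rule summable_comparison_test'[OF summable_mult[OF sm, of "(norm (a 1))\<^sup>2 * real l"]])
        fix p :: nat
        show "norm (if prime p then (norm (a p))\<^sup>2 / real p else 0)
           \<le> (norm (a 1))\<^sup>2 * real l * (if prime p then norm (\<Sum>j=1..l. A j p) / real p else 0)"
        proof (cases "prime p")
          case True
          define t where "t = norm (\<Sum>j=1..l. A j p)"
          have "t \<le> (\<Sum>j=1..l. norm (A j p))" unfolding t_def by (rule norm_sum)
          also have "\<dots> \<le> (\<Sum>j=1..l. 1)" using A1 True by (intro sum_mono) auto
          finally have "t \<le> real l" by simp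
          hence "t * t \<le> real l * t" by (intro mult_right_mono) (auto simp: t_def)
          hence "(norm (a p))\<^sup>2 \<le> (norm (a 1))\<^sup>2 * real l * t"
            unfolding ap[OF True] by (simp add: norm_mult power_mult_distrib power2_eq_square[of "norm (sum _ _)"]
                t_def mult_left_mono mult.assoc)
          hence "(norm (a p))\<^sup>2 / real p \<le> (norm (a 1))\<^sup>2 * real l * t / real p"
            by (rule divide_right_mono) simp
          thus ?thesis using True by (simp add: t_def)
        qed simp
      qed
      thus False using not_summable_prime_weights[OF \<kappa>(2,1)] by contradiction
    qed
  qed (rule A1)
qed

section \<open>Joint approximation of the values\<close>

text \<open>The logarithms cost n^(1 / 4), leaving n^(- 3 / 4). Summed over the powers p^2, p^3 and
  so on, this is a geometric series of order p^(- 3 / 2). A pair (p, k) stands for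
  \<open>p ^ Suc k\<close>, so k = 0 are the primes left out.\<close>

lemma summable_nonprime_prime_powers:
  "summable (\<lambda>m. if primepow (Suc m) \<and> \<not> prime (Suc m) then \<bar>ln (real (Suc m))\<bar> ^ \<nu> / real (Suc m) else 0)"
proof -
  obtain K where K: "K > 0" "\<And>x::real. x \<ge> 1 \<Longrightarrow> \<bar>ln x\<bar> ^ \<nu> \<le> K * x powr (1 / 4)"
    using ln_power_le_powr[of "1 / 4" \<nu>] by auto
  define g where "g = (\<lambda>n::nat. if primepow n \<and> \<not> prime n then real n powr (- 3 / 4) else 0)"
  \<comment> \<open>The geometric factor 1 / (1 - p^(- 3 / 4)) is largest at p = 2.\<close>
  define d where "d = 1 / (1 - 2 powr (- 3 / 4 :: real))"
  have "(2::real) powr (- 3 / 4) < 2 powr 0" by (intro powr_less_mono) auto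
  hence two: "(2::real) powr (- 3 / 4) < 1" by simp
  have pairs: "(\<lambda>(p, k). if k = 0 then 0 else real (p ^ Suc k) powr (- 3 / 4)) summable_on (Collect prime \<times> (UNIV :: nat set))"
  proof (rule summable_on_SigmaI)
    fix p :: nat assume "p \<in> Collect prime"
    hence p: "p \<ge> 2" by (simp add: prime_ge_2_nat)
    define q where "q = real p powr (- 3 / 4)"
    have "q \<le> 2 powr (- 3 / 4)" unfolding q_def using p by (intro powr_mono2') auto
    hence q: "0 \<le> q" "q < 1" using two by (auto simp: q_def)
    have eq: "real (p ^ n) powr (- 3 / 4) = q ^ n" for n
    proof -
      have "real (p ^ n) powr (- 3 / 4) = (real p powr real n) powr (- 3 / 4)" using p by (simp add: powr_realpow)
      also have "\<dots> = (real p powr (- 3 / 4)) powr real n" by (simp only: powr_powr mult.commute)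
      also have "\<dots> = q ^ n" using p unfolding q_def by (simp add: powr_realpow)
      finally show ?thesis .
    qed
    have "(\<lambda>k. q ^ k) sums (1 / (1 - q))" using q by (intro geometric_sums) auto
    hence "(\<lambda>k. q\<^sup>2 * q ^ k) sums (q\<^sup>2 * (1 / (1 - q)))" by (rule sums_mult)
    hence "(\<lambda>k. if Suc k = 0 then 0 else q ^ Suc (Suc k)) sums (q\<^sup>2 * (1 / (1 - q)))"
      by (simp add: power2_eq_square mult.assoc)
    hence "(\<lambda>k. if k = 0 then 0 else q ^ Suc k) sums (q\<^sup>2 * (1 / (1 - q)))"
      by (subst (asm) sums_Suc_iff) simp
    hence "((\<lambda>k. if k = 0 then 0 else q ^ Suc k) has_sum (q\<^sup>2 * (1 / (1 - q)))) UNIV"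
      by (rule sums_nonneg_imp_has_sum) (use q in auto)
    thus "((\<lambda>k. case (p, k) of (p, k) \<Rightarrow> if k = 0 then 0 else real (p ^ Suc k) powr (- 3 / 4))
        has_sum (\<lambda>p. (real p powr (- 3 / 4))\<^sup>2 * (1 / (1 - real p powr (- 3 / 4)))) p) UNIV"
      unfolding prod.case eq unfolding q_def .
  next
    have "summable (\<lambda>p. d * real p powr (- 3 / 2))"
      by (intro summable_mult) (subst summable_real_powr_iff, simp)
    hence "(\<lambda>p. d * real p powr (- 3 / 2)) summable_on UNIV"
      by (subst summable_on_UNIV_nonneg_real_iff) (use two in \<open>auto simp: d_def\<close>)
    hence s: "(\<lambda>p. d * real p powr (- 3 / 2)) summable_on Collect prime"
      by (rule summable_on_subset) auto
    show "(\<lambda>p::nat. (real p powr (- 3 / 4))\<^sup>2 * (1 / (1 - real p powr (- 3 / 4)))) summable_on Collect prime"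
    proof (rule summable_on_comparison_test[OF s])
      fix p :: nat assume "p \<in> Collect prime"
      hence p: "p \<ge> 2" by (simp add: prime_ge_2_nat)
      have "real p powr (- 3 / 4) \<le> 2 powr (- 3 / 4)" using p by (intro powr_mono2') auto
      hence "1 / (1 - real p powr (- 3 / 4)) \<le> d" "1 / (1 - real p powr (- 3 / 4)) \<ge> 0"
        unfolding d_def using two by (auto intro!: divide_left_mono mult_pos_pos)
      moreover have "(real p powr (- 3 / 4))\<^sup>2 = real p powr (- 3 / 2)"
        by (simp only: power2_eq_square powr_add[symmetric]) simp
      ultimately show "(real p powr (- 3 / 4))\<^sup>2 * (1 / (1 - real p powr (- 3 / 4))) \<le> d * real p powr (- 3 / 2)"
        "0 \<le> (real p powr (- 3 / 4))\<^sup>2 * (1 / (1 - real p powr (- 3 / 4)))"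
        by (simp_all only: mult.commute[of d] mult_left_mono powr_ge_zero mult_nonneg_nonneg)
    qed
  qed auto
  have "(\<lambda>x. g ((\<lambda>(p, k). p ^ Suc k) x)) summable_on (Collect prime \<times> UNIV)"
  proof (rule summable_on_cong[THEN iffD1, OF _ pairs])
    fix x :: "nat \<times> nat" assume "x \<in> Collect prime \<times> UNIV"
    then obtain p k where x: "x = (p, k)" "prime p" by auto
    have "prime (p ^ Suc k) \<longleftrightarrow> k = 0" using x(2) prime_power_iff[of p "Suc k"] by auto
    thus "(case x of (p, k) \<Rightarrow> if k = 0 then 0 else real (p ^ Suc k) powr (- 3 / 4)) = g ((\<lambda>(p, k). p ^ Suc k) x)"
      using x primepow_prime_power[OF x(2), of "Suc k"] unfolding g_def x by (simp del: power_Suc)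
  qed
  hence "g summable_on Collect primepow"
    by (subst (asm) summable_on_reindex_bij_betw[OF bij_betw_primepows])
  also have "?this \<longleftrightarrow> g summable_on UNIV"
    by (rule summable_on_cong_neutral) (auto simp: g_def)
  also have "\<dots> \<longleftrightarrow> summable g"
    by (rule summable_on_UNIV_nonneg_real_iff) (auto simp: g_def)
  finally have "summable (\<lambda>m. K * g (Suc m))" by (intro summable_mult) (simp add: summable_Suc_iff)
  thus ?thesis
  proof (rule summable_comparison_test')
    fix m :: nat
    have "\<bar>ln (real (Suc m))\<bar> ^ \<nu> / real (Suc m) \<le> (K * real (Suc m) powr (1 / 4)) / real (Suc m)"
      by (intro divide_right_mono K(2)) auto
    also have "\<dots> = K * (real (Suc m) powr (1 / 4) * real (Suc m) powr (- 1))"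
      by (simp add: powr_minus_divide del: of_nat_Suc)
    also have "real (Suc m) powr (1 / 4) * real (Suc m) powr (- 1) = real (Suc m) powr (- 3 / 4)"
      by (simp only: powr_add[symmetric]) simp
    finally show "norm (if primepow (Suc m) \<and> \<not> prime (Suc m) then \<bar>ln (real (Suc m))\<bar> ^ \<nu> / real (Suc m) else 0) \<le> K * g (Suc m)"
      by (auto simp: g_def)
  qed
qed

lemma summable_square_ln_weights:
  fixes v :: "nat \<Rightarrow> complex"
  assumes \<beta>: "\<beta> > 0" and v: "\<And>m. norm (v m) \<le> C * \<bar>ln (real m + \<beta>)\<bar> ^ \<nu>"
  shows "summable (\<lambda>m. (norm (v m) / (real m + \<beta>))\<^sup>2)"
proof (rule summable_comparison_test')
  show "summable (\<lambda>m. C\<^sup>2 * (\<bar>ln (real m + \<beta>)\<bar> ^ (2 * \<nu>) * (real m + \<beta>) powr - 2))"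
    using \<beta> by (intro summable_mult summable_ln_power_powr) auto
  fix m :: nat
  have x: "real m + \<beta> > 0" using \<beta> by simp
  have "(norm (v m))\<^sup>2 \<le> (C * \<bar>ln (real m + \<beta>)\<bar> ^ \<nu>)\<^sup>2" using v by (intro power_mono) auto
  hence "(norm (v m))\<^sup>2 / (real m + \<beta>)\<^sup>2 \<le> (C * \<bar>ln (real m + \<beta>)\<bar> ^ \<nu>)\<^sup>2 / (real m + \<beta>)\<^sup>2"
    by (intro divide_right_mono) auto
  also have "\<dots> = C\<^sup>2 * (\<bar>ln (real m + \<beta>)\<bar> ^ (2 * \<nu>) * (real m + \<beta>) powr - 2)"
    using x by (simp add: power_mult_distrib power_mult[symmetric] mult.commute[of \<nu>] powr_minus powr_numeral divide_inverse)
  finally show "norm ((norm (v m) / (real m + \<beta>))\<^sup>2) \<le> C\<^sup>2 * (\<bar>ln (real m + \<beta>)\<bar> ^ (2 * \<nu>) * (real m + \<beta>) powr - 2)"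
    by (simp add: power_divide)
qed

lemma summable_ln_weights:
  fixes v :: "nat \<Rightarrow> complex"
  assumes \<beta>: "\<beta> > 0" and v: "\<And>m. norm (v m) \<le> C * \<bar>ln (real m + \<beta>)\<bar> ^ \<nu>" and \<sigma>: "\<sigma> > 1"
  shows "summable (\<lambda>m. norm (v m) * (real m + \<beta>) powr - \<sigma>)"
proof (rule summable_comparison_test')
  show "summable (\<lambda>m. C * (\<bar>ln (real m + \<beta>)\<bar> ^ \<nu> * (real m + \<beta>) powr - \<sigma>))"
    using \<beta> \<sigma> by (intro summable_mult summable_ln_power_powr) auto
  fix m :: nat
  have "norm (v m) * (real m + \<beta>) powr - \<sigma> \<le> (C * \<bar>ln (real m + \<beta>)\<bar> ^ \<nu>) * (real m + \<beta>) powr - \<sigma>"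
    using v by (intro mult_right_mono) auto
  thus "norm (norm (v m) * (real m + \<beta>) powr - \<sigma>) \<le> C * (\<bar>ln (real m + \<beta>)\<bar> ^ \<nu> * (real m + \<beta>) powr - \<sigma>)"
    by (simp add: mult.assoc abs_mult)
qed

lemma powr_le_two_endpoints:
  assumes "x > (0::real)" "1 \<le> \<sigma>" "\<sigma> \<le> 2"
  shows "x powr - \<sigma> \<le> x powr - 1 + x powr - 2"
proof (cases "x \<ge> 1")
  case True
  hence "x powr - \<sigma> \<le> x powr - 1" using assms by (intro powr_mono) auto
  thus ?thesis by (simp add: add_increasing2)
next
  case False
  hence "x powr - \<sigma> \<le> x powr - 2" using assms by (intro powr_mono') auto
  thus ?thesis by (simp add: add_increasing)
qed

text \<open>On one residue class modulo \<open>k\<close> the linear form is a fixed polynomial in -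
  ln (m + \<alpha>). The rank condition finds a class where this polynomial is not zero, so the form
  stays away from 0 and the harmonic series over that class makes the weighted sum diverge.\<close>

lemma hurwitz_twists_approx:
  fixes b :: "'i \<Rightarrow> nat \<Rightarrow> complex" and y :: "'i \<times> nat \<Rightarrow> complex"
  assumes I: "finite I" and \<alpha>: "\<alpha> > 0"
    and bounded: "\<And>i m. i \<in> I \<Longrightarrow> norm (b i m) \<le> C"
    and per: "k > 0" "\<And>i m. i \<in> I \<Longrightarrow> b i (m + k) = b i m"
    and rank: "\<And>u. \<exists>i\<in>I. u i \<noteq> 0 \<Longrightarrow> \<exists>m. (\<Sum>i\<in>I. b i m * u i) \<noteq> 0"
    and e: "e > 0"
  obtains \<delta> where "\<delta> > 0" "\<And>\<sigma>. 1 < \<sigma> \<Longrightarrow> \<sigma> < 1 + \<delta> \<Longrightarrow> \<exists>\<omega>. (\<forall>m. norm (\<omega> m) = 1) \<and>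
     (\<forall>i\<in>I. \<forall>\<nu><N. norm (y (i, \<nu>) - suminf (\<lambda>m. (b i m * of_real ((- ln (real m + \<alpha>)) ^ \<nu> * (real m + \<alpha>) powr - \<sigma>)) * \<omega> m)) < e)"
proof -
  define J where "J = I \<times> {..<N}"
  define x where "x = (\<lambda>m. real m + \<alpha>)"
  define v where "v = (\<lambda>m (i, \<nu>). b i m * of_real ((- ln (x m)) ^ \<nu>))"
  have J: "finite J" using I by (simp add: J_def)
  have x: "x m > 0" "m \<ge> 1 \<Longrightarrow> x m \<ge> 1" for m using \<alpha> by (auto simp: x_def)
  have vle: "norm (v m (i, \<nu>)) \<le> C * \<bar>ln (real m + \<alpha>)\<bar> ^ \<nu>" if "i \<in> I" for m i \<nu>
    using bounded[OF that, of m] by (simp add: v_def x_def norm_mult norm_power mult_right_mono)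
  have div: "\<not> summable (\<lambda>m. norm (\<Sum>t\<in>J. v m t * cnj (u t)) / x m)" if u: "\<exists>t\<in>J. u t \<noteq> 0" for u
  proof -
    obtain i0 \<nu>0 where u0: "i0 \<in> I" "\<nu>0 < N" "u (i0, \<nu>0) \<noteq> 0" using u by (auto simp: J_def)
    \<comment> \<open>One nonzero coefficient of the polynomial is enough, so the rank condition is
      applied to the single order \<nu>0 of differentiation.\<close>
    have "\<exists>i\<in>I. cnj (u (i, \<nu>0)) \<noteq> 0" using u0 by auto
    from rank[OF this] obtain m0 where m0: "(\<Sum>i\<in>I. b i m0 * cnj (u (i, \<nu>0))) \<noteq> 0" by blast
    define z where "z = (\<lambda>\<nu>. \<Sum>i\<in>I. b i m0 * cnj (u (i, \<nu>)))"
    obtain c Y where c: "c > 0" "\<And>t::real. t \<ge> Y \<Longrightarrow> norm (\<Sum>\<nu><N. of_real ((- t) ^ \<nu>) * z \<nu>) \<ge> c"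
      using poly_lower_bound[of N z] m0 u0(2) unfolding z_def by blast
    define m0' where "m0' = m0 mod k"
    have perq: "b i (q * k + m) = b i m" if "i \<in> I" for i q m
    proof (induction q)
      case (Suc q)
      thus ?case using per(2)[OF that, of "q * k + m"] by (simp add: add_ac)
    qed simp
    have bper: "b i m = b i m0" if "[m = m0] (mod k)" "i \<in> I" for i m
    proof -
      have "b i m = b i (m mod k)" using perq[OF that(2), of "m div k" "m mod k"] by simp
      also have "\<dots> = b i (m0 mod k)" using that(1) by (simp add: cong_def)
      also have "\<dots> = b i m0" using perq[OF that(2), of "m0 div k" "m0 mod k"] by simp
      finally show ?thesis .
    qed
    have "filterlim (\<lambda>m. ln (real m + \<alpha>)) at_top sequentially"
    proof (rule filterlim_compose[OF ln_at_top])
      show "filterlim (\<lambda>m. real m + \<alpha>) at_top sequentially"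
        using filterlim_tendsto_add_at_top[OF tendsto_const filterlim_real_sequentially, of \<alpha>]
        by (simp add: add.commute)
    qed
    hence "eventually (\<lambda>m. ln (real m + \<alpha>) \<ge> Y) sequentially" by (simp add: filterlim_at_top)
    then obtain M where M: "\<And>m. m \<ge> M \<Longrightarrow> ln (real m + \<alpha>) \<ge> Y" by (auto simp: eventually_sequentially)
    show ?thesis
    proof (rule not_summable_lower_bound[OF not_summable_residue_class[OF \<alpha> per(1), of m0] c(1)])
      show "0 \<le> (if [m = m0] (mod k) then 1 / (real m + \<alpha>) else 0)" for m using \<alpha> by simp
      fix m assume m: "m \<ge> M"
      show "c * (if [m = m0] (mod k) then 1 / (real m + \<alpha>) else 0) \<le> norm (\<Sum>t\<in>J. v m t * cnj (u t)) / x m"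
      proof (cases "[m = m0] (mod k)")
        case True
        have "(\<Sum>t\<in>J. v m t * cnj (u t)) = (\<Sum>i\<in>I. \<Sum>\<nu><N. v m (i, \<nu>) * cnj (u (i, \<nu>)))"
          unfolding J_def by (simp add: sum.cartesian_product)
        also have "\<dots> = (\<Sum>\<nu><N. \<Sum>i\<in>I. v m (i, \<nu>) * cnj (u (i, \<nu>)))" by (rule sum.swap)
        also have "\<dots> = (\<Sum>\<nu><N. of_real ((- ln (x m)) ^ \<nu>) * z \<nu>)"
          unfolding z_def sum_distrib_left v_def prod.case using bper[OF True]
          by (intro sum.cong refl) (simp add: mult_ac)
        finally have "c \<le> norm (\<Sum>t\<in>J. v m t * cnj (u t))" using c(2)[OF M[OF m]] by (simp add: x_def)
        hence "c / x m \<le> norm (\<Sum>t\<in>J. v m t * cnj (u t)) / x m" using x(1)[of m] by (intro divide_right_mono) auto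
        thus ?thesis using True by (simp add: x_def)
      next
        case False
        thus ?thesis using x(1)[of m] by (simp add: less_imp_le)
      qed
    qed
  qed
  have sq: "summable (\<lambda>m. (norm (v m t) / x m)\<^sup>2)" if "t \<in> J" for t
    using summable_square_ln_weights[OF \<alpha>, of "\<lambda>m. v m t" C "snd t"] vle[of "fst t" _ "snd t"] that
    unfolding x_def J_def by auto
  have ab: "summable (\<lambda>m. norm (v m t) * x m powr - \<sigma>)" if "t \<in> J" "\<sigma> > 1" for t \<sigma>
    using summable_ln_weights[OF \<alpha>, of "\<lambda>m. v m t" C "snd t" \<sigma>] vle[of "fst t" _ "snd t"] that
    unfolding x_def J_def by auto
  obtain M1 where M1: "\<And>M0 R. M0 \<ge> M1 \<Longrightarrow> \<exists>\<delta>>0. \<forall>\<sigma>. 1 < \<sigma> \<and> \<sigma> < 1 + \<delta> \<longrightarrow>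
     (\<forall>y. (\<forall>i\<in>J. norm (y i) \<le> R) \<longrightarrow> (\<exists>\<omega>. (\<forall>m. norm (\<omega> m) = 1) \<and>
        (\<forall>i\<in>J. norm (y i - suminf (\<lambda>m. if m < M0 then 0 else \<omega> m * of_real (x m powr - \<sigma>) * v m i)) < e)))"
    using twisted_series_approx[OF J x(1) x(2) div sq ab e] by blast
  \<comment> \<open>The terms moved into the target need a bound uniform in \<sigma>. For 1 <
    \<sigma> < 2 the two endpoint exponents give it even where the base \<alpha> is below 1; hence
    the cap \<open>min \<delta> 1\<close>.\<close>
  define R where "R = (\<Sum>t\<in>J. norm (y t) + (\<Sum>m<M1. norm (v m t) * (x m powr - 1 + x m powr - 2)))"
  from M1[OF order.refl, of R] obtain \<delta> where \<delta>: "\<delta> > 0" "\<And>\<sigma> y. 1 < \<sigma> \<Longrightarrow> \<sigma> < 1 + \<delta> \<Longrightarrow> \<forall>i\<in>J. norm (y i) \<le> R \<Longrightarrow>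
      \<exists>\<omega>. (\<forall>m. norm (\<omega> m) = 1) \<and> (\<forall>i\<in>J. norm (y i - suminf (\<lambda>m. if m < M1 then 0 else \<omega> m * of_real (x m powr - \<sigma>) * v m i)) < e)"
    by blast
  show ?thesis
  proof (rule that[of "min \<delta> 1"])
    show "min \<delta> 1 > 0" using \<delta> by simp
    fix \<sigma> assume \<sigma>: "1 < \<sigma>" "\<sigma> < 1 + min \<delta> 1"
    define y' where "y' = (\<lambda>t. y t - (\<Sum>m<M1. of_real (x m powr - \<sigma>) * v m t))"
    have y'R: "\<forall>t\<in>J. norm (y' t) \<le> R"
    proof
      fix t assume t: "t \<in> J"
      have "norm (y' t) \<le> norm (y t) + norm (\<Sum>m<M1. of_real (x m powr - \<sigma>) * v m t)"
        unfolding y'_def by (rule norm_triangle_ineq4)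
      also have "norm (\<Sum>m<M1. of_real (x m powr - \<sigma>) * v m t) \<le> (\<Sum>m<M1. norm (v m t) * (x m powr - 1 + x m powr - 2))"
      proof (rule order_trans[OF norm_sum], rule sum_mono)
        fix m
        have "x m powr - \<sigma> \<le> x m powr - 1 + x m powr - 2"
          using \<sigma> x(1)[of m] by (intro powr_le_two_endpoints) auto
        thus "norm (of_real (x m powr - \<sigma>) * v m t) \<le> norm (v m t) * (x m powr - 1 + x m powr - 2)"
          by (simp add: norm_mult mult.commute[of "norm (v m t)"] mult_right_mono)
      qed
      also have "norm (y t) + (\<Sum>m<M1. norm (v m t) * (x m powr - 1 + x m powr - 2)) \<le> R"
        unfolding R_def using J t
        by (intro member_le_sum[of t J "\<lambda>t. norm (y t) + (\<Sum>m<M1. norm (v m t) * (x m powr - 1 + x m powr - 2))"])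
           (auto intro!: add_nonneg_nonneg sum_nonneg)
      finally show "norm (y' t) \<le> R" by simp
    qed
    obtain \<omega> where \<omega>: "\<And>m. norm (\<omega> m) = 1"
      "\<And>t. t \<in> J \<Longrightarrow> norm (y' t - suminf (\<lambda>m. if m < M1 then 0 else \<omega> m * of_real (x m powr - \<sigma>) * v m t)) < e"
    proof -
      have "\<sigma> < 1 + \<delta>" using \<sigma> by simp
      from \<delta>(2)[OF \<sigma>(1) this y'R] show ?thesis using that by blast
    qed
    define \<omega>' where "\<omega>' = (\<lambda>m. if m < M1 then 1 else \<omega> m)"
    have main: "norm (y (i, \<nu>) - suminf (\<lambda>m. (b i m * of_real ((- ln (real m + \<alpha>)) ^ \<nu> * (real m + \<alpha>) powr - \<sigma>)) * \<omega>' m)) < e"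
      if "i \<in> I" "\<nu> < N" for i \<nu>
    proof -
      define h where "h = (\<lambda>m. \<omega>' m * of_real (x m powr - \<sigma>) * v m (i, \<nu>))"
      have t: "(i, \<nu>) \<in> J" using that by (simp add: J_def)
      have \<omega>'1: "norm (\<omega>' m) = 1" for m using \<omega>(1) by (simp add: \<omega>'_def)
      have "norm (h m) = norm (v m (i, \<nu>)) * x m powr - \<sigma>" for m
        unfolding h_def norm_mult \<omega>'1 norm_of_real by simp
      hence "summable (\<lambda>m. norm (h m))" using ab[OF t \<sigma>(1)] by simp
      hence "h sums suminf h" by (rule summable_sums[OF summable_norm_cancel])
      hence "(\<lambda>m. if m \<in> {..<M1} then 0 else h m) sums (suminf h - (\<Sum>m<M1. h m))"
        by (rule sums_If_finite_set') (auto simp: sum_negf)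
      hence "suminf h = (\<Sum>m<M1. h m) + suminf (\<lambda>m. if m < M1 then 0 else h m)" by (simp add: sums_iff)
      moreover have "(\<lambda>m. if m < M1 then 0 else h m) = (\<lambda>m. if m < M1 then 0 else \<omega> m * of_real (x m powr - \<sigma>) * v m (i, \<nu>))"
        by (auto simp: h_def \<omega>'_def fun_eq_iff)
      moreover have "(\<Sum>m<M1. h m) = (\<Sum>m<M1. of_real (x m powr - \<sigma>) * v m (i, \<nu>))"
        by (intro sum.cong) (auto simp: h_def \<omega>'_def)
      moreover have "(\<lambda>m. (b i m * of_real ((- ln (real m + \<alpha>)) ^ \<nu> * (real m + \<alpha>) powr - \<sigma>)) * \<omega>' m) = h"
        unfolding h_def v_def x_def prod.case of_real_mult by (intro ext) (simp only: mult_ac)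
      ultimately show ?thesis using \<omega>(2)[OF t] by (simp only: y'_def diff_diff_add)
    qed
    show "\<exists>\<omega>. (\<forall>m. norm (\<omega> m) = 1) \<and>
     (\<forall>i\<in>I. \<forall>\<nu><N. norm (y (i, \<nu>) - suminf (\<lambda>m. (b i m * of_real ((- ln (real m + \<alpha>)) ^ \<nu> * (real m + \<alpha>) powr - \<sigma>)) * \<omega> m)) < e)"
      by (rule exI[of _ \<omega>']) (use main \<omega>(1) in \<open>auto simp: \<omega>'_def\<close>)
  qed
qed

text \<open>Phases on prime powers obey the law of n^(- i t) and are determined by those on primes.
  Elsewhere \<open>log_coeff\<close> vanishes, so the value 1 is a convention.\<close>

definition prime_power_phase :: "(nat \<Rightarrow> complex) \<Rightarrow> nat \<Rightarrow> complex" where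
  "prime_power_phase \<omega> n =
     (if primepow n then \<omega> (aprimedivisor n) ^ multiplicity (aprimedivisor n) n else 1)"

lemma norm_prime_power_phase:
  assumes "\<And>p. norm (\<omega> p) = 1"
  shows "norm (prime_power_phase \<omega> n) = 1"
  using assms by (simp add: prime_power_phase_def norm_power)

lemma prime_power_phase_prime_power:
  assumes "prime p" "k > 0"
  shows "prime_power_phase \<omega> (p ^ k) = \<omega> p ^ k"
  using assms by (simp add: prime_power_phase_def aprimedivisor_prime_power)

lemma prime_power_phase_prime:
  "prime p \<Longrightarrow> prime_power_phase \<omega> p = \<omega> p"
  using prime_power_phase_prime_power[of p 1 \<omega>] by simp

text \<open>The primes beyond a cut-off are twisted freely, and their series diverges by
  \<open>ns\<close>. The initial segment and the higher prime powers are counted with phase 1 in the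
  target; beyond the cut-off the latter are so small that their true phases hardly matter.\<close>

lemma euler_twists_approx:
  fixes y :: "nat \<Rightarrow> complex" and A :: "nat \<Rightarrow> nat \<Rightarrow> complex"
  assumes A: "\<And>j p. j \<in> {1..l} \<Longrightarrow> prime p \<Longrightarrow> norm (A j p) \<le> 1"
    and ns: "\<not> summable (\<lambda>p. if prime p then norm (\<Sum>j=1..l. A j p) / real p else 0)"
    and e: "e > 0"
  obtains \<delta> where "\<delta> > 0" "\<And>\<sigma>. 1 < \<sigma> \<Longrightarrow> \<sigma> < 1 + \<delta> \<Longrightarrow> \<exists>\<omega>. (\<forall>p. norm (\<omega> p) = 1) \<and>
     (\<forall>\<nu><N. norm (y \<nu> - suminf (\<lambda>m. (log_coeff l A (Suc m) * of_real ((- ln (real m + 1)) ^ \<nu> * (real m + 1) powr - \<sigma>))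
        * prime_power_phase \<omega> (Suc m))) < e)"
proof -
  define c where "c = (\<lambda>m. log_coeff l A (Suc m))"
  define x where "x = (\<lambda>m. real m + 1)"
  define v where "v = (\<lambda>m \<nu>. if prime (Suc m) then c m * of_real ((- ln (x m)) ^ \<nu>) else 0)"
  define g where "g = (\<lambda>\<sigma> \<nu> m. c m * of_real ((- ln (x m)) ^ \<nu> * x m powr - \<sigma>))"
  define W where "W = (\<lambda>\<nu> m. if primepow (Suc m) \<and> \<not> prime (Suc m) then \<bar>ln (real (Suc m))\<bar> ^ \<nu> / real (Suc m) else 0)"
  define V where "V = (\<lambda>\<nu> m. norm (v m \<nu>) * x m powr - 1)"
  have x: "x m > 0" "x m \<ge> 1" for m by (auto simp: x_def)
  have cle: "norm (c m) \<le> real l" for m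
    using norm_log_coeff_le[of l A 0 "Suc m"] A by (simp add: c_def prime_gt_0_nat)
  have vle: "norm (v m \<nu>) \<le> real l * \<bar>ln (real m + 1)\<bar> ^ \<nu>" for m \<nu>
    using cle[of m] by (simp add: v_def x_def norm_mult norm_power mult_right_mono)
  have W0: "W \<nu> m \<ge> 0" for \<nu> m by (simp add: W_def)
  have sW: "summable (W \<nu>)" for \<nu> unfolding W_def by (rule summable_nonprime_prime_powers)
  have div: "\<not> summable (\<lambda>m. norm (\<Sum>\<nu>\<in>{..<N}. v m \<nu> * cnj (u \<nu>)) / x m)" if u: "\<exists>\<nu>\<in>{..<N}. u \<nu> \<noteq> 0" for u
  proof -
    obtain d Y where d: "d > 0" "\<And>t::real. t \<ge> Y \<Longrightarrow> norm (\<Sum>\<nu><N. of_real ((- t) ^ \<nu>) * cnj (u \<nu>)) \<ge> d"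
      using poly_lower_bound[of N "\<lambda>\<nu>. cnj (u \<nu>)"] u by auto
    have "filterlim (\<lambda>m. ln (real m + 1)) at_top sequentially"
    proof (rule filterlim_compose[OF ln_at_top])
      show "filterlim (\<lambda>m. real m + 1) at_top sequentially"
        using filterlim_tendsto_add_at_top[OF tendsto_const filterlim_real_sequentially, of 1]
        by (simp add: add.commute)
    qed
    hence "eventually (\<lambda>m. ln (real m + 1) \<ge> Y) sequentially" by (simp add: filterlim_at_top)
    then obtain M where M: "\<And>m. m \<ge> M \<Longrightarrow> ln (real m + 1) \<ge> Y" by (auto simp: eventually_sequentially)
    define f where "f = (\<lambda>p. if prime p then norm (\<Sum>j=1..l. A j p) / real p else 0)"
    have nsf: "\<not> summable (\<lambda>m. f (Suc m))" using ns[folded f_def] summable_Suc_iff[of f] by blast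
    show ?thesis
    proof (rule not_summable_lower_bound[OF nsf d(1)])
      show "0 \<le> f (Suc m)" for m by (simp add: f_def)
      fix m assume m: "m \<ge> M"
      show "d * f (Suc m) \<le> norm (\<Sum>\<nu>\<in>{..<N}. v m \<nu> * cnj (u \<nu>)) / x m"
      proof (cases "prime (Suc m)")
        case True
        have "c m = (\<Sum>j=1..l. A j (Suc m))"
          using log_coeff_prime_power[OF True, of 1 l A] by (simp add: c_def)
        moreover have "(\<Sum>\<nu>\<in>{..<N}. v m \<nu> * cnj (u \<nu>)) = c m * (\<Sum>\<nu><N. of_real ((- ln (x m)) ^ \<nu>) * cnj (u \<nu>))"
          using True by (simp add: v_def sum_distrib_left mult.assoc)
        ultimately have "norm (\<Sum>\<nu>\<in>{..<N}. v m \<nu> * cnj (u \<nu>)) = norm (\<Sum>j=1..l. A j (Suc m)) * norm (\<Sum>\<nu><N. of_real ((- ln (x m)) ^ \<nu>) * cnj (u \<nu>))"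
          by (simp add: norm_mult)
        also have "\<dots> \<ge> norm (\<Sum>j=1..l. A j (Suc m)) * d"
          using d(2)[OF M[OF m]] by (intro mult_left_mono) (auto simp: x_def)
        finally have "norm (\<Sum>j=1..l. A j (Suc m)) * d / x m \<le> norm (\<Sum>\<nu>\<in>{..<N}. v m \<nu> * cnj (u \<nu>)) / x m"
          using x(1)[of m] by (intro divide_right_mono) auto
        moreover have "real (Suc m) = x m" by (simp add: x_def)
        ultimately show ?thesis using True by (simp add: f_def mult.commute)
      next
        case False
        thus ?thesis using x(1)[of m] by (simp add: f_def less_imp_le)
      qed
    qed
  qed
  have sq: "summable (\<lambda>m. (norm (v m \<nu>) / x m)\<^sup>2)" for \<nu>
    using summable_square_ln_weights[of 1 "\<lambda>m. v m \<nu>" "real l" \<nu>] vle unfolding x_def by auto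
  have ab: "summable (\<lambda>m. norm (v m \<nu>) * x m powr - \<sigma>)" if "\<sigma> > 1" for \<nu> \<sigma>
    using summable_ln_weights[of 1 "\<lambda>m. v m \<nu>" "real l" \<nu> \<sigma>] vle that unfolding x_def by auto
  have e2: "e / 2 > 0" using e by simp
  obtain M1 where M1: "\<And>M0 R. M0 \<ge> M1 \<Longrightarrow> \<exists>\<delta>>0. \<forall>\<sigma>. 1 < \<sigma> \<and> \<sigma> < 1 + \<delta> \<longrightarrow>
     (\<forall>y. (\<forall>i\<in>{..<N}. norm (y i) \<le> R) \<longrightarrow> (\<exists>\<omega>. (\<forall>m. norm (\<omega> m) = 1) \<and>
        (\<forall>i\<in>{..<N}. norm (y i - suminf (\<lambda>m. if m < M0 then 0 else \<omega> m * of_real (x m powr - \<sigma>) * v m i)) < e / 2)))"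
    using twisted_series_approx[OF finite_lessThan x(1) x(2) div sq ab e2] by blast
  \<comment> \<open>The tail is later multiplied by 2 * l, which then stays below e / 2; the added 1
    avoids a zero denominator.\<close>
  have e4: "e / (4 * (real l + 1)) > 0" using e by simp
  obtain M2 where M2: "\<And>\<nu> n. \<nu> \<in> {..<N} \<Longrightarrow> n \<ge> M2 \<Longrightarrow> suminf (\<lambda>m. W \<nu> (m + n)) < e / (4 * (real l + 1))"
    by (rule finite_index_uniform_tail[where f = W and I = "{..<N}", OF finite_lessThan sW W0 e4]) auto
  define M0 where "M0 = max M1 M2"
  define R where "R = (\<Sum>\<nu><N. norm (y \<nu>) + ((\<Sum>m<M0. V \<nu> m) + real l * suminf (W \<nu>)))"
  have "M0 \<ge> M1" by (simp add: M0_def)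
  from M1[OF this, of R] obtain \<delta> where \<delta>: "\<delta> > 0" "\<And>\<sigma> y. 1 < \<sigma> \<Longrightarrow> \<sigma> < 1 + \<delta> \<Longrightarrow> \<forall>i\<in>{..<N}. norm (y i) \<le> R \<Longrightarrow>
      \<exists>\<omega>. (\<forall>m. norm (\<omega> m) = 1) \<and> (\<forall>i\<in>{..<N}. norm (y i - suminf (\<lambda>m. if m < M0 then 0 else \<omega> m * of_real (x m powr - \<sigma>) * v m i)) < e / 2)"
    by blast
  show ?thesis
  proof (rule that[OF \<delta>(1)])
    fix \<sigma> assume \<sigma>: "1 < \<sigma>" "\<sigma> < 1 + \<delta>"
    have xs: "x m powr - \<sigma> \<le> x m powr - 1" for m using x \<sigma> by (intro powr_mono) auto
    \<comment> \<open>Everything that is not twisted freely: all terms below \<open>M0\<close> and,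
      beyond it, the prime powers that are not prime.\<close>
    define q where "q = (\<lambda>\<nu> m. if prime (Suc m) \<and> m \<ge> M0 then 0 else g \<sigma> \<nu> m)"
    have gW: "norm (g \<sigma> \<nu> m) \<le> real l * W \<nu> m" if "\<not> prime (Suc m)" for \<nu> m
    proof (cases "primepow (Suc m)")
      case True
      have "norm (g \<sigma> \<nu> m) = norm (c m) * (\<bar>ln (x m)\<bar> ^ \<nu> * x m powr - \<sigma>)"
        using x(1)[of m] by (simp add: g_def norm_mult norm_power)
      also have "\<dots> \<le> real l * (\<bar>ln (x m)\<bar> ^ \<nu> * x m powr - 1)"
        using cle xs by (intro mult_mono mult_left_mono) auto
      also have "\<bar>ln (x m)\<bar> ^ \<nu> * x m powr - 1 = W \<nu> m"
        using True that x(1)[of m] by (simp add: W_def x_def powr_minus divide_inverse add.commute)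
      finally show ?thesis .
    next
      case False
      thus ?thesis using W0[of \<nu> m] by (simp add: g_def c_def log_coeff_def)
    qed
    have gv: "norm (g \<sigma> \<nu> m) = norm (v m \<nu>) * x m powr - \<sigma>" if "prime (Suc m)" for \<nu> m
      using that x(1)[of m] by (simp add: g_def v_def norm_mult norm_power)
    have gV: "norm (g \<sigma> \<nu> m) \<le> V \<nu> m" if "prime (Suc m)" for \<nu> m
      unfolding gv[OF that] V_def by (intro mult_left_mono xs) simp
    have sg: "summable (\<lambda>m. norm (g \<sigma> \<nu> m))" for \<nu>
    proof (rule summable_comparison_test'[OF summable_add[OF ab[OF \<sigma>(1), of \<nu>] summable_mult[OF sW[of \<nu>], of "real l"]]])
      fix m
      show "norm (norm (g \<sigma> \<nu> m)) \<le> norm (v m \<nu>) * x m powr - \<sigma> + real l * W \<nu> m"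
      proof (cases "prime (Suc m)")
        case True
        thus ?thesis using x(1)[of m] W0[of \<nu> m] by (simp add: g_def v_def norm_mult norm_power)
      next
        case False
        thus ?thesis using gW[OF False, of \<nu>] x(1)[of m] by (simp add: add_increasing)
      qed
    qed
    have q_le: "norm (q \<nu> m) \<le> (if m < M0 then V \<nu> m else 0) + real l * W \<nu> m" for \<nu> m
      using gW[of m \<nu>] gV[of m \<nu>] W0[of \<nu> m] x(1)[of m]
      by (cases "prime (Suc m)") (auto simp: q_def V_def add_increasing2 add_increasing)
    have sum_q: "summable (\<lambda>m. norm (q \<nu> m))" for \<nu>
      by (rule summable_comparison_test'[OF sg[of \<nu>]]) (simp add: q_def)
    define y' where "y' = (\<lambda>\<nu>. y \<nu> - suminf (q \<nu>))"
    have "\<forall>\<nu>\<in>{..<N}. norm (y' \<nu>) \<le> R"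
    proof
      fix \<nu> assume \<nu>: "\<nu> \<in> {..<N}"
      have fin: "(\<lambda>m. if m < M0 then V \<nu> m else 0) sums (\<Sum>m<M0. V \<nu> m)"
        using sums_If_finite_set[of "{..<M0}" "V \<nu>"] by simp
      have tot: "(\<lambda>m. (if m < M0 then V \<nu> m else 0) + real l * W \<nu> m) sums ((\<Sum>m<M0. V \<nu> m) + real l * suminf (W \<nu>))"
        by (intro sums_add fin sums_mult summable_sums sW)
      have "norm (suminf (q \<nu>)) \<le> suminf (\<lambda>m. norm (q \<nu> m))" by (rule summable_norm[OF sum_q])
      also have "\<dots> \<le> (\<Sum>m<M0. V \<nu> m) + real l * suminf (W \<nu>)"
        using suminf_le[OF q_le sum_q sums_summable[OF tot]] sums_unique[OF tot] by simp
      finally have "norm (y' \<nu>) \<le> norm (y \<nu>) + ((\<Sum>m<M0. V \<nu> m) + real l * suminf (W \<nu>))"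
        unfolding y'_def using norm_triangle_ineq4[of "y \<nu>" "suminf (q \<nu>)"] by linarith
      also have "\<dots> \<le> R"
        unfolding R_def using \<nu> suminf_nonneg[OF sW W0] x(1)
        by (intro member_le_sum[of \<nu> "{..<N}" "\<lambda>\<nu>. norm (y \<nu>) + ((\<Sum>m<M0. V \<nu> m) + real l * suminf (W \<nu>))"])
           (auto intro!: add_nonneg_nonneg sum_nonneg mult_nonneg_nonneg simp: V_def)
      finally show "norm (y' \<nu>) \<le> R" .
    qed
    from \<delta>(2)[OF \<sigma> this] obtain \<omega> where \<omega>: "\<And>m. norm (\<omega> m) = 1"
      "\<And>\<nu>. \<nu> < N \<Longrightarrow> norm (y' \<nu> - suminf (\<lambda>m. if m < M0 then 0 else \<omega> m * of_real (x m powr - \<sigma>) * v m \<nu>)) < e / 2"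
      by auto
    \<comment> \<open>Index m belongs to the integer m + 1, so \<open>p \<le> M0\<close> means an
      index below \<open>M0\<close>. The base of a prime power up to \<open>M0\<close> is also at
      most \<open>M0\<close>, so all phases below the cut-off are 1.\<close>
    define \<omega>' where "\<omega>' = (\<lambda>p. if p \<le> M0 then 1 else \<omega> (p - 1))"
    define \<Omega> where "\<Omega> = (\<lambda>m. prime_power_phase \<omega>' (Suc m))"
    have \<omega>'1: "norm (\<omega>' p) = 1" for p using \<omega>(1) by (simp add: \<omega>'_def)
    have \<Omega>1: "norm (\<Omega> m) = 1" for m unfolding \<Omega>_def by (rule norm_prime_power_phase[OF \<omega>'1])
    have \<Omega>_small: "\<Omega> m = 1" if "m < M0" for m
    proof (cases "primepow (Suc m)")
      case True
      hence "aprimedivisor (Suc m) \<le> Suc m" using primepow_gt_Suc_0[OF True] by (intro aprimedivisor_le_nat) auto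
      thus ?thesis using that by (simp add: \<Omega>_def prime_power_phase_def \<omega>'_def)
    qed (simp add: \<Omega>_def prime_power_phase_def)
    have main: "norm (y \<nu> - suminf (\<lambda>m. g \<sigma> \<nu> m * \<Omega> m)) < e" if \<nu>: "\<nu> < N" for \<nu>
    proof -
      define P where "P = (\<lambda>m. if m < M0 then 0 else \<omega> m * of_real (x m powr - \<sigma>) * v m \<nu>)"
      \<comment> \<open>The error of counting the terms of \<open>q\<close> with phase 1 instead of
        their true phase. It vanishes below \<open>M0\<close> and at primes.\<close>
      define D where "D = (\<lambda>m. q \<nu> m * (\<Omega> m - 1))"
      have sP: "summable P"
      proof (rule summable_norm_cancel, rule summable_comparison_test'[OF ab[OF \<sigma>(1), of \<nu>]])
        show "norm (norm (P m)) \<le> norm (v m \<nu>) * x m powr - \<sigma>" for m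
          using \<omega>(1)[of m] by (simp add: P_def norm_mult)
      qed
      have D_le: "norm (D m) \<le> (if m < M0 then 0 else 2 * (real l * W \<nu> m))" for m
      proof (cases "m < M0")
        case True
        thus ?thesis by (simp add: D_def \<Omega>_small)
      next
        case False
        have "norm (\<Omega> m - 1) \<le> 2" using norm_triangle_ineq4[of "\<Omega> m" 1] \<Omega>1[of m] by simp
        hence "norm (q \<nu> m) * norm (\<Omega> m - 1) \<le> (real l * W \<nu> m) * 2"
          using q_le[of \<nu> m] False W0[of \<nu> m] by (intro mult_mono) auto
        thus ?thesis using False by (simp add: D_def norm_mult)
      qed
      have sWM: "summable (\<lambda>m. W \<nu> (m + M0))" using sW[of \<nu>] by (simp add: summable_iff_shift)
      have tailW: "(\<lambda>m. if m < M0 then 0 else 2 * (real l * W \<nu> m)) sums (2 * (real l * suminf (\<lambda>m. W \<nu> (m + M0))))"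
      proof -
        have "(\<lambda>m. 2 * (real l * W \<nu> (m + M0))) sums (2 * (real l * suminf (\<lambda>m. W \<nu> (m + M0))))"
          by (intro sums_mult summable_sums sWM)
        hence "(\<lambda>m. if m + M0 < M0 then 0 else 2 * (real l * W \<nu> (m + M0))) sums (2 * (real l * suminf (\<lambda>m. W \<nu> (m + M0))))"
          by simp
        thus ?thesis by (subst (asm) sums_iff_shift) simp
      qed
      have sD: "summable (\<lambda>m. norm (D m))"
        by (rule summable_comparison_test'[OF sums_summable[OF tailW]]) (use D_le in auto)
      have "norm (suminf D) \<le> suminf (\<lambda>m. norm (D m))" by (rule summable_norm[OF sD])
      also have "\<dots> \<le> 2 * (real l * suminf (\<lambda>m. W \<nu> (m + M0)))"
        using suminf_le[OF D_le sD sums_summable[OF tailW]] sums_unique[OF tailW] by simp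
      also have "\<dots> \<le> 2 * ((real l + 1) * (e / (4 * (real l + 1))))"
      proof (intro mult_left_mono mult_mono)
        show "suminf (\<lambda>m. W \<nu> (m + M0)) \<le> e / (4 * (real l + 1))"
          using M2[of \<nu> M0] \<nu> by (simp add: M0_def)
        show "0 \<le> suminf (\<lambda>m. W \<nu> (m + M0))" by (rule suminf_nonneg[OF sWM W0])
      qed auto
      also have "\<dots> = e / 2" by (simp add: field_simps)
      finally have D: "norm (suminf D) \<le> e / 2" .
      have "g \<sigma> \<nu> m * \<Omega> m = P m + q \<nu> m + D m" for m
      proof (cases "prime (Suc m) \<and> m \<ge> M0")
        case True
        hence "\<Omega> m = \<omega> m" by (simp add: \<Omega>_def prime_power_phase_prime \<omega>'_def)
        thus ?thesis using True by (simp add: P_def q_def D_def g_def v_def mult_ac)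
      next
        case False
        thus ?thesis by (auto simp: P_def q_def D_def v_def algebra_simps)
      qed
      hence "suminf (\<lambda>m. g \<sigma> \<nu> m * \<Omega> m) = suminf (\<lambda>m. P m + q \<nu> m + D m)" by simp
      also have "\<dots> = suminf P + suminf (q \<nu>) + suminf D"
        using sP summable_norm_cancel[OF sum_q[of \<nu>]] summable_norm_cancel[OF sD]
        by (simp add: suminf_add[symmetric] summable_add)
      finally have "y \<nu> - suminf (\<lambda>m. g \<sigma> \<nu> m * \<Omega> m) = (y' \<nu> - suminf P) - suminf D"
        by (simp add: y'_def)
      hence "norm (y \<nu> - suminf (\<lambda>m. g \<sigma> \<nu> m * \<Omega> m)) \<le> norm (y' \<nu> - suminf P) + norm (suminf D)"
        by (simp only: norm_triangle_ineq4)
      also have "\<dots> < e / 2 + e / 2" using \<omega>(2)[OF \<nu>] D unfolding P_def by (intro add_less_le_mono) auto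
      finally show ?thesis by simp
    qed
    show "\<exists>\<omega>. (\<forall>p. norm (\<omega> p) = 1) \<and>
     (\<forall>\<nu><N. norm (y \<nu> - suminf (\<lambda>m. (log_coeff l A (Suc m) * of_real ((- ln (real m + 1)) ^ \<nu> * (real m + 1) powr - \<sigma>))
        * prime_power_phase \<omega> (Suc m))) < e)"
      by (intro exI[of _ \<omega>'] conjI allI impI \<omega>'1) (use main in \<open>simp add: g_def c_def x_def \<Omega>_def\<close>)
  qed
qed

section \<open>Realising all phases by one ordinate\<close>

lemma phase_perturbation_family:
  fixes g :: "'a \<Rightarrow> nat \<Rightarrow> complex"
  assumes "finite X" "\<And>x. x \<in> X \<Longrightarrow> summable (\<lambda>m. norm (g x m))" "e > 0"
  shows "\<exists>M \<eta>. \<eta> > 0 \<and> (\<forall>x\<in>X. \<forall>\<omega> \<omega>'. (\<forall>m. norm (\<omega> m) \<le> 1) \<longrightarrow> (\<forall>m. norm (\<omega>' m) \<le> 1) \<longrightarrow>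
     (\<forall>m<M. norm (\<omega> m - \<omega>' m) < \<eta>) \<longrightarrow> norm (suminf (\<lambda>m. g x m * \<omega> m) - suminf (\<lambda>m. g x m * \<omega>' m)) < e)"
  using assms(1,2)
proof (induction X rule: finite_induct)
  case empty
  show ?case by (auto intro: exI[of _ 1])
next
  case (insert x X)
  then obtain M \<eta> where IH: "\<eta> > 0" "\<forall>x\<in>X. \<forall>\<omega> \<omega>'. (\<forall>m. norm (\<omega> m) \<le> 1) \<longrightarrow> (\<forall>m. norm (\<omega>' m) \<le> 1) \<longrightarrow>
     (\<forall>m<M. norm (\<omega> m - \<omega>' m) < \<eta>) \<longrightarrow> norm (suminf (\<lambda>m. g x m * \<omega> m) - suminf (\<lambda>m. g x m * \<omega>' m)) < e"
    by auto
  have "\<exists>M' \<eta>'. \<eta>' > 0 \<and> (\<forall>\<omega> \<omega>'. (\<forall>m. norm (\<omega> m) \<le> 1) \<longrightarrow> (\<forall>m. norm (\<omega>' m) \<le> 1) \<longrightarrow>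
     (\<forall>m<M'. norm (\<omega> m - \<omega>' m) < \<eta>') \<longrightarrow> norm (suminf (\<lambda>m. g x m * \<omega> m) - suminf (\<lambda>m. g x m * \<omega>' m)) < e)"
  proof (rule phase_perturbation[OF insert.prems[OF insertI1] assms(3)])
    fix M' \<eta>' assume "\<eta>' > 0" and rule: "\<And>\<omega> \<omega>' :: nat \<Rightarrow> complex. (\<And>m. norm (\<omega> m) \<le> 1) \<Longrightarrow> (\<And>m. norm (\<omega>' m) \<le> 1) \<Longrightarrow>
       (\<And>m. m < M' \<Longrightarrow> norm (\<omega> m - \<omega>' m) < \<eta>') \<Longrightarrow>
       norm (suminf (\<lambda>m. g x m * \<omega> m) - suminf (\<lambda>m. g x m * \<omega>' m)) < e"
    show ?thesis
      by (intro exI[of _ M'] exI[of _ \<eta>'] conjI allI impI \<open>\<eta>' > 0\<close>) (rule rule; simp)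
  qed
  then obtain M' \<eta>' where x: "\<eta>' > 0" "\<forall>\<omega> \<omega>'. (\<forall>m. norm (\<omega> m) \<le> 1) \<longrightarrow> (\<forall>m. norm (\<omega>' m) \<le> 1) \<longrightarrow>
     (\<forall>m<M'. norm (\<omega> m - \<omega>' m) < \<eta>') \<longrightarrow> norm (suminf (\<lambda>m. g x m * \<omega> m) - suminf (\<lambda>m. g x m * \<omega>' m)) < e"
    by (elim exE conjE)
  show ?case
  proof (intro exI[of _ "max M M'"] exI[of _ "min \<eta> \<eta>'"] conjI ballI allI impI)
    show "min \<eta> \<eta>' > 0" using IH x by simp
    fix z \<omega> \<omega>' assume z: "z \<in> insert x X" and n: "\<forall>m. norm (\<omega> m) \<le> 1" "\<forall>m. norm (\<omega>' m :: complex) \<le> 1"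
      and d: "\<forall>m<max M M'. norm (\<omega> m - \<omega>' m) < min \<eta> \<eta>'"
    show "norm (suminf (\<lambda>m. g z m * \<omega> m) - suminf (\<lambda>m. g z m * \<omega>' m)) < e"
    proof (cases "z = x")
      case True
      have "\<forall>m<M'. norm (\<omega> m - \<omega>' m) < \<eta>'" using d by auto
      thus ?thesis unfolding True using x(2) n by blast
    next
      case False
      hence "z \<in> X" using z by simp
      moreover have "\<forall>m<M. norm (\<omega> m - \<omega>' m) < \<eta>" using d by auto
      ultimately show ?thesis using IH(2) n by blast
    qed
  qed
qed

text \<open>The label j = 0, with shift 1, carries the primes m + 1. Algebraic independence removes
  the coefficients of the shifts \<open>\<alpha> j\<close>; what remains is a relation among
  logarithms of primes.\<close>

lemma shift_frequencies_independent:
  fixes c :: "nat \<times> nat \<Rightarrow> int" and \<alpha> :: "nat \<Rightarrow> real"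
  assumes indep: "algebraically_independent_rat {1..r} \<alpha>" and pos: "\<And>j. j \<in> {1..r} \<Longrightarrow> \<alpha> j > 0"
    and J: "finite J" "\<And>m. m \<in> J \<Longrightarrow> prime (Suc m)"
    and eq: "(\<Sum>(j, m)\<in>({0} \<times> J) \<union> ({1..r} \<times> {..<M}). of_int (c (j, m)) * ln (real m + (if j = 0 then 1 else \<alpha> j))) = 0"
  shows "\<forall>x\<in>({0} \<times> J) \<union> ({1..r} \<times> {..<M}). c x = 0"
proof -
  define S where "S = Suc ` J"
  define d where "d = (\<lambda>p. c (0, p - 1))"
  have eq': "(\<Sum>p\<in>S. of_int (d p) * ln (real p)) + (\<Sum>(j, m)\<in>{1..r} \<times> {..<M}. of_int (c (j, m)) * ln (real m + \<alpha> j)) = 0"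
  proof -
    have "(\<Sum>(j, m)\<in>({0} \<times> J) \<union> ({1..r} \<times> {..<M}). of_int (c (j, m)) * ln (real m + (if j = 0 then 1 else \<alpha> j)))
      = (\<Sum>(j, m)\<in>{0} \<times> J. of_int (c (j, m)) * ln (real m + (if j = 0 then 1 else \<alpha> j)))
      + (\<Sum>(j, m)\<in>{1..r} \<times> {..<M}. of_int (c (j, m)) * ln (real m + (if j = 0 then 1 else \<alpha> j)))"
      using J by (intro sum.union_disjoint) auto
    also have "(\<Sum>(j, m)\<in>{0} \<times> J. of_int (c (j, m)) * ln (real m + (if j = 0 then 1 else \<alpha> j)))
      = (\<Sum>m\<in>J. of_int (c (0, m)) * ln (real m + 1))"
      by (simp add: sum.cartesian_product[symmetric])
    also have "\<dots> = (\<Sum>p\<in>S. of_int (d p) * ln (real p))"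
      unfolding S_def d_def by (subst sum.reindex) (auto simp: add.commute)
    also have "(\<Sum>(j, m)\<in>{1..r} \<times> {..<M}. of_int (c (j, m)) * ln (real m + (if j = 0 then 1 else \<alpha> j)))
      = (\<Sum>(j, m)\<in>{1..r} \<times> {..<M}. of_int (c (j, m)) * ln (real m + \<alpha> j))"
      by (intro sum.cong) auto
    finally show ?thesis using eq by simp
  qed
  have S: "finite S" "\<And>p. p \<in> S \<Longrightarrow> prime p" "\<And>p. p \<in> S \<Longrightarrow> p > 0" using J by (auto simp: S_def)
  have c1: "c x = 0" if "x \<in> {1..r} \<times> {..<M}" for x
    by (rule ln_shifts_independent[OF indep pos _ _ S(1) S(3) eq' that]) auto
  have "(\<Sum>(j, m)\<in>{1..r} \<times> {..<M}. of_int (c (j, m)) * ln (real m + \<alpha> j)) = 0"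
    by (rule sum.neutral) (use c1 in auto)
  hence "(\<Sum>p\<in>S. of_int (d p) * ln (real p)) = 0" using eq' by simp
  hence d0: "d p = 0" if "p \<in> S" for p using ln_primes_independent[OF S(1,2) _ that] by blast
  show ?thesis
  proof
    fix x assume "x \<in> ({0} \<times> J) \<union> ({1..r} \<times> {..<M})"
    thus "c x = 0" using c1 d0[of "Suc (snd x)"] by (cases x) (auto simp: S_def d_def)
  qed
qed

text \<open>Base and exponent of a prime power up to \<open>M\<close> are both at most
  \<open>M\<close>, and taking k-th powers of unimodular numbers enlarges distances at most k
  times.\<close>

lemma prime_power_phase_cis:
  assumes \<eta>: "\<And>p. prime p \<Longrightarrow> p \<le> M \<Longrightarrow> norm (cis (- (t * ln (real p))) - \<omega> p) < \<eta> / (real M + 1)"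
    and \<omega>: "\<And>p. norm (\<omega> p) = 1" and n: "primepow n" "n \<le> M" "\<eta> > 0"
  shows "norm (cis (- (t * ln (real n))) - prime_power_phase \<omega> n) < \<eta>"
proof -
  obtain p k where pk: "prime p" "k > 0" "n = p ^ k" using n(1) by (auto simp: primepow_def)
  have p1: "p > 1" using pk(1) by (rule prime_gt_1_nat)
  have "k < p ^ k" using p1 by (intro power_gt_expt) simp
  hence k: "k \<le> M" using n pk by simp
  have "p ^ 1 \<le> p ^ k" using pk p1 by (intro power_increasing) auto
  hence p: "p \<le> M" using n pk by simp
  have "cis (- (t * ln (real n))) = cis (- (t * ln (real p))) ^ k"
    unfolding Complex.DeMoivre pk(3) of_nat_power
    by (rule arg_cong[where f = cis]) (use p1 in \<open>simp add: ln_realpow mult_ac\<close>)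
  hence "norm (cis (- (t * ln (real n))) - prime_power_phase \<omega> n) = norm (cis (- (t * ln (real p))) ^ k - \<omega> p ^ k)"
    using pk by (simp add: prime_power_phase_prime_power)
  also have "\<dots> \<le> real k * norm (cis (- (t * ln (real p))) - \<omega> p)"
    by (rule norm_power_diff) (simp_all add: \<omega>)
  also have "\<dots> \<le> real M * norm (cis (- (t * ln (real p))) - \<omega> p)" using k by (intro mult_right_mono) auto
  also have "\<dots> \<le> real M * (\<eta> / (real M + 1))" using \<eta>[OF pk(1) p] by (intro mult_left_mono) auto
  also have "\<dots> < \<eta>" using n(3) by (simp add: field_simps)
  finally show ?thesis .
qed

text \<open>Once \<sigma> is fixed, each of the finitely many series depends, up to e / 2, on
  finitely many phases only. The frequencies being independent, Kronecker's theorem realises these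
  phases by a single ordinate beyond \<open>T\<close>.\<close>

lemma joint_values_approx:
  fixes \<alpha> :: "nat \<Rightarrow> real" and b :: "nat \<Rightarrow> nat \<Rightarrow> nat \<Rightarrow> complex" and A :: "nat \<Rightarrow> nat \<Rightarrow> complex"
    and y0 :: "nat \<Rightarrow> complex" and y :: "nat \<Rightarrow> nat \<times> nat \<Rightarrow> complex"
  assumes indep: "algebraically_independent_rat {1..r} \<alpha>" and pos: "\<And>j. j \<in> {1..r} \<Longrightarrow> \<alpha> j > 0"
    and per: "\<And>j. j \<in> {1..r} \<Longrightarrow> K j > 0" "\<And>j i m. j \<in> {1..r} \<Longrightarrow> i \<in> {1..l j} \<Longrightarrow> b j i (m + K j) = b j i m"
    and bounded: "\<And>j i m. j \<in> {1..r} \<Longrightarrow> i \<in> {1..l j} \<Longrightarrow> norm (b j i m) \<le> C j"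
    and rank: "\<And>j u. j \<in> {1..r} \<Longrightarrow> \<exists>i\<in>{1..l j}. u i \<noteq> 0 \<Longrightarrow> \<exists>m. (\<Sum>i\<in>{1..l j}. b j i m * u i) \<noteq> 0"
    and A: "\<And>j p. j \<in> {1..h} \<Longrightarrow> prime p \<Longrightarrow> norm (A j p) \<le> 1"
    and ns: "\<not> summable (\<lambda>p. if prime p then norm (\<Sum>j=1..h. A j p) / real p else 0)"
    and e: "e > 0"
  shows "\<exists>s. Re s > 1 \<and> Im s > T \<and>
     (\<forall>\<nu><N. norm (y0 \<nu> - dser 1 (\<lambda>m. log_coeff h A (Suc m)) \<nu> s) < e) \<and>
     (\<forall>j\<in>{1..r}. \<forall>i\<in>{1..l j}. \<forall>\<nu><N. norm (y j (i, \<nu>) - dser (\<alpha> j) (b j i) \<nu> s) < e)"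
proof -
  have e2: "e / 2 > 0" using e by simp
  obtain \<delta>0 where \<delta>0: "\<delta>0 > 0" "\<And>\<sigma>. 1 < \<sigma> \<Longrightarrow> \<sigma> < 1 + \<delta>0 \<Longrightarrow> \<exists>\<omega>. (\<forall>p. norm (\<omega> p) = 1) \<and>
     (\<forall>\<nu><N. norm (y0 \<nu> - suminf (\<lambda>m. (log_coeff h A (Suc m) * of_real ((- ln (real m + 1)) ^ \<nu> * (real m + 1) powr - \<sigma>))
        * prime_power_phase \<omega> (Suc m))) < e / 2)"
    by (rule euler_twists_approx[of h A "e / 2" N y0]) (use A ns e2 in blast)+
  define Q where "Q = (\<lambda>j \<sigma> \<omega>. (\<forall>m. norm (\<omega> m) = 1) \<and>
     (\<forall>i\<in>{1..l j}. \<forall>\<nu><N. norm (y j (i, \<nu>) - suminf (\<lambda>m. (b j i m * of_real ((- ln (real m + \<alpha> j)) ^ \<nu> * (real m + \<alpha> j) powr - \<sigma>)) * \<omega> m)) < e / 2))"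
  have "\<forall>j\<in>{1..r}. \<exists>\<delta>>0. \<forall>\<sigma>. 1 < \<sigma> \<longrightarrow> \<sigma> < 1 + \<delta> \<longrightarrow> (\<exists>\<omega>. Q j \<sigma> \<omega>)"
  proof
    fix j assume j: "j \<in> {1..r}"
    show "\<exists>\<delta>>0. \<forall>\<sigma>. 1 < \<sigma> \<longrightarrow> \<sigma> < 1 + \<delta> \<longrightarrow> (\<exists>\<omega>. Q j \<sigma> \<omega>)"
      unfolding Q_def
      by (rule hurwitz_twists_approx[of "{1..l j}" "\<alpha> j" "b j" "C j" "K j" "e / 2" N "y j"])
         (use pos[OF j] per(1)[OF j] per(2)[OF j] bounded[OF j] rank[OF j] e2 in blast)+
  qed
  from bchoice[OF this] obtain \<delta> where
    \<delta>': "\<forall>j\<in>{1..r}. \<delta> j > 0 \<and> (\<forall>\<sigma>. 1 < \<sigma> \<longrightarrow> \<sigma> < 1 + \<delta> j \<longrightarrow> (\<exists>\<omega>. Q j \<sigma> \<omega>))"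
    by (rule exE)
  \<comment> \<open>One \<sigma> has to serve \<phi> and all zeta-functions, which are evaluated at
    the same point.\<close>
  define d where "d = Min (insert \<delta>0 (\<delta> ` {1..r}))"
  have d: "d > 0" "d \<le> \<delta>0" unfolding d_def using \<delta>0(1) \<delta>' by auto
  have d3: "d \<le> \<delta> j" if "j \<in> {1..r}" for j unfolding d_def by (rule Min_le) (use that in auto)
  define \<sigma> where "\<sigma> = 1 + d / 2"
  have \<sigma>: "\<sigma> > 1" "\<sigma> < 1 + \<delta>0" using d(1,2) unfolding \<sigma>_def by linarith+
  have \<sigma>3: "\<sigma> < 1 + \<delta> j" if "j \<in> {1..r}" for j
    using d(1) d3[OF that] unfolding \<sigma>_def by linarith
  define G0 where "G0 = (\<lambda>\<nu> m. log_coeff h A (Suc m) * of_real ((- ln (real m + 1)) ^ \<nu> * (real m + 1) powr - \<sigma>))"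
  define G where "G = (\<lambda>(j, i, \<nu>) m. b j i m * of_real ((- ln (real m + \<alpha> j)) ^ \<nu> * (real m + \<alpha> j) powr - \<sigma>))"
  obtain \<omega>0 where \<omega>0: "\<And>p. norm (\<omega>0 p) = 1" "\<And>\<nu>. \<nu> < N \<Longrightarrow> norm (y0 \<nu> - suminf (\<lambda>m. G0 \<nu> m * prime_power_phase \<omega>0 (Suc m))) < e / 2"
    using \<delta>0(2)[OF \<sigma>(1,2)] unfolding G0_def by blast
  have "\<forall>j\<in>{1..r}. \<exists>\<omega>. Q j \<sigma> \<omega>" using \<delta>' \<sigma>(1) \<sigma>3 by blast
  from bchoice[OF this] obtain \<omega> where "\<forall>j\<in>{1..r}. Q j \<sigma> (\<omega> j)" by (rule exE)
  hence \<omega>: "norm (\<omega> j m) = 1"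
    "i \<in> {1..l j} \<Longrightarrow> \<nu> < N \<Longrightarrow> norm (y j (i, \<nu>) - suminf (\<lambda>m. G (j, i, \<nu>) m * \<omega> j m)) < e / 2"
    if "j \<in> {1..r}" for j m i \<nu>
    using that unfolding G_def prod.case Q_def by blast+
  have cbound: "norm (log_coeff h A (Suc m)) \<le> real h * (real m + 1) powr 0" for m
    using norm_log_coeff_le[of h A 0 "Suc m"] A by (simp add: prime_gt_0_nat)
  have sG0: "summable (\<lambda>m. norm (G0 \<nu> m))" for \<nu>
    using dser_summable[OF _ cbound, of "of_real \<sigma>" \<nu>] \<sigma>(1)
    by (simp add: G0_def norm_mult norm_of_real_powr mult.assoc del: of_real_add)
  have sG: "summable (\<lambda>m. norm (G (j, i, \<nu>) m))" if "j \<in> {1..r}" "i \<in> {1..l j}" for j i \<nu>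
  proof -
    have "norm (b j i m) \<le> C j * (real m + \<alpha> j) powr 0" for m
      using bounded[OF that, of m] pos[OF that(1)] by simp
    from dser_summable[OF pos[OF that(1)] this, of "of_real \<sigma>" \<nu>] show ?thesis
      using \<sigma>(1) pos[OF that(1)] by (simp add: G_def norm_mult norm_of_real_powr mult.assoc del: of_real_add)
  qed
  define X where "X = (SIGMA j:{1..r}. {1..l j} \<times> {..<N})"
  have X: "finite X" by (simp add: X_def)
  have "\<exists>M \<eta>. \<eta> > 0 \<and> (\<forall>x\<in>X. \<forall>\<omega> \<omega>'. (\<forall>m. norm (\<omega> m) \<le> 1) \<longrightarrow> (\<forall>m. norm (\<omega>' m) \<le> 1) \<longrightarrow>
     (\<forall>m<M. norm (\<omega> m - \<omega>' m) < \<eta>) \<longrightarrow> norm (suminf (\<lambda>m. G x m * \<omega> m) - suminf (\<lambda>m. G x m * \<omega>' m)) < e / 2)"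
    by (rule phase_perturbation_family[OF X _ e2]) (use sG in \<open>auto simp: X_def\<close>)
  then obtain M1 \<eta>1 where 1: "\<eta>1 > 0" "\<forall>x\<in>X. \<forall>\<omega> \<omega>'. (\<forall>m. norm (\<omega> m) \<le> 1) \<longrightarrow> (\<forall>m. norm (\<omega>' m) \<le> 1) \<longrightarrow>
     (\<forall>m<M1. norm (\<omega> m - \<omega>' m) < \<eta>1) \<longrightarrow> norm (suminf (\<lambda>m. G x m * \<omega> m) - suminf (\<lambda>m. G x m * \<omega>' m)) < e / 2"
    by (elim exE conjE)
  have "\<exists>M \<eta>. \<eta> > 0 \<and> (\<forall>\<nu>\<in>{..<N}. \<forall>\<omega> \<omega>'. (\<forall>m. norm (\<omega> m) \<le> 1) \<longrightarrow> (\<forall>m. norm (\<omega>' m) \<le> 1) \<longrightarrow>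
     (\<forall>m<M. norm (\<omega> m - \<omega>' m) < \<eta>) \<longrightarrow> norm (suminf (\<lambda>m. G0 \<nu> m * \<omega> m) - suminf (\<lambda>m. G0 \<nu> m * \<omega>' m)) < e / 2)"
    by (rule phase_perturbation_family[OF finite_lessThan _ e2]) (rule sG0)
  then obtain M0 \<eta>0 where 0: "\<eta>0 > 0" "\<forall>\<nu>\<in>{..<N}. \<forall>\<omega> \<omega>'. (\<forall>m. norm (\<omega> m) \<le> 1) \<longrightarrow> (\<forall>m. norm (\<omega>' m) \<le> 1) \<longrightarrow>
     (\<forall>m<M0. norm (\<omega> m - \<omega>' m) < \<eta>0) \<longrightarrow> norm (suminf (\<lambda>m. G0 \<nu> m * \<omega> m) - suminf (\<lambda>m. G0 \<nu> m * \<omega>' m)) < e / 2"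
    by (elim exE conjE)
  \<comment> \<open>Primes are approximated more closely, because the error at p^k may be k times
    that at p, with k up to \<open>M0\<close>.\<close>
  define \<eta> where "\<eta> = min \<eta>1 (\<eta>0 / (real M0 + 1))"
  have \<eta>: "\<eta> > 0" using 0(1) 1(1) by (simp add: \<eta>_def)
  define J where "J = {m. m < M0 \<and> prime (Suc m)}"
  define \<theta> where "\<theta> = (\<lambda>(j, m). ln (real m + (if j = 0 then 1 else \<alpha> j)))"
  have fin: "finite (({0} \<times> J) \<union> ({1..r} \<times> {..<M1}))" by (simp add: J_def)
  have ind: "\<forall>x\<in>({0} \<times> J) \<union> ({1..r} \<times> {..<M1}). c x = 0"
    if "(\<Sum>x\<in>({0} \<times> J) \<union> ({1..r} \<times> {..<M1}). of_int (c x) * \<theta> x) = 0" for c :: "nat \<times> nat \<Rightarrow> int"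
    by (rule shift_frequencies_independent[OF indep pos]) (use that in \<open>auto simp: J_def \<theta>_def case_prod_beta\<close>)
  define w where "w = (\<lambda>(j, m). if j = 0 then \<omega>0 (Suc m) else \<omega> j m)"
  have w: "norm (w x) = 1" if "x \<in> ({0} \<times> J) \<union> ({1..r} \<times> {..<M1})" for x
    using that \<omega>0(1) \<omega>(1) by (auto simp: w_def)
  obtain t where t: "t > T" "\<And>x. x \<in> ({0} \<times> J) \<union> ({1..r} \<times> {..<M1}) \<Longrightarrow> norm (cis (- (t * \<theta> x)) - w x) < \<eta>"
    by (rule kronecker_unimodular[OF fin ind \<eta> w]) auto
  show ?thesis
  proof (intro exI[of _ "Complex \<sigma> t"] conjI ballI allI impI)
    show "Re (Complex \<sigma> t) > 1" "Im (Complex \<sigma> t) > T" using \<sigma>(1) t(1) by simp_all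
  next
    fix \<nu> assume \<nu>: "\<nu> < N"
    \<comment> \<open>Off the prime powers the coefficients vanish, so the phase may be replaced
      there by the conventional 1 of \<open>prime_power_phase\<close>.\<close>
    define \<Omega> where "\<Omega> = (\<lambda>m. if primepow (Suc m) then cis (- (t * ln (real m + 1))) else 1)"
    define \<Omega>' where "\<Omega>' = (\<lambda>m. prime_power_phase \<omega>0 (Suc m))"
    have "dser 1 (\<lambda>m. log_coeff h A (Suc m)) \<nu> (Complex \<sigma> t) = suminf (\<lambda>m. G0 \<nu> m * cis (- (t * ln (real m + 1))))"
      unfolding G0_def by (rule dser_vertical) simp
    also have "\<dots> = suminf (\<lambda>m. G0 \<nu> m * \<Omega> m)"
      by (intro suminf_cong) (simp add: \<Omega>_def G0_def log_coeff_def)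
    finally have eq: "dser 1 (\<lambda>m. log_coeff h A (Suc m)) \<nu> (Complex \<sigma> t) = suminf (\<lambda>m. G0 \<nu> m * \<Omega> m)" .
    have "norm (suminf (\<lambda>m. G0 \<nu> m * \<Omega>' m) - suminf (\<lambda>m. G0 \<nu> m * \<Omega> m)) < e / 2"
    proof (rule 0(2)[THEN bspec, THEN spec, THEN spec, THEN mp, THEN mp, THEN mp])
      show "\<nu> \<in> {..<N}" using \<nu> by simp
      show "\<forall>m. norm (\<Omega> m) \<le> 1" by (simp add: \<Omega>_def)
      show "\<forall>m. norm (\<Omega>' m) \<le> 1" by (simp add: \<Omega>'_def norm_prime_power_phase \<omega>0(1))
      show "\<forall>m<M0. norm (\<Omega>' m - \<Omega> m) < \<eta>0"
      proof (intro allI impI)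
        fix m assume m: "m < M0"
        show "norm (\<Omega>' m - \<Omega> m) < \<eta>0"
        proof (cases "primepow (Suc m)")
          case True
          have "norm (cis (- (t * ln (real (Suc m)))) - prime_power_phase \<omega>0 (Suc m)) < \<eta>0"
          proof (rule prime_power_phase_cis[where M = M0])
            fix p assume p: "prime p" "p \<le> M0"
            have p0: "p > 0" using p(1) by (rule prime_gt_0_nat)
            have "(0, p - 1) \<in> ({0} \<times> J) \<union> ({1..r} \<times> {..<M1})" using p p0 by (auto simp: J_def)
            from t(2)[OF this] show "norm (cis (- (t * ln (real p))) - \<omega>0 p) < \<eta>0 / (real M0 + 1)"
              using p0 by (simp add: \<theta>_def w_def \<eta>_def of_nat_diff)
          qed (use m True 0(1) \<omega>0(1) in auto)
          moreover have "real (Suc m) = real m + 1" by simp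
          ultimately show ?thesis using True by (simp only: \<Omega>_def \<Omega>'_def if_True norm_minus_commute)
        next
          case False
          thus ?thesis using 0(1) by (simp add: \<Omega>_def \<Omega>'_def prime_power_phase_def)
        qed
      qed
    qed
    moreover have "norm (y0 \<nu> - suminf (\<lambda>m. G0 \<nu> m * \<Omega>' m)) < e / 2" unfolding \<Omega>'_def by (rule \<omega>0(2)[OF \<nu>])
    ultimately show "norm (y0 \<nu> - dser 1 (\<lambda>m. log_coeff h A (Suc m)) \<nu> (Complex \<sigma> t)) < e"
      unfolding eq using norm_triangle_ineq[of "y0 \<nu> - suminf (\<lambda>m. G0 \<nu> m * \<Omega>' m)"
          "suminf (\<lambda>m. G0 \<nu> m * \<Omega>' m) - suminf (\<lambda>m. G0 \<nu> m * \<Omega> m)"] by simp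
  next
    fix j i \<nu> assume j: "j \<in> {1..r}" and i: "i \<in> {1..l j}" and \<nu>: "\<nu> < N"
    have eq: "dser (\<alpha> j) (b j i) \<nu> (Complex \<sigma> t) = suminf (\<lambda>m. G (j, i, \<nu>) m * cis (- (t * ln (real m + \<alpha> j))))"
      unfolding G_def prod.case by (rule dser_vertical[OF pos[OF j]])
    have "norm (suminf (\<lambda>m. G (j, i, \<nu>) m * \<omega> j m) - suminf (\<lambda>m. G (j, i, \<nu>) m * cis (- (t * ln (real m + \<alpha> j))))) < e / 2"
    proof (rule 1(2)[THEN bspec, THEN spec, THEN spec, THEN mp, THEN mp, THEN mp])
      show "(j, i, \<nu>) \<in> X" using j i \<nu> by (simp add: X_def)
      show "\<forall>m<M1. norm (\<omega> j m - cis (- (t * ln (real m + \<alpha> j)))) < \<eta>1"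
      proof (intro allI impI)
        fix m assume m: "m < M1"
        have "(j, m) \<in> ({0} \<times> J) \<union> ({1..r} \<times> {..<M1})" using j m by simp
        from t(2)[OF this] show "norm (\<omega> j m - cis (- (t * ln (real m + \<alpha> j)))) < \<eta>1"
          using j by (simp add: \<theta>_def w_def \<eta>_def norm_minus_commute)
      qed
    qed (simp_all add: \<omega>(1)[OF j])
    with \<omega>(2)[OF j i \<nu>] show "norm (y j (i, \<nu>) - dser (\<alpha> j) (b j i) \<nu> (Complex \<sigma> t)) < e"
      unfolding eq using norm_triangle_ineq[of "y j (i, \<nu>) - suminf (\<lambda>m. G (j, i, \<nu>) m * \<omega> j m)"
          "suminf (\<lambda>m. G (j, i, \<nu>) m * \<omega> j m) - suminf (\<lambda>m. G (j, i, \<nu>) m * cis (- (t * ln (real m + \<alpha> j))))"] by simp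
  qed
qed

section \<open>Passing from the logarithm to the function\<close>

text \<open>Leibniz's rule for f' = L' f: with \<open>y k\<close> the k-th derivative of L at a
  point, these are the derivatives of f = exp L there.\<close>

fun exp_derivs :: "(nat \<Rightarrow> complex) \<Rightarrow> nat \<Rightarrow> complex" where
  "exp_derivs y 0 = exp (y 0)"
| "exp_derivs y (Suc n) = (\<Sum>k\<le>n. of_nat (n choose k) * y (Suc k) * exp_derivs y (n - k))"

text \<open>The recursion of \<open>exp_derivs\<close> solved for its highest entry, which appears
  multiplied by \<open>x 0\<close>; this is where \<open>x 0 \<noteq> 0\<close> comes in.\<close>

fun log_derivs :: "(nat \<Rightarrow> complex) \<Rightarrow> nat \<Rightarrow> complex" where
  "log_derivs x 0 = Ln (x 0)"
| "log_derivs x (Suc n) = (x (Suc n) - (\<Sum>k<n. of_nat (n choose k) * log_derivs x (Suc k) * x (n - k))) / x 0"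

lemma exp_log_derivs:
  assumes "x 0 \<noteq> 0"
  shows "exp_derivs (log_derivs x) n = x n"
proof (induction n rule: less_induct)
  case (less n)
  show ?case
  proof (cases n)
    case 0
    thus ?thesis using assms by simp
  next
    case (Suc m)
    have "exp_derivs (log_derivs x) n = (\<Sum>k\<le>m. of_nat (m choose k) * log_derivs x (Suc k) * x (m - k))"
      unfolding Suc exp_derivs.simps
    proof (intro sum.cong refl)
      fix k
      have "exp_derivs (log_derivs x) (m - k) = x (m - k)" by (rule less.IH) (simp add: Suc)
      thus "of_nat (m choose k) * log_derivs x (Suc k) * exp_derivs (log_derivs x) (m - k)
          = of_nat (m choose k) * log_derivs x (Suc k) * x (m - k)" by (simp only:)
    qed
    also have "\<dots> = (\<Sum>k<m. of_nat (m choose k) * log_derivs x (Suc k) * x (m - k)) + log_derivs x (Suc m) * x 0"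
      by (simp only: lessThan_Suc_atMost[symmetric] sum.lessThan_Suc binomial_n_n of_nat_1 mult_1 diff_self_eq_0)
    also have "log_derivs x (Suc m) * x 0 = x (Suc m) - (\<Sum>k<m. of_nat (m choose k) * log_derivs x (Suc k) * x (m - k))"
      using assms by (subst log_derivs.simps(2)) (simp del: log_derivs.simps)
    also have "(\<Sum>k<m. of_nat (m choose k) * log_derivs x (Suc k) * x (m - k)) + \<dots> = x n"
      unfolding Suc by (simp del: log_derivs.simps)
    finally show ?thesis .
  qed
qed

lemma tendsto_exp_derivs:
  assumes "\<And>k. k \<le> n \<Longrightarrow> ((\<lambda>t. Y t k) \<longlongrightarrow> y k) F"
  shows "((\<lambda>t. exp_derivs (Y t) n) \<longlongrightarrow> exp_derivs y n) F"
  using assms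
proof (induction n rule: less_induct)
  case (less n)
  show ?case
  proof (cases n)
    case 0
    thus ?thesis using less.prems[of 0] by (simp add: tendsto_exp)
  next
    case (Suc m)
    show ?thesis unfolding Suc exp_derivs.simps
      by (intro tendsto_sum tendsto_mult tendsto_const less.IH less.prems) (auto simp: Suc)
  qed
qed

lemma higher_deriv_exp:
  assumes S: "open S" and L: "L holomorphic_on S" and f: "\<And>s. s \<in> S \<Longrightarrow> f s = exp (L s)" and s: "s \<in> S"
  shows "(deriv ^^ n) f s = exp_derivs (\<lambda>k. (deriv ^^ k) L s) n"
proof (induction n rule: less_induct)
  case (less n)
  show ?case
  proof (cases n)
    case 0
    thus ?thesis using f s by simp
  next
    case (Suc m)
    have "(\<lambda>s. exp (L s)) holomorphic_on S" using L by (intro holomorphic_intros)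
    hence fh: "f holomorphic_on S" by (rule holomorphic_transform) (simp add: f)
    have d: "deriv f w = deriv L w * f w" if "w \<in> S" for w
    proof -
      have "(L has_field_derivative deriv L w) (at w)" using L S that by (rule holomorphic_derivI)
      from DERIV_chain2[OF DERIV_exp this]
      have "((\<lambda>s. exp (L s)) has_field_derivative exp (L w) * deriv L w) (at w)" .
      hence "(f has_field_derivative exp (L w) * deriv L w) (at w)"
        by (rule has_field_derivative_transform_within_open[OF _ S that]) (simp add: f)
      thus ?thesis using f[OF that] by (simp add: DERIV_imp_deriv mult.commute)
    qed
    have "(deriv ^^ n) f s = (deriv ^^ m) (deriv f) s" by (simp add: Suc funpow_Suc_right del: funpow.simps)
    also have "\<dots> = (deriv ^^ m) (\<lambda>w. deriv L w * f w) s"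
      by (rule higher_deriv_transform_within_open[OF _ _ S s]) (use d S L fh in \<open>auto intro!: holomorphic_intros\<close>)
    also have "\<dots> = (\<Sum>i=0..m. of_nat (m choose i) * (deriv ^^ i) (deriv L) s * (deriv ^^ (m - i)) f s)"
      by (rule higher_deriv_mult[OF _ fh S s]) (intro holomorphic_intros L S)
    also have "\<dots> = exp_derivs (\<lambda>k. (deriv ^^ k) L s) n"
      unfolding Suc exp_derivs.simps atMost_atLeast0
      by (intro sum.cong refl) (use less Suc in \<open>simp add: funpow_Suc_right del: funpow.simps\<close>)
    finally show ?thesis .
  qed
qed

text \<open>The entries of \<open>zeta_args\<close> are labelled by triples \<open>(j, i, \<nu>)\<close>; the block of \<open>\<phi>\<close> gets \<open>j = 0\<close>.\<close>
definition arg_labels :: "nat \<Rightarrow> nat \<Rightarrow> (nat \<Rightarrow> nat) \<Rightarrow> (nat \<times> nat \<times> nat) list" where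
  "arg_labels N r l = map (\<lambda>\<nu>. (0, 0, \<nu>)) [0..<N] @
     concat (map (\<lambda>j. concat (map (\<lambda>i. map (\<lambda>\<nu>. (j, i, \<nu>)) [0..<N]) [1..<Suc (l j)])) [1..<Suc r])"

lemma zeta_args_eq_map:
  "zeta_args N \<phi> r l Z s = map (\<lambda>(j, i, \<nu>). (deriv ^^ \<nu>) (if j = 0 then \<phi> else Z j i) s) (arg_labels N r l)"
proof -
  define F where "F = (\<lambda>(j, i, \<nu>). (deriv ^^ \<nu>) (if j = 0 then \<phi> else Z j i) s)"
  define B where "B = (\<lambda>j. concat (map (\<lambda>i. map (\<lambda>\<nu>. (j, i, \<nu>)) [0..<N]) [1..<Suc (l j)]))"
  have "concat (map (\<lambda>i. derivs_list N (Z j i) s) [1..<Suc (l j)]) = map F (B j)" if "j \<in> set [1..<Suc r]" for j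
    using that by (simp add: B_def F_def map_concat o_def derivs_list_def del: upt_Suc)
  hence "concat (map (\<lambda>j. concat (map (\<lambda>i. derivs_list N (Z j i) s) [1..<Suc (l j)])) [1..<Suc r])
      = concat (map (\<lambda>j. map F (B j)) [1..<Suc r])"
    by (intro arg_cong[of _ _ concat] map_cong refl)
  also have "\<dots> = map F (concat (map B [1..<Suc r]))"
    by (simp add: map_concat o_def del: upt_Suc)
  moreover have "derivs_list N \<phi> s = map F (map (\<lambda>\<nu>. (0, 0, \<nu>)) [0..<N])"
    by (simp add: derivs_list_def F_def)
  ultimately show ?thesis
    unfolding zeta_args_def arg_labels_def F_def[symmetric] B_def[symmetric] by (simp only: map_append)
qed

lemma set_arg_labels:
  "set (arg_labels N r l) = {(0, 0, \<nu>) | \<nu>. \<nu> < N} \<union> {(j, i, \<nu>). j \<in> {1..r} \<and> i \<in> {1..l j} \<and> \<nu> < N}"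
  unfolding arg_labels_def by (auto simp: image_iff simp del: upt_Suc)

lemma length_arg_labels: "length (arg_labels N r l) = N * ((\<Sum>j=1..r. l j) + 1)"
  \<comment> \<open>The length does not depend on the functions listed, so arbitrary ones may be
    inserted.\<close>
  using length_zeta_args[of N undefined r l undefined undefined] unfolding zeta_args_eq_map by simp

text \<open>Shown by counting. It makes the position of a label well defined, so a point can be
  prescribed label by label.\<close>

lemma distinct_arg_labels: "distinct (arg_labels N r l)"
proof (rule card_distinct)
  have "card (set (arg_labels N r l)) = card ((\<lambda>\<nu>. (0::nat, 0::nat, \<nu>)) ` {..<N}) + card (SIGMA j:{1..r}. {1..l j} \<times> {..<N})"
  proof (subst card_Un_disjoint[symmetric])
    show "card (set (arg_labels N r l)) = card ((\<lambda>\<nu>. (0::nat, 0::nat, \<nu>)) ` {..<N} \<union> (SIGMA j:{1..r}. {1..l j} \<times> {..<N}))"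
      unfolding set_arg_labels by (rule arg_cong[where f = card]) auto
  qed auto
  also have "card ((\<lambda>\<nu>. (0::nat, 0::nat, \<nu>)) ` {..<N}) = N" by (subst card_image) (auto simp: inj_on_def)
  also have "card (SIGMA j:{1..r}. {1..l j} \<times> {..<N}) = (\<Sum>j=1..r. l j * N)" by (simp add: card_cartesian_product)
  finally show "card (set (arg_labels N r l)) = length (arg_labels N r l)"
    unfolding length_arg_labels by (simp add: sum_distrib_left distrib_left mult.commute)
qed

lemma arg_labels_nth:
  assumes "\<nu> < N"
  shows "arg_labels N r l ! \<nu> = (0, 0, \<nu>)"
  using assms by (simp add: arg_labels_def nth_append)

section \<open>The leading coefficient vanishes\<close>

lemma periodic_lcm:
  assumes "\<And>i. i \<in> I \<Longrightarrow> is_period (b i) (k i)" "finite I" "i \<in> I"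
  shows "b i (m + Lcm (k ` I)) = b i m"
proof -
  have "k i dvd Lcm (k ` I)" using assms(3) by (intro dvd_Lcm) auto
  then obtain q where q: "Lcm (k ` I) = q * k i" by (metis dvd_def mult.commute)
  have "b i (m + q * k i) = b i m" for q
  proof (induction q)
    case (Suc q)
    thus ?case using assms(1)[OF assms(3)] unfolding is_period_def
      by (metis add.assoc add.commute mult_Suc)
  qed simp
  thus ?thesis unfolding q by simp
qed

lemma periodic_bounded:
  fixes b :: "nat \<Rightarrow> complex"
  assumes "is_period b k"
  shows "norm (b m) \<le> (\<Sum>t<k. norm (b t))"
proof -
  have k: "k > 0" and per: "\<And>m. b (m + k) = b m" using assms by (auto simp: is_period_def)
  have "b (q * k + t) = b t" for q t
  proof (induction q)
    case (Suc q)
    thus ?case using per[of "q * k + t"] by (simp add: add_ac)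
  qed simp
  from this[of "m div k" "m mod k"] have "b m = b (m mod k)" by simp
  also have "norm \<dots> \<le> (\<Sum>t<k. norm (b t))" using k by (intro member_le_sum) auto
  finally show ?thesis .
qed

lemma tendsto_leading_coefficient_zero:
  fixes s :: "nat \<Rightarrow> complex" and c :: "nat \<Rightarrow> nat \<Rightarrow> complex"
  assumes s: "filterlim s at_infinity sequentially"
    and c: "\<And>j. j \<le> n \<Longrightarrow> (\<lambda>t. c j t) \<longlonglongrightarrow> d j"
    and zero: "\<And>t. (\<Sum>j\<le>n. s t ^ j * c j t) = 0"
  shows "d n = 0"
proof -
  have inv: "(\<lambda>t. inverse (s t)) \<longlonglongrightarrow> 0"
    by (rule filterlim_compose[OF tendsto_inverse_0 s])
  have "(\<lambda>t. \<Sum>j\<le>n. inverse (s t) ^ (n - j) * c j t) \<longlonglongrightarrow> (\<Sum>j\<le>n. 0 ^ (n - j) * d j)"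
    by (intro tendsto_sum tendsto_mult tendsto_power inv c) auto
  also have "(\<Sum>j\<le>n. 0 ^ (n - j) * d j) = (\<Sum>j\<in>{n}. 0 ^ (n - j) * d j)"
    by (rule sum.mono_neutral_right) auto
  finally have lim: "(\<lambda>t. \<Sum>j\<le>n. inverse (s t) ^ (n - j) * c j t) \<longlonglongrightarrow> d n" by simp
  have "eventually (\<lambda>t. s t \<noteq> 0) sequentially"
    using filterlim_at_infinity_imp_eventually_ne[OF s, of 0] .
  hence "eventually (\<lambda>t. (\<Sum>j\<le>n. inverse (s t) ^ (n - j) * c j t) = 0) sequentially"
  proof eventually_elim
    case (elim t)
    have "(\<Sum>j\<le>n. inverse (s t) ^ (n - j) * c j t) = (\<Sum>j\<le>n. inverse (s t) ^ n * (s t ^ j * c j t))"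
    proof (rule sum.cong[OF refl])
      fix j assume "j \<in> {..n}"
      hence "inverse (s t) ^ n * s t ^ j = inverse (s t) ^ (n - j) * (inverse (s t) ^ j * s t ^ j)"
        by (simp add: power_add[symmetric] mult.assoc[symmetric])
      also have "inverse (s t) ^ j * s t ^ j = 1" using elim by (simp add: power_mult_distrib[symmetric])
      finally show "inverse (s t) ^ (n - j) * c j t = inverse (s t) ^ n * (s t ^ j * c j t)"
        by (simp add: mult.assoc[symmetric])
    qed
    also have "\<dots> = inverse (s t) ^ n * (\<Sum>j\<le>n. s t ^ j * c j t)" by (simp only: sum_distrib_left)
    finally show ?case using zero[of t] by simp
  qed
  hence "(\<lambda>t. \<Sum>j\<le>n. inverse (s t) ^ (n - j) * c j t) \<longlonglongrightarrow> 0" by (rule tendsto_eventually)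
  with lim show ?thesis by (rule LIMSEQ_unique)
qed

lemma tendsto_of_norm_less_inverse_Suc:
  fixes f :: "nat \<Rightarrow> complex"
  assumes "\<And>t. norm (a - f t) < inverse (real (Suc t))"
  shows "f \<longlonglongrightarrow> a"
proof (rule LIM_zero_cancel, rule Lim_null_comparison)
  show "(\<lambda>t. inverse (real (Suc t))) \<longlonglongrightarrow> 0" by (rule LIMSEQ_inverse_real_of_nat)
  show "eventually (\<lambda>t. norm (f t - a) \<le> inverse (real (Suc t))) sequentially"
    using assms by (intro always_eventually allI) (metis less_imp_le norm_minus_commute)
qed

lemma continuous_on_complex_space_tendsto:
  assumes F: "continuous_map (complex_space d) euclidean F"
    and x: "x \<in> topspace (complex_space d)" and X: "\<And>t. X t \<in> topspace (complex_space d)"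
    and lim: "\<And>i. i < d \<Longrightarrow> (\<lambda>t. X t i) \<longlonglongrightarrow> x i"
  shows "(\<lambda>t. F (X t)) \<longlonglongrightarrow> F x"
proof -
  have "limitin (complex_space d) X x sequentially"
    unfolding complex_space_def limitin_componentwise
    using x X lim by (auto simp: complex_space_def PiE_def)
  from continuous_map_limit[OF F this] show ?thesis by (simp add: o_def)
qed

theorem theorem2:
  fixes r N n lam :: nat
    and \<alpha> :: "nat \<Rightarrow> real"
    and l :: "nat \<Rightarrow> nat"
    and b :: "nat \<Rightarrow> nat \<Rightarrow> nat \<Rightarrow> complex"
    and k :: "nat \<Rightarrow> nat \<Rightarrow> nat"
    and K :: "nat \<Rightarrow> nat"
    and B :: "nat \<Rightarrow> complex mat"
    and \<phi> :: "complex \<Rightarrow> complex"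
    and \<sigma>0 :: real
    and F :: "nat \<Rightarrow> (nat \<Rightarrow> complex) \<Rightarrow> complex"
    and Z :: "nat \<Rightarrow> nat \<Rightarrow> complex \<Rightarrow> complex"
  assumes "r \<ge> 1"
    and "\<And>j. j \<in> {1..r} \<Longrightarrow> 0 < \<alpha> j \<and> \<alpha> j < 1"
    and "algebraically_independent_rat {1..r} \<alpha>"
    and "\<And>j. j \<in> {1..r} \<Longrightarrow> l j \<ge> 1"
    and "lam = (\<Sum>j=1..r. l j)"
    and "\<And>j i. j \<in> {1..r} \<Longrightarrow> i \<in> {1..l j} \<Longrightarrow> is_minimal_period (b j i) (k j i)"
    and "\<And>j i. j \<in> {1..r} \<Longrightarrow> i \<in> {1..l j} \<Longrightarrow> \<exists>m. b j i m \<noteq> 0"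
    and "\<And>j. j \<in> {1..r} \<Longrightarrow> K j = Lcm (k j ` {1..l j})"
    and "\<And>j. j \<in> {1..r} \<Longrightarrow> B j = Matrix.mat (K j) (l j) (\<lambda>(m, i). b j (Suc i) (Suc m))"
    and "\<And>j. j \<in> {1..r} \<Longrightarrow> vec_space.rank (K j) (B j) = l j"
    and "in_class_S_tilde \<sigma>0 \<phi>"
    and "N \<ge> 1"
    and "\<And>j. j \<in> {0..n} \<Longrightarrow> continuous_map (complex_space (N * (lam + 1))) euclidean (F j)"
    and "\<And>j i. j \<in> {1..r} \<Longrightarrow> i \<in> {1..l j} \<Longrightarrow> Z j i = periodic_hurwitz_zeta (\<alpha> j) (b j i)"
    and "\<And>s. Re s > \<sigma>0 \<Longrightarrow> \<not> is_pole \<phi> s \<Longrightarrow>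
           (\<And>j i. j \<in> {1..r} \<Longrightarrow> i \<in> {1..l j} \<Longrightarrow> \<not> is_pole (Z j i) s) \<Longrightarrow>
           (\<Sum>j=0..n. s ^ j * F j (tuple_of_list (zeta_args N \<phi> r l Z s))) = 0"
  shows "\<forall>j\<in>{0..n}. \<forall>x\<in>topspace (complex_space (N * (lam + 1))). F j x = 0"
proof -
  note asm = assms
  define d where "d = N * (lam + 1)"
  define Lb where "Lb = arg_labels N r l"
  have pos: "\<alpha> j > 0" if "j \<in> {1..r}" for j using asm(2)[OF that] by blast
  have period: "is_period (b j i) (k j i)" if "j \<in> {1..r}" "i \<in> {1..l j}" for j i
    using asm(6)[OF that] by (simp add: is_minimal_period_def)
  have K0: "K j > 0" if j: "j \<in> {1..r}" for j
  proof -
    have "0 \<notin> k j ` {1..l j}" using period[OF j] by (force simp: is_period_def)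
    hence "Lcm (k j ` {1..l j}) \<noteq> 0" by (subst Lcm_0_iff) auto
    hence "K j \<noteq> 0" by (simp only: asm(8)[OF j] not_False_eq_True)
    thus ?thesis by linarith
  qed
  have per: "b j i (m + K j) = b j i m" if j: "j \<in> {1..r}" and i: "i \<in> {1..l j}" for j i m
    unfolding asm(8)[OF j] using period[OF j] i by (intro periodic_lcm) auto
  define C where "C = (\<lambda>j. \<Sum>i\<in>{1..l j}. \<Sum>t<k j i. norm (b j i t))"
  have bounded: "norm (b j i m) \<le> C j" if j: "j \<in> {1..r}" and i: "i \<in> {1..l j}" for j i m
  proof -
    have "norm (b j i m) \<le> (\<Sum>t<k j i. norm (b j i t))" by (rule periodic_bounded[OF period[OF j i]])
    also have "\<dots> \<le> C j" unfolding C_def using i by (intro member_le_sum) (auto intro: sum_nonneg)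
    finally show ?thesis .
  qed
  have rank: "\<exists>m. (\<Sum>i\<in>{1..l j}. b j i m * u i) \<noteq> 0" if j: "j \<in> {1..r}" and u: "\<exists>i\<in>{1..l j}. u i \<noteq> 0" for j u
  proof -
    obtain i where i: "i \<in> {1..l j}" "u i \<noteq> 0" using u by blast
    have car: "B j \<in> carrier_mat (K j) (l j)" unfolding asm(9)[OF j] by simp
    \<comment> \<open>Columns and rows of \<open>B j\<close> are numbered from 0, the sequences and
      the rows of the original matrix from 1.\<close>
    have i': "i - 1 < l j" "u (Suc (i - 1)) \<noteq> 0" using i by auto
    from full_column_rank_injective[OF car asm(10)[OF j], of "i - 1" "\<lambda>i. u (Suc i)"] i'
    obtain m where m: "m < K j" "(\<Sum>i<l j. B j $$ (m, i) * u (Suc i)) \<noteq> 0" by blast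
    have "(\<Sum>i<l j. B j $$ (m, i) * u (Suc i)) = (\<Sum>i<l j. b j (Suc i) (Suc m) * u (Suc i))"
      unfolding asm(9)[OF j] using m(1) by (intro sum.cong refl) simp
    also have "\<dots> = (\<Sum>i\<in>{1..l j}. b j i (Suc m) * u i)"
      by (simp add: sum.atLeast1_atMost_eq)
    finally show ?thesis using m(2) by metis
  qed
  obtain h :: nat and A where A: "\<And>j p. j \<in> {1..h} \<Longrightarrow> prime p \<Longrightarrow> norm (A j p) \<le> 1"
    and \<phi>: "\<And>s. Re s > 1 \<Longrightarrow> \<phi> s = exp (dser 1 (\<lambda>m. log_coeff h A (Suc m)) 0 s)"
    and ns: "\<not> summable (\<lambda>p. if prime p then norm (\<Sum>j=1..h. A j p) / real p else 0)"
    by (rule class_S_tilde_exp_log[OF asm(11)]) (rule that; simp)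
  define c where "c = (\<lambda>m. log_coeff h A (Suc m))"
  define S where "S = {s. Re s > 1}"
  have S: "open S" unfolding S_def by (rule open_halfspace_Re_gt)
  have cbound: "norm (c m) \<le> real h * (real m + 1) powr 0" for m
    using norm_log_coeff_le[of h A 0 "Suc m"] A by (simp add: c_def prime_gt_0_nat)
  have bbound: "norm (b j i m) \<le> C j * (real m + \<alpha> j) powr 0" if "j \<in> {1..r}" "i \<in> {1..l j}" for j i m
    using bounded[OF that, of m] pos[OF that(1)] by simp
  have hol: "dser \<beta> f 0 holomorphic_on S"
    if "\<beta> > 0" "\<And>m. norm (f m) \<le> D * (real m + \<beta>) powr 0" for \<beta> f D
    unfolding S_def
    by (subst holomorphic_on_open[OF open_halfspace_Re_gt])
       (use dser_has_field_derivative[OF that, of _ 0] in auto)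
  have L_hol: "dser 1 c 0 holomorphic_on S" by (rule hol[OF _ cbound]) simp
  have L_deriv: "(deriv ^^ \<nu>) (dser 1 c 0) s = dser 1 c \<nu> s" if "s \<in> S" for \<nu> s
    by (rule higher_deriv_eq_dser[OF _ cbound]) (use that in \<open>auto simp: S_def\<close>)
  have \<phi>': "\<phi> s = exp (dser 1 c 0 s)" if "s \<in> S" for s
    using \<phi> that unfolding S_def c_def by simp
  have \<phi>_deriv: "(deriv ^^ \<nu>) \<phi> s = exp_derivs (\<lambda>k. dser 1 c k s) \<nu>" if "s \<in> S" for \<nu> s
    using higher_deriv_exp[OF S L_hol \<phi>' that, of \<nu>] L_deriv[OF that] by simp
  have "(\<lambda>s. exp (dser 1 c 0 s)) holomorphic_on S" by (intro holomorphic_intros L_hol)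
  hence \<phi>_hol: "\<phi> holomorphic_on S" by (rule holomorphic_transform) (simp add: \<phi>')
  have Z_eq: "Z j i s = dser (\<alpha> j) (b j i) 0 s" if ji: "j \<in> {1..r}" "i \<in> {1..l j}" and s: "s \<in> S" for j i s
  proof -
    have "is_periodic_hurwitz_zeta (\<alpha> j) (b j i) (Z j i)"
      unfolding asm(14)[OF ji] by (rule periodic_hurwitz_exists[OF pos[OF ji(1)] period[OF ji]])
    hence "(\<lambda>m. b j i m * of_real (real m + \<alpha> j) powr (- s)) sums Z j i s"
      using s by (simp add: is_periodic_hurwitz_zeta_def S_def)
    thus ?thesis by (simp add: dser_def sums_iff)
  qed
  have Z_deriv: "(deriv ^^ \<nu>) (Z j i) s = dser (\<alpha> j) (b j i) \<nu> s"
    if ji: "j \<in> {1..r}" "i \<in> {1..l j}" and s: "s \<in> S" for j i s \<nu>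
    by (rule higher_deriv_eq_dser[OF pos[OF ji(1)] bbound[OF ji]]) (use s Z_eq[OF ji] in \<open>auto simp: S_def\<close>)
  have Z_hol: "Z j i holomorphic_on S" if ji: "j \<in> {1..r}" "i \<in> {1..l j}" for j i
    by (rule holomorphic_transform[OF hol[OF pos[OF ji(1)] bbound[OF ji]]]) (simp add: Z_eq[OF ji])
  \<comment> \<open>For Re s > 1 all functions involved are holomorphic, so the relation holds there
    without exceptional points.\<close>
  have zero: "(\<Sum>j\<le>n. s ^ j * F j (tuple_of_list (zeta_args N \<phi> r l Z s))) = 0" if s: "s \<in> S" for s
  proof -
    have "\<sigma>0 < 1" using asm(11) by (simp add: in_class_S_tilde_def)
    hence "Re s > \<sigma>0" using s by (simp add: S_def)
    moreover have "\<not> is_pole \<phi> s" by (rule not_is_pole_holomorphic[OF S s \<phi>_hol])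
    moreover have "\<not> is_pole (Z j i) s" if "j \<in> {1..r}" "i \<in> {1..l j}" for j i
      by (rule not_is_pole_holomorphic[OF S s Z_hol[OF that]])
    ultimately have "(\<Sum>j=0..n. s ^ j * F j (tuple_of_list (zeta_args N \<phi> r l Z s))) = 0"
      by (rule asm(15))
    thus ?thesis by (simp only: atMost_atLeast0)
  qed
  have len: "length Lb = d" unfolding Lb_def length_arg_labels d_def asm(5) ..
  have N_le: "N \<le> d" by (simp add: d_def)
  have args: "zeta_args N \<phi> r l Z s = map (\<lambda>(j, i, \<nu>). (deriv ^^ \<nu>) (if j = 0 then \<phi> else Z j i) s) Lb" for s
    unfolding Lb_def by (rule zeta_args_eq_map)
  define T where "T = (\<lambda>s. tuple_of_list (zeta_args N \<phi> r l Z s))"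
  have T_top: "T s \<in> topspace (complex_space d)" for s
    using tuple_of_list_in_space[of "zeta_args N \<phi> r l Z s"] by (simp add: T_def args len)
  \<comment> \<open>Coordinate 0 is the prospective value of \<phi>, an exponential, and hence must
    not be 0.\<close>
  have approach: "\<exists>s. (\<forall>t. s t \<in> S) \<and> filterlim s at_infinity sequentially \<and> (\<forall>i<d. (\<lambda>t. T (s t) i) \<longlonglongrightarrow> x i)"
    if x0: "x 0 \<noteq> 0" for x :: "nat \<Rightarrow> complex"
  proof -
    \<comment> \<open>The position of a label, inverse to \<open>Lb\<close>.\<close>
    define ix where "ix = (\<lambda>lab. SOME i. i < d \<and> Lb ! i = lab)"
    have ix: "ix (Lb ! i) = i" if "i < d" for i
    proof -
      have "ix (Lb ! i) < d \<and> Lb ! (ix (Lb ! i)) = Lb ! i"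
        unfolding ix_def by (rule someI[of _ i]) (use that in simp)
      thus ?thesis using nth_eq_iff_index_eq[OF distinct_arg_labels[of N r l]] that len
        unfolding Lb_def by blast
    qed
    \<comment> \<open>The first \<open>N\<close> coordinates of \<open>x\<close> are the derivatives
      of \<phi> in order, so \<open>log_derivs\<close> applies to \<open>x\<close> directly; its
      entry \<nu> reads only coordinates up to \<nu>.\<close>
    define y0 where "y0 = log_derivs x"
    define y where "y = (\<lambda>j (i, \<nu>). x (ix (j, i, \<nu>)))"
    have "\<exists>s. Re s > 1 \<and> Im s > real t \<and>
       (\<forall>\<nu><N. norm (y0 \<nu> - dser 1 c \<nu> s) < inverse (real (Suc t))) \<and>
       (\<forall>j\<in>{1..r}. \<forall>i\<in>{1..l j}. \<forall>\<nu><N. norm (y j (i, \<nu>) - dser (\<alpha> j) (b j i) \<nu> s) < inverse (real (Suc t)))" for t :: nat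
      unfolding c_def
      by (rule joint_values_approx[OF asm(3) pos K0 per bounded rank A ns]) auto
    from choice[OF allI[OF this]] obtain s where s: "\<forall>t. Re (s t) > 1 \<and> Im (s t) > real t \<and>
       (\<forall>\<nu><N. norm (y0 \<nu> - dser 1 c \<nu> (s t)) < inverse (real (Suc t))) \<and>
       (\<forall>j\<in>{1..r}. \<forall>i\<in>{1..l j}. \<forall>\<nu><N. norm (y j (i, \<nu>) - dser (\<alpha> j) (b j i) \<nu> (s t)) < inverse (real (Suc t)))"
      by (rule exE)
    have sS: "s t \<in> S" for t using s by (simp add: S_def)
    have "filterlim s at_infinity sequentially"
    proof (rule filterlim_norm_at_top_imp_at_infinity, rule filterlim_at_top_mono[OF filterlim_real_sequentially])
      show "eventually (\<lambda>t. real t \<le> norm (s t)) sequentially"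
        using s abs_Im_le_cmod by (intro always_eventually allI) (smt (verit, best))
    qed
    moreover have "(\<lambda>t. T (s t) i) \<longlonglongrightarrow> x i" if i: "i < d" for i
    proof -
      obtain j i' \<nu> where lab: "Lb ! i = (j, i', \<nu>)" by (cases "Lb ! i") auto
      have T: "T (s t) i = (deriv ^^ \<nu>) (if j = 0 then \<phi> else Z j i') (s t)" for t
        unfolding T_def tuple_of_list_def args using i len by (simp add: lab)
      have "Lb ! i \<in> set Lb" using i len by (intro nth_mem) simp
      from this[unfolded lab, unfolded Lb_def set_arg_labels]
      have cases: "j = 0 \<and> i' = 0 \<and> \<nu> < N \<or> j \<in> {1..r} \<and> i' \<in> {1..l j} \<and> \<nu> < N"
        by blast
      show ?thesis
      proof (cases "j = 0")
        case True
        hence 0: "i' = 0" "\<nu> < N" using cases by auto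
        have eq: "Lb ! \<nu> = Lb ! i" using arg_labels_nth[OF 0(2), of r l] True 0 lab by (simp add: Lb_def)
        have "\<nu> < d" using 0(2) N_le by linarith
        from ix[OF this] ix[OF i] have \<nu>: "\<nu> = i" unfolding eq by (rule trans[OF sym])
        have "(\<lambda>t. exp_derivs (\<lambda>k. dser 1 c k (s t)) \<nu>) \<longlonglongrightarrow> exp_derivs y0 \<nu>"
        proof (rule tendsto_exp_derivs)
          fix q assume "q \<le> \<nu>"
          hence "q < N" using 0(2) by simp
          thus "(\<lambda>t. dser 1 c q (s t)) \<longlonglongrightarrow> y0 q"
            using s by (intro tendsto_of_norm_less_inverse_Suc) blast
        qed
        moreover have "exp_derivs y0 \<nu> = x i" unfolding y0_def \<nu> by (rule exp_log_derivs[of x, OF x0])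
        ultimately show ?thesis using True \<phi>_deriv[OF sS] by (simp add: T)
      next
        case False
        hence j: "j \<in> {1..r}" "i' \<in> {1..l j}" "\<nu> < N" using cases by auto
        have "(\<lambda>t. dser (\<alpha> j) (b j i') \<nu> (s t)) \<longlonglongrightarrow> y j (i', \<nu>)"
          using s j by (intro tendsto_of_norm_less_inverse_Suc) blast
        moreover have "y j (i', \<nu>) = x i" using ix[OF i] by (simp add: y_def lab)
        ultimately show ?thesis using False Z_deriv[OF j(1,2) sS] by (simp add: T)
      qed
    qed
    ultimately show ?thesis using sS by blast
  qed
  have cont: "continuous_map (complex_space d) euclidean (F j)" if "j \<le> n" for j
    using asm(13)[of j] that unfolding d_def by simp
  have "\<forall>x\<in>topspace (complex_space d). F m x = 0" if "m \<le> n" for m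
    using that
  \<comment> \<open>Descending on the index: once all later coefficients vanish identically,
    \<open>F m\<close> is the leading one of the remaining relation.\<close>
  proof (induction "n - m" arbitrary: m rule: less_induct)
    case less
    have higher: "F j x = 0" if "m < j" "j \<le> n" "x \<in> topspace (complex_space d)" for j x
      using less.hyps[of j] that by (metis diff_less_mono2 less_le_trans)
    have nonzero: "F m x = 0" if x: "x \<in> topspace (complex_space d)" and x0: "x 0 \<noteq> 0" for x
    proof -
      obtain s where s: "\<And>t. s t \<in> S" "filterlim s at_infinity sequentially"
        "\<And>i. i < d \<Longrightarrow> (\<lambda>t. T (s t) i) \<longlonglongrightarrow> x i"
        using approach[of x, OF x0] by blast
      show ?thesis
      proof (rule tendsto_leading_coefficient_zero[OF s(2)])
        fix j assume "j \<le> m"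
        thus "(\<lambda>t. F j (T (s t))) \<longlonglongrightarrow> F j x"
          using less.prems by (intro continuous_on_complex_space_tendsto[OF cont x T_top s(3)]) auto
      next
        fix t
        have "(\<Sum>j\<le>m. s t ^ j * F j (T (s t))) = (\<Sum>j\<le>n. s t ^ j * F j (T (s t)))"
          by (rule sum.mono_neutral_left) (use less.prems higher T_top in auto)
        thus "(\<Sum>j\<le>m. s t ^ j * F j (T (s t))) = 0" using zero[OF s(1)] by (simp add: T_def)
      qed
    qed
    show ?case
    proof
      fix x assume x: "x \<in> topspace (complex_space d)"
      show "F m x = 0"
      proof (cases "x 0 = 0")
        case True
        have d0: "0 < d" using asm(12) by (simp add: d_def)
        \<comment> \<open>Continuity recovers the points with \<open>x 0 = 0\<close>: only
          coordinate 0 is moved, through the nonzero values 1 / (t + 1).\<close>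
        define X where "X = (\<lambda>t. x(0 := complex_of_real (inverse (real (Suc t)))))"
        have X: "X t \<in> topspace (complex_space d)" for t
          using x d0 by (auto simp: complex_space_def X_def PiE_def extensional_def)
        have "(\<lambda>t. complex_of_real (inverse (real (Suc t)))) \<longlonglongrightarrow> of_real 0"
          by (intro tendsto_of_real LIMSEQ_inverse_real_of_nat)
        hence "(\<lambda>t. X t i) \<longlonglongrightarrow> x i" for i
          using True by (cases "i = 0") (simp_all add: X_def)
        hence "(\<lambda>t. F m (X t)) \<longlonglongrightarrow> F m x"
          by (rule continuous_on_complex_space_tendsto[OF cont[OF less.prems] x X])
        moreover have "F m (X t) = 0" for t
          by (rule nonzero[OF X]) (simp add: X_def del: of_nat_Suc)
        ultimately show ?thesis by (simp add: LIMSEQ_const_iff)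
      qed (rule nonzero[OF x])
    qed
  qed
  thus ?thesis unfolding d_def by simp
qed

end
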